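(* Let $w_T,w_\Omega:\mathbb{R}\to[0,\infty)$ be weight functions such that: (i) both $w_T$ and $w_\Omega$ satisfy the non-degeneracy condition; (ii) both weight functions $1+w_T$ and $1+w_\Omega$ satisfy the regularity condition. For $\alpha>0$ and $\tau\in\mathbb{R}$ let $g_{\alpha,\tau}(t)=\sqrt{\alpha}\,\exp\big(-\pi\alpha(t-\tau)^2\big)$, $t\in\mathbb{R}$. Then: 1. $g_{\alpha,\tau}\in\mathcal{H}_{w_T,w_\Omega}$ for every $\alpha>0$ and every $\tau\in\mathbb{R}$. 2. The family $\{g_{\alpha,\tau}\}_{\alpha>0,\,\tau\in\mathbb{R}}$ is complete in $\mathcal{H}_{w_T,w_\Omega}$, i.e. its (complex) linear span is dense in $\mathcal{H}_{w_T,w_\Omega}$ with respect to the norm $\|\cdot\|_{\mathcal{H}_{w_T,w_\Omega}}$.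
   Context: A weight function is a Lebesgue measurable function $w:\mathbb{R}\to\mathbb{R}$ with $0\le w(\xi)<\infty$ for all $\xi\in\mathbb{R}$. $L^2(\mathbb{R},w(\xi)d\xi)$ is the space of measurable complex-valued functions $x$ with $\|x\|_{L^2(\mathbb{R},w(\xi)d\xi)}=\big(\int_{\mathbb{R}}|x(\xi)|^2w(\xi)\,d\xi\big)^{1/2}<\infty$ (functions at distance zero are identified). The Fourier transform is $\hat{x}(\omega)=\int_{\mathbb{R}}x(t)e^{-2\pi i\omega t}\,dt$, extended to $L^2(\mathbb{R},dt)$ as a unitary operator onto $L^2(\mathbb{R},d\omega)$. For weight functions $w_T,w_\Omega$, the space $\mathcal{H}_{w_T,w_\Omega}$ is the set of all $x\in L^2(\mathbb{R},dt)$ with $x\in L^2(\mathbb{R},w_T(t)dt)$ and $\hat{x}\in L^2(\mathbb{R},w_\Omega(\omega)d\omega)$, with inner product $\langle x_1,x_2\rangle_{\mathcal{H}_{w_T,w_\Omega}}=\int_{\mathbb{R}}x_1(t)\overline{x_2(t)}w_T(t)\,dt+\int_{\mathbb{R}}\hat{x}_1(\omega)\overline{\hat{x}_2(\omega)}w_\Omega(\omega)\,d\omega$ and $\|x\|^2_{\mathcal{H}_{w_T,w_\Omega}}=\langle x,x\rangle_{\mathcal{H}_{w_T,w_\Omega}}$. Non-degeneracy condition: a weight function $w$ satisfies it if there exists $\varepsilon>0$ such that the set $\{\xi\in\mathbb{R}: w(\xi)<\varepsilon\}$ has finite Lebesgue measure. Regularity condition: for a weight function $w$ with $w(\xi)>0$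 for all $\xi\in\mathbb{R}$, the multiplicative modulus of continuity is $M_w(\delta)=\sup\{w(\xi')/w(\xi''):\ \xi',\xi''\in\mathbb{R},\ |\xi'-\xi''|\le\delta\}\in[1,\infty]$ for $\delta\ge0$. Such a $w$ satisfies the regularity condition if $M_w(\delta)<\infty$ for all $\delta>0$ (equivalently, for some $\delta>0$). *)

theory Defs
  imports "HOL-Analysis.Analysis" "HOL-Library.Function_Algebras"
begin

definition weight_function :: "(real \<Rightarrow> real) \<Rightarrow> bool" where
  "weight_function w \<longleftrightarrow> w \<in> borel_measurable lebesgue \<and> (\<forall>\<xi>. 0 \<le> w \<xi>)"

text \<open>
  Elements of the spaces below are represented by honest functions; functions at
  distance zero are not quotiented out, so the norms are only seminorms.
\<close>

definition L2 :: "(real \<Rightarrow> real) \<Rightarrow> (real \<Rightarrow> complex) set" where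
  "L2 w = {x \<in> borel_measurable lebesgue. integrable lebesgue (\<lambda>\<xi>. (cmod (x \<xi>))\<^sup>2 * w \<xi>)}"

definition L2_norm :: "(real \<Rightarrow> real) \<Rightarrow> (real \<Rightarrow> complex) \<Rightarrow> real" where
  "L2_norm w x = sqrt (LINT \<xi>|lebesgue. (cmod (x \<xi>))\<^sup>2 * w \<xi>)"

definition fourier_integral :: "(real \<Rightarrow> complex) \<Rightarrow> real \<Rightarrow> complex" where
  "fourier_integral x \<omega> =
     (LINT t|lebesgue. x t * exp (- 2 * of_real pi * \<i> * of_real \<omega> * of_real t))"

text \<open>
  The extension of the Fourier integral to \<open>L\<^sup>2(\<real>)\<close> by continuity:
  \<open>is_fourier_L2\<close> is the closure in \<open>L\<^sup>2 \<times> L\<^sup>2\<close> of the graph of the Fourier integral on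
  \<open>L\<^sup>1 \<inter> L\<^sup>2\<close>. By Plancherel's theorem, every \<open>x\<close> in \<open>L\<^sup>2\<close> has such a \<open>y\<close>, unique up to
  null sets, and the condition \<open>fourier_integral (X n) \<in> L2 (\<lambda>_. 1)\<close> always holds. It is
  listed because the integral in \<open>L2_norm\<close> is \<open>0\<close> for non-integrable arguments.
\<close>

definition is_fourier_L2 :: "(real \<Rightarrow> complex) \<Rightarrow> (real \<Rightarrow> complex) \<Rightarrow> bool" where
  "is_fourier_L2 x y \<longleftrightarrow>
     x \<in> L2 (\<lambda>_. 1) \<and> y \<in> L2 (\<lambda>_. 1) \<and>
     (\<exists>X :: nat \<Rightarrow> real \<Rightarrow> complex.
        (\<forall>n. integrable lebesgue (X n) \<and> X n \<in> L2 (\<lambda>_. 1) \<and>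
             fourier_integral (X n) \<in> L2 (\<lambda>_. 1)) \<and>
        (\<lambda>n. L2_norm (\<lambda>_. 1) (\<lambda>t. X n t - x t)) \<longlonglongrightarrow> 0 \<and>
        (\<lambda>n. L2_norm (\<lambda>_. 1) (\<lambda>\<omega>. fourier_integral (X n) \<omega> - y \<omega>)) \<longlonglongrightarrow> 0)"

definition fourier_L2 :: "(real \<Rightarrow> complex) \<Rightarrow> real \<Rightarrow> complex" where
  "fourier_L2 x = (SOME y. is_fourier_L2 x y)"

definition H_space :: "(real \<Rightarrow> real) \<Rightarrow> (real \<Rightarrow> real) \<Rightarrow> (real \<Rightarrow> complex) set" where
  "H_space w\<^sub>T w\<^sub>\<Omega> = {x \<in> L2 (\<lambda>_. 1). x \<in> L2 w\<^sub>T \<and> fourier_L2 x \<in> L2 w\<^sub>\<Omega>}"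

definition H_inner ::
    "(real \<Rightarrow> real) \<Rightarrow> (real \<Rightarrow> real) \<Rightarrow> (real \<Rightarrow> complex) \<Rightarrow> (real \<Rightarrow> complex) \<Rightarrow> complex" where
  "H_inner w\<^sub>T w\<^sub>\<Omega> x\<^sub>1 x\<^sub>2 =
     (LINT t|lebesgue. x\<^sub>1 t * cnj (x\<^sub>2 t) * of_real (w\<^sub>T t)) +
     (LINT \<omega>|lebesgue. fourier_L2 x\<^sub>1 \<omega> * cnj (fourier_L2 x\<^sub>2 \<omega>) * of_real (w\<^sub>\<Omega> \<omega>))"

definition H_norm :: "(real \<Rightarrow> real) \<Rightarrow> (real \<Rightarrow> real) \<Rightarrow> (real \<Rightarrow> complex) \<Rightarrow> real" where
  "H_norm w\<^sub>T w\<^sub>\<Omega> x = sqrt (Re (H_inner w\<^sub>T w\<^sub>\<Omega> x x))"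

definition nondegenerate :: "(real \<Rightarrow> real) \<Rightarrow> bool" where
  "nondegenerate w \<longleftrightarrow> (\<exists>\<epsilon>>0. emeasure lebesgue {\<xi>. w \<xi> < \<epsilon>} < \<infinity>)"

definition mult_modulus :: "(real \<Rightarrow> real) \<Rightarrow> real \<Rightarrow> ennreal" where
  "mult_modulus w \<delta> = Sup {ennreal (w \<xi>' / w \<xi>'') | \<xi>' \<xi>''. \<bar>\<xi>' - \<xi>''\<bar> \<le> \<delta>}"

definition regular_weight :: "(real \<Rightarrow> real) \<Rightarrow> bool" where
  "regular_weight w \<longleftrightarrow> (\<forall>\<xi>. 0 < w \<xi>) \<and> (\<forall>\<delta>>0. mult_modulus w \<delta> < \<infinity>)"

definition gauss :: "real \<Rightarrow> real \<Rightarrow> real \<Rightarrow> complex" where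
  "gauss \<alpha> \<tau> t = complex_of_real (sqrt \<alpha> * exp (- pi * \<alpha> * (t - \<tau>)\<^sup>2))"

interpretation cfun: vector_space "\<lambda>(c::complex) (f::real \<Rightarrow> complex) t. c * f t"
  by unfold_locales (auto simp: fun_eq_iff algebra_simps)

definition complete_in_H ::
    "(real \<Rightarrow> real) \<Rightarrow> (real \<Rightarrow> real) \<Rightarrow> (real \<Rightarrow> complex) set \<Rightarrow> bool" where
  "complete_in_H w\<^sub>T w\<^sub>\<Omega> G \<longleftrightarrow>
     cfun.span G \<subseteq> H_space w\<^sub>T w\<^sub>\<Omega> \<and>
     (\<forall>x\<in>H_space w\<^sub>T w\<^sub>\<Omega>. \<forall>\<epsilon>>0. \<exists>y\<in>cfun.span G. H_norm w\<^sub>T w\<^sub>\<Omega> (\<lambda>t. x t - y t) < \<epsilon>)"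

end

theory Submission
  imports Defs "HOL-Probability.Characteristic_Functions"
begin

text \<open>
  Let \<open>G\<close> be the Gaussian of width \<open>e\<close> and unit mass and \<open>H\<close> its Fourier transform. For \<open>x\<close> in the
  space, mollify and cut off: \<open>H \<cdot> (x * G)\<close> has Fourier transform \<open>G * (x^ \<cdot> H)\<close>, so both sides have
  the same shape. Regularity makes translations bounded, with exponential growth, and strongly continuous in the
  weighted norms, so that as \<open>e\<close> tends to \<open>0\<close> both sides converge to \<open>x\<close> and \<open>x^\<close>. The
  product \<open>H(t) G(t - s)\<close> is, as a function of \<open>t\<close>, a Gaussian of fixed width times a factor
  decaying like a Gaussian in \<open>s\<close>; hence \<open>H \<cdot> (x * G)\<close> is an absolutely convergent superposition
  of members of the family, and its Riemann sums lie in their span. Everything is carried out in the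
  stronger norms with weights \<open>1 + w\<close>.
\<close>

section \<open>Weighted square integrals\<close>

text \<open>Two functions have to be approximated at once and by the same finite combination: x in
  one weighted norm and its transform in the other. What is a cut-off after a mollification on one
  side is a mollification after a cut-off on the other, so both orders have to be controlled. The
  first needs that the multiplier is a contraction, the second a bound for the mollifier that is
  uniform in its width; the latter holds because a Gaussian kernel integrates every exponential.
  Regularity speaks of 1 + w and not of w, which may vanish, and it is membership in the unweighted
  space that makes the stronger norm of x finite. A second obstacle is \<open>fourier_L2\<close>: it
  is a choice, fixed only up to null sets, and acts on Lebesgue measurable functions. The analysis
  is therefore done for Borel functions, with squared norms in \<open>ennreal\<close> and with pairs
  of a function and its transform in place of an operator; versions are exchanged at the
  end.\<close>

text \<open>The squared norm takes values in \<open>ennreal\<close>, so that estimates need no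
  integrability conditions and finiteness expresses membership in the weighted space.\<close>

definition sqn :: "(real \<Rightarrow> real) \<Rightarrow> (real \<Rightarrow> complex) \<Rightarrow> ennreal" where
  "sqn W f = (\<integral>\<^sup>+t. ennreal ((cmod (f t))\<^sup>2 * W t) \<partial>lborel)"

text \<open>The exponential bound is what iterating the modulus of continuity at step 1 yields. The
  lower bound 1 makes each weighted norm dominate the unweighted one.\<close>

definition moderate :: "(real \<Rightarrow> real) \<Rightarrow> bool" where
  "moderate W \<longleftrightarrow> W \<in> borel_measurable borel \<and> (\<forall>t. 1 \<le> W t) \<and>
     (\<exists>C c. 0 \<le> C \<and> 0 \<le> c \<and> (\<forall>s t. W (t + s) \<le> C * exp (c * \<bar>s\<bar>) * W t))"

lemma moderateD [measurable_dest]: "moderate W \<Longrightarrow> W \<in> borel_measurable borel"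
  by (simp add: moderate_def)

lemma moderate_ge1: "moderate W \<Longrightarrow> 1 \<le> W t"
  by (simp add: moderate_def)

lemma moderate_nonneg: "moderate W \<Longrightarrow> 0 \<le> W t"
  using moderate_ge1[of W t] by linarith

lemma moderate_one: "moderate (\<lambda>_. 1)"
  unfolding moderate_def by (auto intro!: exI[of _ 1])

section \<open>Limits at zero in the extended nonnegative reals\<close>

lemma ennreal_tendsto_0_iff:
  fixes X :: "'a \<Rightarrow> ennreal"
  shows "(X \<longlongrightarrow> 0) F \<longleftrightarrow> (\<forall>e::real. 0 < e \<longrightarrow> (\<forall>\<^sub>F n in F. X n \<le> ennreal e))"
proof
  assume "(X \<longlongrightarrow> 0) F"
  then show "\<forall>e::real. 0 < e \<longrightarrow> (\<forall>\<^sub>F n in F. X n \<le> ennreal e)"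
    unfolding order_tendsto_iff by (metis (mono_tags, lifting) ennreal_less_zero_iff eventually_mono less_imp_le)
next
  assume *: "\<forall>e::real. 0 < e \<longrightarrow> (\<forall>\<^sub>F n in F. X n \<le> ennreal e)"
  show "(X \<longlongrightarrow> 0) F"
  proof (rule order_tendstoI)
    fix a :: ennreal assume "0 < a"
    then obtain e where "0 < e" "ennreal e < a"
      by (metis dense ennreal_cases ennreal_less_zero_iff neq_top_trans order_less_imp_le top.not_eq_extremum)
    with * show "\<forall>\<^sub>F n in F. X n < a"
      by (auto elim!: eventually_mono)
  qed auto
qed

lemma ennreal_tendsto_0_le:
  fixes X Y :: "'a \<Rightarrow> ennreal"
  assumes "(Y \<longlongrightarrow> 0) F" "\<forall>\<^sub>F n in F. X n \<le> Y n"
  shows "(X \<longlongrightarrow> 0) F"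
  by (rule tendsto_sandwich[OF _ assms(2) tendsto_const assms(1)]) auto

lemma ennreal_tendsto_0_cmult:
  fixes X :: "'a \<Rightarrow> ennreal"
  assumes "(X \<longlongrightarrow> 0) F" "K < \<infinity>"
  shows "((\<lambda>n. K * X n) \<longlongrightarrow> 0) F"
  using ennreal_tendsto_cmult[of K X 0 F] assms by auto

lemma norm_add_square_le: "(norm (a + b))\<^sup>2 \<le> 2 * (norm a)\<^sup>2 + 2 * (norm (b :: 'a :: real_normed_vector))\<^sup>2"
proof -
  have "(norm (a + b))\<^sup>2 \<le> (norm a + norm b)\<^sup>2"
    by (intro power_mono norm_triangle_ineq) auto
  also have "\<dots> \<le> 2 * (norm a)\<^sup>2 + 2 * (norm b)\<^sup>2"
    using zero_le_power2[of "norm a - norm b"] by (simp add: power2_eq_square algebra_simps)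
  finally show ?thesis .
qed

section \<open>Algebra and integral inequalities for weighted square integrals\<close>

lemma sqn_cong: "(\<And>t. f t = g t) \<Longrightarrow> sqn W f = sqn W g"
  by (simp add: sqn_def)

lemma sqn_cong_AE: "AE t in lborel. f t = g t \<Longrightarrow> sqn W f = sqn W g"
  unfolding sqn_def by (rule nn_integral_cong_AE) auto

lemma sqn_uminus: "sqn W (\<lambda>t. - f t) = sqn W f"
  by (simp add: sqn_def)

lemma sqn_minus_commute: "sqn W (\<lambda>t. f t - g t) = sqn W (\<lambda>t. g t - f t)"
  by (simp add: sqn_def norm_minus_commute)

lemma sqn_cmult:
  assumes [measurable]: "f \<in> borel_measurable borel" "W \<in> borel_measurable borel"
  shows "sqn W (\<lambda>t. c * f t) = ennreal ((cmod c)\<^sup>2) * sqn W f"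
  unfolding sqn_def
  by (subst nn_integral_cmult[symmetric])
     (auto simp: norm_mult power_mult_distrib ennreal_mult' [symmetric] mult.assoc)

lemma sqn_mono:
  assumes "\<And>t. cmod (f t) \<le> cmod (g t)" "\<And>t. 0 \<le> W t"
  shows "sqn W f \<le> sqn W g"
  unfolding sqn_def
  by (intro nn_integral_mono ennreal_leI mult_right_mono power_mono) (auto simp: assms)

lemma sqn_weight_mono:
  assumes "\<And>t. W t \<le> V t"
  shows "sqn W f \<le> sqn V f"
  unfolding sqn_def by (intro nn_integral_mono ennreal_leI mult_left_mono) (auto simp: assms)

lemma sqn_add:
  assumes [measurable]: "f \<in> borel_measurable borel" "g \<in> borel_measurable borel"
    "W \<in> borel_measurable borel" and W: "\<And>t. 0 \<le> W t"
  shows "sqn W (\<lambda>t. f t + g t) \<le> 2 * sqn W f + 2 * sqn W g"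
proof -
  have "sqn W (\<lambda>t. f t + g t) \<le> (\<integral>\<^sup>+t. 2 * ennreal ((cmod (f t))\<^sup>2 * W t) + 2 * ennreal ((cmod (g t))\<^sup>2 * W t) \<partial>lborel)"
    unfolding sqn_def
  proof (rule nn_integral_mono)
    fix t
    have "(cmod (f t + g t))\<^sup>2 * W t \<le> (2 * (cmod (f t))\<^sup>2 + 2 * (cmod (g t))\<^sup>2) * W t"
      by (intro mult_right_mono norm_add_square_le W)
    then show "ennreal ((cmod (f t + g t))\<^sup>2 * W t) \<le> 2 * ennreal ((cmod (f t))\<^sup>2 * W t) + 2 * ennreal ((cmod (g t))\<^sup>2 * W t)"
      using W[of t]
      by (simp add: algebra_simps ennreal_mult[symmetric] flip: ennreal_numeral ennreal_plus)
  qed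
  also have "\<dots> = 2 * sqn W f + 2 * sqn W g"
    unfolding sqn_def by (subst nn_integral_add) (auto simp: nn_integral_cmult)
  finally show ?thesis .
qed

lemma sqn_diff_triangle:
  assumes [measurable]: "f \<in> borel_measurable borel" "g \<in> borel_measurable borel" "h \<in> borel_measurable borel"
    "W \<in> borel_measurable borel" and W: "\<And>t. 0 \<le> W t"
  shows "sqn W (\<lambda>t. f t - h t) \<le> 2 * sqn W (\<lambda>t. f t - g t) + 2 * sqn W (\<lambda>t. g t - h t)"
  using sqn_add[of "\<lambda>t. f t - g t" "\<lambda>t. g t - h t" W] W by simp

text \<open>Splitting |k| into two square roots and applying Cauchy-Schwarz in s bounds the square
  pointwise in t; Tonelli then exchanges the two integrals. It is used for mollification, with k the
  Gaussian, and for discretisation, with k the superposition density.\<close>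

lemma sqn_Jensen:
  fixes k :: "real \<Rightarrow> complex" and F :: "real \<Rightarrow> real \<Rightarrow> complex"
  assumes [measurable]: "k \<in> borel_measurable borel" "W \<in> borel_measurable borel"
    and F [measurable]: "case_prod F \<in> borel_measurable (borel \<Otimes>\<^sub>M borel)"
    and W: "\<And>t. 0 \<le> W t"
  shows "sqn W (\<lambda>t. LINT s|lborel. k s * F s t)
    \<le> (\<integral>\<^sup>+s. ennreal (cmod (k s)) \<partial>lborel) * (\<integral>\<^sup>+s. ennreal (cmod (k s)) * sqn W (F s) \<partial>lborel)"
proof -
  let ?A = "\<integral>\<^sup>+s. ennreal (cmod (k s)) \<partial>lborel"
  have pt: "ennreal ((cmod (LINT s|lborel. k s * F s t))\<^sup>2 * W t)
      \<le> ?A * (\<integral>\<^sup>+s. ennreal (cmod (k s)) * ennreal ((cmod (F s t))\<^sup>2 * W t) \<partial>lborel)" for t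
  proof -
    \<comment> \<open>If the integrand is not integrable, the Bochner integral is 0 and the bound is
      trivial, so \<open>F\<close> needs measurability only.\<close>
    have "ennreal (cmod (LINT s|lborel. k s * F s t)) \<le> (\<integral>\<^sup>+s. ennreal (cmod (k s * F s t)) \<partial>lborel)"
      by (cases "integrable lborel (\<lambda>s. k s * F s t)")
         (simp_all add: integral_norm_bound_ennreal not_integrable_integral_eq)
    also have "\<dots> = (\<integral>\<^sup>+s. ennreal (sqrt (cmod (k s))) * ennreal (sqrt (cmod (k s)) * cmod (F s t)) \<partial>lborel)"
      by (intro nn_integral_cong) (simp add: norm_mult mult.assoc[symmetric] flip: ennreal_mult)
    finally have "(ennreal (cmod (LINT s|lborel. k s * F s t)))\<^sup>2
        \<le> (\<integral>\<^sup>+s. ennreal (sqrt (cmod (k s))) * ennreal (sqrt (cmod (k s)) * cmod (F s t)) \<partial>lborel)\<^sup>2"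
      by (rule power_mono) simp
    also have "\<dots> \<le> (\<integral>\<^sup>+s. (ennreal (sqrt (cmod (k s))))\<^sup>2 \<partial>lborel) *
        (\<integral>\<^sup>+s. (ennreal (sqrt (cmod (k s)) * cmod (F s t)))\<^sup>2 \<partial>lborel)"
      by (rule Cauchy_Schwarz_nn_integral) auto
    also have "\<dots> = ?A * (\<integral>\<^sup>+s. ennreal (cmod (k s)) * ennreal ((cmod (F s t))\<^sup>2) \<partial>lborel)"
      by (simp add: ennreal_power power_mult_distrib ennreal_mult)
    finally have "(ennreal (cmod (LINT s|lborel. k s * F s t)))\<^sup>2 * ennreal (W t)
        \<le> ?A * (\<integral>\<^sup>+s. ennreal (cmod (k s)) * ennreal ((cmod (F s t))\<^sup>2) \<partial>lborel) * ennreal (W t)"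
      by (rule mult_right_mono) simp
    then show ?thesis
      by (simp add: ennreal_power ennreal_mult W nn_integral_multc mult.assoc[symmetric])
  qed
  have "sqn W (\<lambda>t. LINT s|lborel. k s * F s t)
      \<le> (\<integral>\<^sup>+t. ?A * (\<integral>\<^sup>+s. ennreal (cmod (k s)) * ennreal ((cmod (F s t))\<^sup>2 * W t) \<partial>lborel) \<partial>lborel)"
    unfolding sqn_def by (intro nn_integral_mono pt)
  also have "\<dots> = ?A * (\<integral>\<^sup>+t. (\<integral>\<^sup>+s. ennreal (cmod (k s)) * ennreal ((cmod (F s t))\<^sup>2 * W t) \<partial>lborel) \<partial>lborel)"
    by (rule nn_integral_cmult) measurable
  also have "(\<integral>\<^sup>+t. (\<integral>\<^sup>+s. ennreal (cmod (k s)) * ennreal ((cmod (F s t))\<^sup>2 * W t) \<partial>lborel) \<partial>lborel) =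
      (\<integral>\<^sup>+s. (\<integral>\<^sup>+t. ennreal (cmod (k s)) * ennreal ((cmod (F s t))\<^sup>2 * W t) \<partial>lborel) \<partial>lborel)"
    by (rule lborel_pair.Fubini') measurable
  also have "\<dots> = (\<integral>\<^sup>+s. ennreal (cmod (k s)) * sqn W (F s) \<partial>lborel)"
    unfolding sqn_def by (intro nn_integral_cong nn_integral_cmult) measurable
  finally show ?thesis .
qed

text \<open>A change of variables moves the shift from the function to the weight, where the
  moderate growth bound applies.\<close>

lemma sqn_translate:
  assumes [measurable]: "f \<in> borel_measurable borel" "W \<in> borel_measurable borel"
    and C: "\<And>s t. W (t + s) \<le> C * exp (c * \<bar>s\<bar>) * W t" "0 \<le> C"
  shows "sqn W (\<lambda>t. f (t - s)) \<le> ennreal (C * exp (c * \<bar>s\<bar>)) * sqn W f"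
proof -
  have "sqn W (\<lambda>t. f (t - s)) = (\<integral>\<^sup>+t. ennreal ((cmod (f t))\<^sup>2 * W (t + s)) \<partial>lborel)"
    unfolding sqn_def
    by (subst nn_integral_real_affine[where c=1 and t=s]) (auto simp: add.commute)
  also have "\<dots> \<le> (\<integral>\<^sup>+t. ennreal (C * exp (c * \<bar>s\<bar>)) * ennreal ((cmod (f t))\<^sup>2 * W t) \<partial>lborel)"
  proof (rule nn_integral_mono)
    fix t
    have "(cmod (f t))\<^sup>2 * W (t + s) \<le> (cmod (f t))\<^sup>2 * (C * exp (c * \<bar>s\<bar>) * W t)"
      by (intro mult_left_mono C) auto
    then show "ennreal ((cmod (f t))\<^sup>2 * W (t + s)) \<le> ennreal (C * exp (c * \<bar>s\<bar>)) * ennreal ((cmod (f t))\<^sup>2 * W t)"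
      using C(2) by (subst ennreal_mult'[symmetric]) (auto intro!: ennreal_leI simp: mult_ac)
  qed
  also have "\<dots> = ennreal (C * exp (c * \<bar>s\<bar>)) * sqn W f"
    unfolding sqn_def by (rule nn_integral_cmult) auto
  finally show ?thesis .
qed

lemma sqn_dominated_convergence:
  assumes [measurable]: "\<And>n. u n \<in> borel_measurable borel" "f \<in> borel_measurable borel" "W \<in> borel_measurable borel"
    "B \<in> borel_measurable borel"
    and W: "\<And>t. 0 \<le> W t"
    and bound: "\<And>n. AE t in lborel. cmod (u n t - f t) \<le> B t"
    and fin: "(\<integral>\<^sup>+t. ennreal ((B t)\<^sup>2 * W t) \<partial>lborel) < \<infinity>"
    and lim: "AE t in lborel. (\<lambda>n. u n t) \<longlonglongrightarrow> f t"
  shows "(\<lambda>n. sqn W (\<lambda>t. u n t - f t)) \<longlonglongrightarrow> 0"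
proof -
  have "(\<lambda>n. \<integral>\<^sup>+t. ennreal ((cmod (u n t - f t))\<^sup>2 * W t) \<partial>lborel) \<longlonglongrightarrow> (\<integral>\<^sup>+t. 0 \<partial>(lborel :: real measure))"
  proof (rule nn_integral_dominated_convergence[where w="\<lambda>t. ennreal ((B t)\<^sup>2 * W t)"])
    show "AE t in lborel. ennreal ((cmod (u n t - f t))\<^sup>2 * W t) \<le> ennreal ((B t)\<^sup>2 * W t)" for n
      using bound[of n] by eventually_elim (intro ennreal_leI mult_right_mono power_mono W, auto)
    show "AE t in lborel. (\<lambda>n. ennreal ((cmod (u n t - f t))\<^sup>2 * W t)) \<longlonglongrightarrow> 0"
      using lim
    proof eventually_elim
      case (elim t)
      then have "(\<lambda>n. (cmod (u n t - f t))\<^sup>2 * W t) \<longlonglongrightarrow> (cmod (f t - f t))\<^sup>2 * W t"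
        by (intro tendsto_intros)
      then show ?case
        using tendsto_ennrealI by fastforce
    qed
  qed (use fin in auto)
  then show ?thesis by (simp add: sqn_def)
qed

section \<open>Truncation, density of continuous functions, continuity of translation\<close>

lemma moderate_bounded_on:
  assumes "moderate W"
  obtains K where "0 \<le> K" "\<And>t. \<bar>t\<bar> \<le> R \<Longrightarrow> W t \<le> K"
proof -
  from assms obtain C c where C: "0 \<le> C" "0 \<le> c" "\<And>s t. W (t + s) \<le> C * exp (c * \<bar>s\<bar>) * W t"
    unfolding moderate_def by blast
  show ?thesis
  proof
    show "0 \<le> C * exp (c * R) * W 0" using C moderate_nonneg[OF assms] by simp
    fix t assume t: "\<bar>t\<bar> \<le> R"
    have "W t \<le> C * exp (c * \<bar>t\<bar>) * W 0" using C(3)[of 0 t] by simp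
    also have "\<dots> \<le> C * exp (c * R) * W 0"
      using C t moderate_nonneg[OF assms] by (intro mult_right_mono mult_left_mono) (auto intro: mult_left_mono)
    finally show "W t \<le> C * exp (c * R) * W 0" .
  qed
qed

lemma nn_integral_bounded_support:
  assumes W: "moderate W"
  shows "(\<integral>\<^sup>+t. ennreal ((B * indicator {-R..R} t)\<^sup>2 * W t) \<partial>lborel) < \<infinity>"
proof -
  obtain K where K: "0 \<le> K" "\<And>t. \<bar>t\<bar> \<le> R \<Longrightarrow> W t \<le> K"
    using moderate_bounded_on[OF W] by metis
  have "(\<integral>\<^sup>+t. ennreal ((B * indicator {-R..R} t)\<^sup>2 * W t) \<partial>lborel) \<le> (\<integral>\<^sup>+t. ennreal (B\<^sup>2 * K) * indicator {-R..R} t \<partial>lborel)"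
    using K by (intro nn_integral_mono) (auto split: split_indicator intro!: ennreal_leI mult_left_mono)
  also have "\<dots> < \<infinity>"
    by (cases "-R \<le> R") (auto simp: nn_integral_cmult ennreal_mult_less_top)
  finally show ?thesis .
qed

text \<open>The difference is 0 or -f at each point, so f itself is the majorant. Truncating size
  and support together produces functions that are integrable as well as square integrable.\<close>

lemma sqn_truncate_tendsto:
  assumes [measurable]: "f \<in> borel_measurable borel" and W: "moderate W" and fin: "sqn W f < \<infinity>"
  shows "(\<lambda>n::nat. sqn W (\<lambda>t. (if cmod (f t) \<le> n \<and> \<bar>t\<bar> \<le> n then f t else 0) - f t)) \<longlonglongrightarrow> 0"
proof (rule sqn_dominated_convergence[where B="\<lambda>t. cmod (f t)"])
  note [measurable] = moderateD[OF W]
  show "W \<in> borel_measurable borel" by measurable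
  show "AE t in lborel. (\<lambda>n::nat. if cmod (f t) \<le> n \<and> \<bar>t\<bar> \<le> n then f t else 0) \<longlonglongrightarrow> f t"
  proof (rule AE_I2)
    fix t
    obtain N :: nat where "max (cmod (f t)) \<bar>t\<bar> \<le> N" using real_arch_simple by blast
    then have "\<forall>\<^sub>F n::nat in sequentially. f t = (if cmod (f t) \<le> n \<and> \<bar>t\<bar> \<le> n then f t else 0)"
      by (intro eventually_sequentiallyI[of N]) auto
    then show "(\<lambda>n::nat. if cmod (f t) \<le> n \<and> \<bar>t\<bar> \<le> n then f t else 0) \<longlonglongrightarrow> f t"
      by (rule Lim_transform_eventually[rotated]) simp
  qed
  show "(\<integral>\<^sup>+ t. ennreal ((cmod (f t))\<^sup>2 * W t) \<partial>lborel) < \<infinity>" using fin by (simp add: sqn_def)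
qed (auto simp: moderate_nonneg[OF W])

text \<open>A measurable function is almost everywhere a limit of continuous ones, but without
  control of size or support. Truncating f beforehand makes it harmless to force such control on the
  continuous functions, and dominated convergence then applies.\<close>

lemma sqn_dense_continuous:
  assumes [measurable]: "f \<in> borel_measurable borel" and W: "moderate W" and fin: "sqn W f < \<infinity>" and e: "0 < (e::real)"
  obtains g B R where "continuous_on UNIV g" "\<And>t. cmod (g t) \<le> B" "\<And>t. \<bar>t\<bar> > R \<Longrightarrow> g t = 0"
    "0 \<le> R" "sqn W (\<lambda>t. g t - f t) \<le> ennreal e"
proof -
  note [measurable] = moderateD[OF W]
  define fn where "fn n t = (if cmod (f t) \<le> real n \<and> \<bar>t\<bar> \<le> real n then f t else 0)" for n t
  have fn_meas [measurable]: "fn n \<in> borel_measurable borel" for n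
    unfolding fn_def by measurable
  \<comment> \<open>The condition \<open>n \<ge> 1\<close> keeps the denominator of the clipping map
    \<open>cl\<close> away from 0. The quarter pays for the factor 2 in
    \<open>sqn_diff_triangle\<close>, applied to two errors.\<close>
  have "\<forall>\<^sub>F n in sequentially. sqn W (\<lambda>t. fn n t - f t) \<le> ennreal (e/4) \<and> n \<ge> 1"
    using sqn_truncate_tendsto[OF assms(1-3)] e eventually_ge_at_top[of "1::nat"]
    unfolding fn_def ennreal_tendsto_0_iff by (intro eventually_conj) auto
  then obtain n where n: "sqn W (\<lambda>t. fn n t - f t) \<le> ennreal (e/4)" "n \<ge> 1"
    using eventually_happens' sequentially_bot by blast
  have "fn n measurable_on UNIV"
    by (rule lebesgue_measurable_imp_measurable_on) (auto intro: measurable_completion)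
  then obtain N g where N: "negligible N" and g: "\<And>k. continuous_on UNIV (g k)"
    and lim: "\<And>t. t \<notin> N \<Longrightarrow> (\<lambda>k. g k t) \<longlonglongrightarrow> fn n t"
    unfolding measurable_on_def by auto
  have ae: "AE t in lborel. t \<notin> N"
    using N unfolding negligible_iff_null_sets by (metis AE_completion_iff AE_not_in)
  \<comment> \<open>Clip to the disc of radius \<open>n\<close> and cut off outside \<open>[-n-1, n+1]\<close>; both leave \<open>fn n\<close> unchanged.\<close>
  define cl where "cl z = complex_of_real (real n / max (real n) (cmod z)) * z" for z
  define ct where "ct t = complex_of_real (max 0 (min 1 (real n + 1 - \<bar>t\<bar>)))" for t
  have cl_cont: "continuous_on UNIV cl"
    unfolding cl_def using n by (intro continuous_intros) auto
  have cl_bd: "cmod (cl z) \<le> n" for z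
    unfolding cl_def norm_mult norm_of_real using n by (simp add: max_def field_simps)
  have ct_bd: "cmod (ct t) \<le> 1" for t by (auto simp: ct_def)
  define h where "h k t = cl (g k t) * ct t" for k t
  have h_cont: "continuous_on UNIV (h k)" for k
    unfolding h_def ct_def
    by (intro continuous_intros continuous_on_compose2[OF cl_cont g]) auto
  have h_bd: "cmod (h k t) \<le> n" for k t
    unfolding h_def norm_mult using mult_mono[OF cl_bd ct_bd] by simp
  have h_0: "h k t = 0" if "\<bar>t\<bar> > real n + 1" for k t
    using that by (simp add: h_def ct_def)
  have [measurable]: "h k \<in> borel_measurable borel" for k
    by (intro borel_measurable_continuous_onI h_cont)
  have "(\<lambda>k. sqn W (\<lambda>t. h k t - fn n t)) \<longlonglongrightarrow> 0"
  proof (rule sqn_dominated_convergence[where B="\<lambda>t. (2 * real n) * indicator {-(real n + 1)..real n + 1} t"])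
    show "AE t in lborel. cmod (h k t - fn n t) \<le> 2 * real n * indicator {-(real n + 1)..real n + 1} t" for k
    proof (rule AE_I2)
      fix t
      have "cmod (h k t - fn n t) \<le> cmod (h k t) + cmod (fn n t)" by (rule norm_triangle_ineq4)
      also have "\<dots> \<le> 2 * real n" using h_bd[of k t] by (auto simp: fn_def)
      finally show "cmod (h k t - fn n t) \<le> 2 * real n * indicator {-(real n + 1)..real n + 1} t"
        using h_0[of t k] by (auto simp: fn_def split: split_indicator)
    qed
    show "AE t in lborel. (\<lambda>k. h k t) \<longlonglongrightarrow> fn n t"
      using ae
    proof eventually_elim
      case (elim t)
      have "isCont cl (fn n t)" using cl_cont by (simp add: continuous_on_eq_continuous_at)
      from isCont_tendsto_compose[OF this lim[OF elim]]
      have "(\<lambda>k. h k t) \<longlonglongrightarrow> cl (fn n t) * ct t" unfolding h_def by (intro tendsto_intros)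
      moreover have "cl (fn n t) * ct t = fn n t"
        using n by (auto simp: cl_def ct_def fn_def max_def)
      ultimately show ?case by simp
    qed
  qed (use nn_integral_bounded_support[OF W, of "2 * real n" "real n + 1"] in \<open>auto simp: moderate_nonneg[OF W]\<close>)
  then have "\<forall>\<^sub>F k in sequentially. sqn W (\<lambda>t. h k t - fn n t) \<le> ennreal (e/4)"
    unfolding ennreal_tendsto_0_iff using e by auto
  then obtain k where k: "sqn W (\<lambda>t. h k t - fn n t) \<le> ennreal (e/4)"
    using eventually_happens' sequentially_bot by blast
  show thesis
  proof
    have "sqn W (\<lambda>t. h k t - f t) \<le> 2 * sqn W (\<lambda>t. h k t - fn n t) + 2 * sqn W (\<lambda>t. fn n t - f t)"
      by (rule sqn_diff_triangle) (auto simp: moderate_nonneg[OF W])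
    also have "\<dots> \<le> 2 * ennreal (e/4) + 2 * ennreal (e/4)"
      by (intro add_mono mult_left_mono k n) auto
    also have "\<dots> = ennreal e" using e by (simp flip: ennreal_numeral ennreal_mult ennreal_plus)
    finally show "sqn W (\<lambda>t. h k t - f t) \<le> ennreal e" .
    show "continuous_on UNIV (h k)" "\<And>t. cmod (h k t) \<le> n" "\<And>t. \<bar>t\<bar> > real n + 1 \<Longrightarrow> h k t = 0"
      using h_cont h_bd h_0 by auto
  qed auto
qed

text \<open>For a continuous function of compact support the claim is dominated convergence. The
  general case follows by density, since translations by at most 1 are bounded on the weighted
  space.\<close>

lemma sqn_translate_tendsto:
  assumes f [measurable]: "f \<in> borel_measurable borel" and W: "moderate W" and fin: "sqn W f < \<infinity>"
    and s: "s \<longlonglongrightarrow> (0::real)"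
  shows "(\<lambda>n. sqn W (\<lambda>t. f (t - s n) - f t)) \<longlonglongrightarrow> 0"
  unfolding ennreal_tendsto_0_iff
proof (intro allI impI)
  fix e :: real assume e: "0 < e"
  note [measurable] = moderateD[OF W]
  note W0 = moderate_nonneg[OF W]
  from W obtain C c where C: "0 \<le> C" "0 \<le> c" "\<And>s t. W (t + s) \<le> C * exp (c * \<bar>s\<bar>) * W t"
    unfolding moderate_def by blast
  \<comment> \<open>\<open>K\<close> collects the coefficients of the density error \<open>d\<close>
    in the final estimate: \<open>2 * C * exp c\<close> from its translate by at most 1, and 4 from
    two uses of the triangle inequality.\<close>
  define K where "K = 2 * C * exp c + 4"
  have K: "K > 0" using C by (auto simp: K_def intro: add_nonneg_pos)
  define d where "d = e / (2 * K)"
  have d: "d > 0" using e K by (simp add: d_def)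
  obtain g B R where g: "continuous_on UNIV g" "\<And>t. cmod (g t) \<le> B" "\<And>t. \<bar>t\<bar> > R \<Longrightarrow> g t = 0"
    "0 \<le> R" "sqn W (\<lambda>t. g t - f t) \<le> ennreal d"
    using sqn_dense_continuous[OF f W fin d] by metis
  have [measurable]: "g \<in> borel_measurable borel"
    by (intro borel_measurable_continuous_onI g)
  have s1: "\<forall>\<^sub>F n in sequentially. \<bar>s n\<bar> \<le> 1"
    using tendsto_rabs[OF s] by (simp add: order_tendsto_iff) (metis (mono_tags, lifting) eventually_mono less_imp_le zero_less_one)
  then obtain N where N: "\<And>n. n \<ge> N \<Longrightarrow> \<bar>s n\<bar> \<le> 1" by (auto simp: eventually_sequentially)
  \<comment> \<open>Starting at \<open>N\<close> keeps all shifts at most 1, so that a single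
    interval of radius R + 1 contains the supports of all the differences.\<close>
  have "(\<lambda>n. sqn W (\<lambda>t. g (t - s (n + N)) - g t)) \<longlonglongrightarrow> 0"
  proof (rule sqn_dominated_convergence[where B="\<lambda>t. (2 * B) * indicator {-(R + 1)..R + 1} t"])
    show "AE t in lborel. cmod (g (t - s (n + N)) - g t) \<le> 2 * B * indicator {-(R + 1)..R + 1} t" for n
    proof (rule AE_I2)
      fix t
      have "cmod (g (t - s (n + N)) - g t) \<le> cmod (g (t - s (n + N))) + cmod (g t)" by (rule norm_triangle_ineq4)
      also have "\<dots> \<le> 2 * B" using g(2)[of t] g(2)[of "t - s (n + N)"] by simp
      finally show "cmod (g (t - s (n + N)) - g t) \<le> 2 * B * indicator {-(R + 1)..R + 1} t"
        using g(3)[of t] g(3)[of "t - s (n + N)"] N[of "n + N"] by (auto split: split_indicator)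
    qed
    show "AE t in lborel. (\<lambda>n. g (t - s (n + N))) \<longlonglongrightarrow> g t"
    proof (rule AE_I2)
      fix t
      have "(\<lambda>n. t - s (n + N)) \<longlonglongrightarrow> t - 0"
        by (intro tendsto_intros LIMSEQ_ignore_initial_segment s)
      then have "(\<lambda>n. t - s (n + N)) \<longlonglongrightarrow> t" by simp
      moreover have "isCont g t" using g(1) by (simp add: continuous_on_eq_continuous_at)
      ultimately show "(\<lambda>n. g (t - s (n + N))) \<longlonglongrightarrow> g t" by (metis isCont_tendsto_compose)
    qed
  qed (use nn_integral_bounded_support[OF W, of "2*B" "R+1"] in \<open>auto simp: W0\<close>)
  then have "(\<lambda>n. sqn W (\<lambda>t. g (t - s n) - g t)) \<longlonglongrightarrow> 0"
    by (rule LIMSEQ_offset)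
  then have "\<forall>\<^sub>F n in sequentially. sqn W (\<lambda>t. g (t - s n) - g t) \<le> ennreal (e / 8)"
    unfolding ennreal_tendsto_0_iff using e by auto
  then show "\<forall>\<^sub>F n in sequentially. sqn W (\<lambda>t. f (t - s n) - f t) \<le> ennreal e"
    using s1
  proof eventually_elim
    case (elim n)
    have "sqn W (\<lambda>t. f (t - s n) - f t) \<le> 2 * sqn W (\<lambda>t. f (t - s n) - g (t - s n)) + 2 * sqn W (\<lambda>t. g (t - s n) - f t)"
      by (rule sqn_diff_triangle) (auto simp: W0)
    also have "\<dots> \<le> 2 * (ennreal (C * exp (c * \<bar>s n\<bar>)) * sqn W (\<lambda>t. f t - g t))
       + 2 * (2 * sqn W (\<lambda>t. g (t - s n) - g t) + 2 * sqn W (\<lambda>t. g t - f t))"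
      by (intro add_mono mult_left_mono sqn_translate[of "\<lambda>t. f t - g t"] sqn_diff_triangle) (auto simp: W0 C)
    also have "\<dots> \<le> 2 * (ennreal (C * exp c) * ennreal d)
       + 2 * (2 * ennreal (e / 8) + 2 * ennreal d)"
      using elim g(5) C by (intro add_mono mult_left_mono mult_mono ennreal_leI)
        (auto simp: sqn_minus_commute[of W f g] mult_left_le)
    also have "\<dots> = ennreal (K * d + e / 2)"
      using d e C by (simp add: K_def algebra_simps flip: ennreal_numeral ennreal_mult ennreal_plus)
    also have "K * d + e / 2 = e" using K by (simp add: d_def)
    finally show ?case .
  qed
qed

section \<open>Gaussian mollification\<close>

text \<open>This is the total mass of the normal density of variance 1/(2 pi), whose normalising
  constant is 1.\<close>

lemma nn_integral_gauss: "(\<integral>\<^sup>+u. ennreal (exp (- pi * u\<^sup>2)) \<partial>lborel) = 1"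
proof -
  define \<sigma> where "\<sigma> = 1 / sqrt (2 * pi)"
  have \<sigma>: "\<sigma> > 0" "\<sigma>\<^sup>2 = 1 / (2 * pi)" by (auto simp: \<sigma>_def power_divide)
  have "normal_density 0 \<sigma> u = exp (- pi * u\<^sup>2)" for u
    by (simp add: normal_density_def \<sigma>)
  moreover have "emeasure (density lborel (normal_density 0 \<sigma>)) UNIV = 1"
    using prob_space.emeasure_space_1[OF prob_space_normal_density[OF \<sigma>(1), of 0]] by simp
  ultimately show ?thesis by (simp add: emeasure_density)
qed

text \<open>Completing the square spends half of the quadratic decay on absorbing the linear term:
  c|u| - a u^2 is at most c^2/(2a) - (a/2) u^2, a normal density of variance 1/a up to a
  constant.\<close>

lemma integrable_exp_quad:
  assumes "a > 0" shows "integrable lborel (\<lambda>u::real. exp (c * \<bar>u\<bar> - a * u\<^sup>2))"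
proof (rule Bochner_Integration.integrable_bound)
  define \<sigma> where "\<sigma> = 1 / sqrt a"
  have \<sigma>: "\<sigma> > 0" "\<sigma>\<^sup>2 = 1 / a" using assms by (auto simp: \<sigma>_def power_divide)
  have "integrable lborel (\<lambda>u. (sqrt (2 * pi * \<sigma>\<^sup>2) * exp (c\<^sup>2 / (2 * a))) * normal_density 0 \<sigma> u)"
    by (intro integrable_mult_right integrable_normal_density \<sigma>)
  then show "integrable lborel (\<lambda>u. exp (c\<^sup>2 / (2 * a)) * exp (- (a / 2) * u\<^sup>2))"
    using assms by (simp add: normal_density_def \<sigma> field_simps)
  have "c * \<bar>u\<bar> - a * u\<^sup>2 \<le> c\<^sup>2 / (2 * a) + - (a / 2) * u\<^sup>2" for u
  proof -
    have "0 \<le> (a * \<bar>u\<bar> - c)\<^sup>2 / (2 * a)" using assms by simp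
    also have "\<dots> = a * u\<^sup>2 / 2 - c * \<bar>u\<bar> + c\<^sup>2 / (2 * a)"
      using assms by (simp add: power2_eq_square field_simps)
    finally show ?thesis by simp
  qed
  then show "AE u in lborel. norm (exp (c * \<bar>u\<bar> - a * u\<^sup>2)) \<le> norm (exp (c\<^sup>2 / (2 * a)) * exp (- (a / 2) * u\<^sup>2))"
    by (simp flip: exp_add)
qed simp

lemma integrable_exp_quad0: "a > 0 \<Longrightarrow> integrable lborel (\<lambda>u::real. exp (- a * u\<^sup>2))"
  using integrable_exp_quad[of a 0] by simp

lemma ennreal_mult_assoc: "0 \<le> a \<Longrightarrow> 0 \<le> b \<Longrightarrow> ennreal a * (ennreal b * X) = ennreal (a * b) * X"
  by (simp add: ennreal_mult mult.assoc)

text \<open>The factors 1 reproduce the integrand of \<open>sqn\<close> with constant weight, so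
  that the right-hand side integrates to a sum of two such terms.\<close>

lemma norm_mult_le_squares: "norm (a * b) \<le> (norm a)\<^sup>2 * 1 + (norm (b :: complex))\<^sup>2 * 1"
  using zero_le_power2[of "norm a - norm b"] mult_nonneg_nonneg[OF norm_ge_zero[of a] norm_ge_zero[of b]]
  unfolding power2_diff norm_mult by linarith

lemma integrable_L2_mult:
  assumes [measurable]: "f \<in> borel_measurable borel" "h \<in> borel_measurable borel"
    and fin: "sqn (\<lambda>_. 1) f < \<infinity>" "sqn (\<lambda>_. 1) h < \<infinity>"
  shows "integrable lborel (\<lambda>s. h s * f s)"
proof (rule integrableI_bounded)
  have "(\<integral>\<^sup>+ s. ennreal (norm (h s * f s)) \<partial>lborel) \<le>
      (\<integral>\<^sup>+ s. ennreal ((cmod (h s))\<^sup>2 * 1) + ennreal ((cmod (f s))\<^sup>2 * 1) \<partial>lborel)"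
    by (intro nn_integral_mono)
       (simp add: norm_mult_le_squares ennreal_leI del: mult_1_right flip: ennreal_plus)
  also have "\<dots> = sqn (\<lambda>_. 1) h + sqn (\<lambda>_. 1) f"
    unfolding sqn_def by (rule nn_integral_add) auto
  also have "\<dots> < \<infinity>" using fin by simp
  finally show "(\<integral>\<^sup>+ s. ennreal (norm (h s * f s)) \<partial>lborel) < \<infinity>" .
qed simp

lemma sqn_one_finite: "moderate W \<Longrightarrow> sqn W f < \<infinity> \<Longrightarrow> sqn (\<lambda>_. 1) f < \<infinity>"
  using sqn_weight_mono[of "\<lambda>_. 1" W f] moderate_ge1 by (meson le_less_trans)

section \<open>The Gaussian multiplier and the Gaussian mollifier\<close>

definition hat_mult :: "real \<Rightarrow> real \<Rightarrow> complex" where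
  "hat_mult e t = of_real (exp (- pi * (e * t)\<^sup>2))"

text \<open>In the overview, \<open>hat_kernel\<close> is G and \<open>hat_mult\<close> is H. For
  positive e the kernel has mass 1 and width e, and is the Fourier transform of the
  multiplier.\<close>

definition hat_kernel :: "real \<Rightarrow> real \<Rightarrow> complex" where
  "hat_kernel e t = of_real (exp (- pi * (t / e)\<^sup>2) / e)"

definition gconv :: "real \<Rightarrow> (real \<Rightarrow> complex) \<Rightarrow> real \<Rightarrow> complex" where
  "gconv e f t = (LINT s|lborel. hat_kernel e (t - s) * f s)"

lemma hat_measurable [measurable]:
  "hat_mult e \<in> borel_measurable borel" "hat_kernel e \<in> borel_measurable borel"
  unfolding hat_mult_def hat_kernel_def by measurable

lemma gconv_measurable [measurable]:
  assumes [measurable]: "f \<in> borel_measurable borel"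
  shows "gconv e f \<in> borel_measurable borel"
  unfolding gconv_def by measurable

lemma norm_hat_mult_le: "cmod (hat_mult e t) \<le> 1"
  by (simp add: hat_mult_def)

lemma sqn_exp_quad:
  assumes "a > 0"
  shows "sqn (\<lambda>_. 1) (\<lambda>u. of_real (b * exp (- a * (u - \<tau>)\<^sup>2))) < \<infinity>"
proof -
  have "integrable lborel (\<lambda>u. exp (- (2 * a) * (- \<tau> + 1 * u)\<^sup>2))"
    using integrable_exp_quad0[of "2 * a"] assms by (intro lborel_integrable_real_affine) auto
  then have "integrable lborel (\<lambda>u. b\<^sup>2 * exp (- (2 * a) * (u - \<tau>)\<^sup>2))"
    by (intro integrable_mult_right) simp
  moreover have "(cmod (of_real (b * exp (- a * (u - \<tau>)\<^sup>2))))\<^sup>2 * 1 = b\<^sup>2 * exp (- (2 * a) * (u - \<tau>)\<^sup>2)" for u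
    unfolding norm_of_real power2_abs power_mult_distrib exp_double[symmetric] by simp
  ultimately show ?thesis
    unfolding sqn_def by (simp only: integrable_iff_bounded) simp
qed

lemma sqn_hat_kernel: "e > 0 \<Longrightarrow> sqn (\<lambda>_. 1) (\<lambda>s. hat_kernel e (t - s)) < \<infinity>"
  using sqn_exp_quad[of "pi / e\<^sup>2" "1 / e" t]
  by (simp add: hat_kernel_def power_divide power2_commute[of t])

lemma sqn_hat_mult: "e > 0 \<Longrightarrow> sqn (\<lambda>_. 1) (hat_mult e) < \<infinity>"
  using sqn_exp_quad[of "pi * e\<^sup>2" "1" 0]
  by (simp add: hat_mult_def[abs_def] power_mult_distrib mult_ac)

text \<open>The substitution s = t - e u leaves e only in the shift. The kernel no longer depends on
  e, which permits majorants that are uniform in e.\<close>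

lemma gconv_eq:
  assumes "e > 0"
  shows "gconv e f t = (LINT u|lborel. of_real (exp (- pi * u\<^sup>2)) * f (t - e * u))"
proof -
  have "gconv e f t = \<bar>-e\<bar> *\<^sub>R (LINT u|lborel. hat_kernel e (t - (t + (-e) * u)) * f (t + (-e) * u))"
    unfolding gconv_def using assms by (intro lborel_integral_real_affine) auto
  also have "\<dots> = (LINT u|lborel. \<bar>-e\<bar> *\<^sub>R (hat_kernel e (t - (t + (-e) * u)) * f (t + (-e) * u)))"
    by simp
  also have "\<dots> = (LINT u|lborel. of_real (exp (- pi * u\<^sup>2)) * f (t - e * u))"
    using assms by (intro Bochner_Integration.integral_cong) (auto simp: hat_kernel_def scaleR_conv_of_real)
  finally show ?thesis .
qed

lemma integrable_gconv:
  assumes "e > 0" "f \<in> borel_measurable borel" "sqn (\<lambda>_. 1) f < \<infinity>"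
  shows "integrable lborel (\<lambda>s. hat_kernel e (t - s) * f s)"
  using assms by (intro integrable_L2_mult sqn_hat_kernel) auto

lemma integrable_gconv':
  assumes "e > 0" and [measurable]: "f \<in> borel_measurable borel" and "sqn (\<lambda>_. 1) f < \<infinity>"
  shows "integrable lborel (\<lambda>u. of_real (exp (- pi * u\<^sup>2)) * f (t - e * u))"
proof -
  have "integrable lborel (\<lambda>u. of_real e * (hat_kernel e (t - (t + (-e) * u)) * f (t + (-e) * u)))"
    using assms by (intro integrable_mult_right lborel_integrable_real_affine integrable_gconv) auto
  then show ?thesis using assms by (simp add: hat_kernel_def)
qed

lemma gconv_diff:
  assumes "e > 0" "f \<in> borel_measurable borel" "sqn (\<lambda>_. 1) f < \<infinity>" "g \<in> borel_measurable borel" "sqn (\<lambda>_. 1) g < \<infinity>"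
  shows "gconv e (\<lambda>s. f s - g s) t = gconv e f t - gconv e g t"
  unfolding gconv_def
  by (subst Bochner_Integration.integral_diff[symmetric])
     (auto intro!: integrable_gconv assms simp: right_diff_distrib)

text \<open>By \<open>sqn_Jensen\<close> the mollification costs an average of translation bounds,
  and for e at most 1 the growth in e u is dominated by the growth in u. Hence \<open>K\<close> is
  an integral of a Gaussian against an exponential and is independent of e.\<close>

lemma gconv_bound:
  assumes W: "moderate W"
  obtains K :: real where "0 \<le> K" "\<And>e f. 0 < e \<Longrightarrow> e \<le> 1 \<Longrightarrow> f \<in> borel_measurable borel \<Longrightarrow> sqn W (gconv e f) \<le> ennreal K * sqn W f"
proof -
  note [measurable] = moderateD[OF W]
  from W obtain C c where C: "0 \<le> C" "0 \<le> c" "\<And>s t. W (t + s) \<le> C * exp (c * \<bar>s\<bar>) * W t"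
    unfolding moderate_def by blast
  define K where "K = (LINT u|lborel. C * exp (c * \<bar>u\<bar> - pi * u\<^sup>2))"
  show thesis
  proof
    show "0 \<le> K" unfolding K_def using C by (intro Bochner_Integration.integral_nonneg) auto
    fix e :: real and f :: "real \<Rightarrow> complex" assume e: "0 < e" "e \<le> 1" and [measurable]: "f \<in> borel_measurable borel"
    have "sqn W (gconv e f) = sqn W (\<lambda>t. LINT u|lborel. of_real (exp (- pi * u\<^sup>2)) * f (t - e * u))"
      using e by (simp add: gconv_eq cong: sqn_cong)
    also have "\<dots> \<le> (\<integral>\<^sup>+u. ennreal (cmod (of_real (exp (- pi * u\<^sup>2)))) \<partial>lborel) *
        (\<integral>\<^sup>+u. ennreal (cmod (of_real (exp (- pi * u\<^sup>2)))) * sqn W (\<lambda>t. f (t - e * u)) \<partial>lborel)"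
      by (rule sqn_Jensen) (auto simp: moderate_nonneg[OF W])
    also have "\<dots> = (\<integral>\<^sup>+u. ennreal (exp (- pi * u\<^sup>2)) * sqn W (\<lambda>t. f (t - e * u)) \<partial>lborel)"
      using nn_integral_gauss by simp
    also have "\<dots> \<le> (\<integral>\<^sup>+u. ennreal (C * exp (c * \<bar>u\<bar> - pi * u\<^sup>2)) * sqn W f \<partial>lborel)"
    proof (rule nn_integral_mono)
      fix u
      have "sqn W (\<lambda>t. f (t - e * u)) \<le> ennreal (C * exp (c * \<bar>e * u\<bar>)) * sqn W f"
        by (rule sqn_translate[OF _ _ C(3,1)]) auto
      also have "\<dots> \<le> ennreal (C * exp (c * \<bar>u\<bar>)) * sqn W f"
        using C e by (intro mult_right_mono ennreal_leI mult_left_mono) (auto simp: abs_mult mult_left_le_one_le mult_left_mono)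
      finally have "ennreal (exp (- pi * u\<^sup>2)) * sqn W (\<lambda>t. f (t - e * u)) \<le> ennreal (exp (- pi * u\<^sup>2)) * (ennreal (C * exp (c * \<bar>u\<bar>)) * sqn W f)"
        by (rule mult_left_mono) simp
      also have "\<dots> = ennreal (C * exp (c * \<bar>u\<bar> - pi * u\<^sup>2)) * sqn W f"
        using C by (subst ennreal_mult_assoc) (simp_all add: exp_diff exp_minus divide_inverse mult_ac)
      finally show "ennreal (exp (- pi * u\<^sup>2)) * sqn W (\<lambda>t. f (t - e * u)) \<le> ennreal (C * exp (c * \<bar>u\<bar> - pi * u\<^sup>2)) * sqn W f" .
    qed
    also have "\<dots> = ennreal K * sqn W f"
      unfolding K_def using C
      by (simp add: nn_integral_multc nn_integral_eq_integral integrable_exp_quad)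
    finally show "sqn W (gconv e f) \<le> ennreal K * sqn W f" .
  qed
qed

text \<open>As the kernel has mass 1, the error is an average of f(t - e u) - f(t) over u. After
  \<open>sqn_Jensen\<close>, each translation error tends to 0, and dominated convergence in u
  finishes.\<close>

lemma gconv_tendsto:
  assumes [measurable]: "f \<in> borel_measurable borel" and W: "moderate W" and fin: "sqn W f < \<infinity>"
    and e: "e \<longlonglongrightarrow> 0" "\<And>n. 0 < e n" "\<And>n. e n \<le> (1::real)"
  shows "(\<lambda>n. sqn W (\<lambda>t. gconv (e n) f t - f t)) \<longlonglongrightarrow> 0"
proof (rule ennreal_tendsto_0_le)
  note [measurable] = moderateD[OF W]
  note W0 = moderate_nonneg[OF W]
  from W obtain C c where C: "0 \<le> C" "0 \<le> c" "\<And>s t. W (t + s) \<le> C * exp (c * \<bar>s\<bar>) * W t"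
    unfolding moderate_def by blast
  let ?g = "\<lambda>u::real. exp (- pi * u\<^sup>2)"
  let ?I = "\<lambda>n. \<integral>\<^sup>+u. ennreal (?g u) * sqn W (\<lambda>t. f (t - e n * u) - f t) \<partial>lborel"
  note fin1 = sqn_one_finite[OF W fin]
  have ig: "(LINT u|lborel. complex_of_real (?g u)) = 1"
    using nn_integral_gauss by (subst integral_complex_of_real) (simp add: integral_eq_nn_integral)
  show "\<forall>\<^sub>F n in sequentially. sqn W (\<lambda>t. gconv (e n) f t - f t) \<le> ?I n"
  proof (intro always_eventually allI)
    fix n
    have "gconv (e n) f t - f t = (LINT u|lborel. of_real (?g u) * (f (t - e n * u) - f t))" for t
    proof -
      have "(LINT u|lborel. of_real (?g u) * (f (t - e n * u) - f t))
        = (LINT u|lborel. of_real (?g u) * f (t - e n * u)) - (LINT u|lborel. of_real (?g u) * f t)"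
        using e integrable_exp_quad0[of pi] unfolding right_diff_distrib
        by (intro Bochner_Integration.integral_diff integrable_gconv' fin1 integrable_mult_left) auto
      also have "(LINT u|lborel. of_real (?g u) * f t) = f t"
        using ig by simp
      finally show ?thesis using e by (simp add: gconv_eq)
    qed
    then have "sqn W (\<lambda>t. gconv (e n) f t - f t) = sqn W (\<lambda>t. LINT u|lborel. of_real (?g u) * (f (t - e n * u) - f t))"
      by simp
    also have "\<dots> \<le> (\<integral>\<^sup>+u. ennreal (cmod (of_real (?g u))) \<partial>lborel) *
        (\<integral>\<^sup>+u. ennreal (cmod (of_real (?g u))) * sqn W (\<lambda>t. f (t - e n * u) - f t) \<partial>lborel)"
      by (rule sqn_Jensen) (auto simp: W0)
    also have "\<dots> = ?I n" using nn_integral_gauss by simp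
    finally show "sqn W (\<lambda>t. gconv (e n) f t - f t) \<le> ?I n" .
  qed
  have meas: "(\<lambda>u. sqn W (\<lambda>t. f (t - a * u) - f t)) \<in> borel_measurable borel" for a
    unfolding sqn_def by measurable
  \<comment> \<open>The vacuous \<open>0 * \<bar>u\<bar>\<close> gives the second summand of the
    majorant the shape of \<open>integrable_exp_quad\<close> with c = 0.\<close>
  have bd: "ennreal (?g u) * sqn W (\<lambda>t. f (t - e n * u) - f t) \<le>
      ennreal (2 * C * exp (c * \<bar>u\<bar> - pi * u\<^sup>2) + 2 * exp (0 * \<bar>u\<bar> - pi * u\<^sup>2)) * sqn W f" for u n
  proof -
    have "sqn W (\<lambda>t. f (t - e n * u) - f t) \<le> 2 * sqn W (\<lambda>t. f (t - e n * u)) + 2 * sqn W (\<lambda>t. - f t)"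
      using sqn_add[of "\<lambda>t. f (t - e n * u)" "\<lambda>t. - f t" W] W0 by simp
    also have "\<dots> \<le> 2 * (ennreal (C * exp (c * \<bar>e n * u\<bar>)) * sqn W f) + 2 * sqn W f"
      unfolding sqn_uminus by (intro add_mono mult_left_mono sqn_translate[OF _ _ C(3,1)]) auto
    also have "\<dots> \<le> 2 * (ennreal (C * exp (c * \<bar>u\<bar>)) * sqn W f) + 2 * sqn W f"
      using C e(2,3)[of n] by (intro add_mono mult_left_mono mult_right_mono ennreal_leI)
         (auto simp: abs_mult mult_left_le_one_le mult_left_mono)
    also have "\<dots> = ennreal (2 * C * exp (c * \<bar>u\<bar>) + 2) * sqn W f"
      using C by (simp add: ennreal_mult distrib_right mult.assoc)
    finally have "ennreal (?g u) * sqn W (\<lambda>t. f (t - e n * u) - f t) \<le> ennreal (?g u) * (ennreal (2 * C * exp (c * \<bar>u\<bar>) + 2) * sqn W f)"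
      by (rule mult_left_mono) simp
    also have "\<dots> = ennreal (?g u * (2 * C * exp (c * \<bar>u\<bar>) + 2)) * sqn W f"
      using C by (subst ennreal_mult_assoc) simp_all
    also have "?g u * (2 * C * exp (c * \<bar>u\<bar>) + 2) = 2 * C * exp (c * \<bar>u\<bar> - pi * u\<^sup>2) + 2 * exp (0 * \<bar>u\<bar> - pi * u\<^sup>2)"
      by (simp add: exp_diff exp_minus divide_inverse distrib_left mult_ac)
    finally show ?thesis .
  qed
  have "?I \<longlonglongrightarrow> (\<integral>\<^sup>+u. 0 \<partial>(lborel :: real measure))"
  proof (rule nn_integral_dominated_convergence[where
        w="\<lambda>u. ennreal (2 * C * exp (c * \<bar>u\<bar> - pi * u\<^sup>2) + 2 * exp (0 * \<bar>u\<bar> - pi * u\<^sup>2)) * sqn W f"])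
    have B: "integrable lborel (\<lambda>u. 2 * C * exp (c * \<bar>u\<bar> - pi * u\<^sup>2) + 2 * exp (0 * \<bar>u\<bar> - pi * u\<^sup>2))"
      by (intro Bochner_Integration.integrable_add integrable_mult_right integrable_exp_quad pi_gt_zero)
    have "(\<integral>\<^sup>+u. ennreal (2 * C * exp (c * \<bar>u\<bar> - pi * u\<^sup>2) + 2 * exp (0 * \<bar>u\<bar> - pi * u\<^sup>2)) \<partial>lborel) < \<infinity>"
      by (subst nn_integral_eq_integral[OF B]) (use C in auto)
    then show "(\<integral>\<^sup>+u. ennreal (2 * C * exp (c * \<bar>u\<bar> - pi * u\<^sup>2) + 2 * exp (0 * \<bar>u\<bar> - pi * u\<^sup>2)) * sqn W f \<partial>lborel) < \<infinity>"
      using fin by (subst nn_integral_multc) (auto simp: ennreal_mult_less_top simp del: ennreal_plus)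
    show "AE u in lborel. (\<lambda>n. ennreal (?g u) * sqn W (\<lambda>t. f (t - e n * u) - f t)) \<longlonglongrightarrow> 0"
    proof (rule AE_I2)
      fix u
      have "(\<lambda>n. e n * u) \<longlonglongrightarrow> 0" using e(1) by (auto intro: tendsto_mult_left_zero)
      then show "(\<lambda>n. ennreal (?g u) * sqn W (\<lambda>t. f (t - e n * u) - f t)) \<longlonglongrightarrow> 0"
        by (intro ennreal_tendsto_0_cmult sqn_translate_tendsto W fin) auto
    qed
  qed (use meas bd in auto)
  then show "?I \<longlonglongrightarrow> 0" by simp
qed

lemma hat_mult_tendsto:
  assumes [measurable]: "f \<in> borel_measurable borel" and W: "moderate W" and fin: "sqn W f < \<infinity>"
    and e: "e \<longlonglongrightarrow> 0"
  shows "(\<lambda>n. sqn W (\<lambda>t. hat_mult (e n) t * f t - f t)) \<longlonglongrightarrow> 0"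
proof (rule sqn_dominated_convergence[where B="\<lambda>t. 2 * cmod (f t)"])
  note [measurable] = moderateD[OF W]
  show "W \<in> borel_measurable borel" by measurable
  show "AE t in lborel. cmod (hat_mult (e n) t * f t - f t) \<le> 2 * cmod (f t)" for n
  proof (rule AE_I2)
    fix t
    have "cmod (hat_mult (e n) t * f t - f t) \<le> cmod (hat_mult (e n) t) * cmod (f t) + cmod (f t)"
      by (metis norm_mult norm_triangle_ineq4)
    also have "\<dots> \<le> 1 * cmod (f t) + cmod (f t)"
      by (intro add_mono mult_right_mono norm_hat_mult_le) auto
    finally show "cmod (hat_mult (e n) t * f t - f t) \<le> 2 * cmod (f t)" by simp
  qed
  have "(\<integral>\<^sup>+ t. ennreal ((2 * cmod (f t))\<^sup>2 * W t) \<partial>lborel) = 4 * sqn W f"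
    unfolding sqn_def by (subst nn_integral_cmult[symmetric]) (auto simp: power_mult_distrib ennreal_mult' mult.assoc)
  then show "(\<integral>\<^sup>+ t. ennreal ((2 * cmod (f t))\<^sup>2 * W t) \<partial>lborel) < \<infinity>"
    using fin by (simp add: ennreal_mult_less_top)
  show "AE t in lborel. (\<lambda>n. hat_mult (e n) t * f t) \<longlonglongrightarrow> f t"
  proof (rule AE_I2)
    fix t
    have "(\<lambda>n. hat_mult (e n) t * f t) \<longlonglongrightarrow> of_real (exp (- pi * (0 * t)\<^sup>2)) * f t"
      unfolding hat_mult_def by (intro tendsto_intros e)
    then show "(\<lambda>n. hat_mult (e n) t * f t) \<longlonglongrightarrow> f t" by simp
  qed
qed (auto simp: moderate_nonneg[OF W])

lemma sqn_hat_mult_le: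
  assumes "moderate W"
  shows "sqn W (\<lambda>t. hat_mult e t * f t) \<le> sqn W f"
proof (rule sqn_mono)
  show "cmod (hat_mult e t * f t) \<le> cmod (f t)" for t
    unfolding norm_mult using mult_right_mono[OF norm_hat_mult_le, of "cmod (f t)"] by simp
qed (simp add: moderate_nonneg[OF assms])

text \<open>The error splits as H (G*f - f) + (H f - f). In the first summand H only decreases the
  norm.\<close>

lemma hat_mult_gconv_tendsto:
  assumes [measurable]: "f \<in> borel_measurable borel" and W: "moderate W" and fin: "sqn W f < \<infinity>"
    and e: "e \<longlonglongrightarrow> 0" "\<And>n. 0 < e n" "\<And>n. e n \<le> (1::real)"
  shows "(\<lambda>n. sqn W (\<lambda>t. hat_mult (e n) t * gconv (e n) f t - f t)) \<longlonglongrightarrow> 0"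
proof (rule ennreal_tendsto_0_le)
  note [measurable] = moderateD[OF W]
  let ?R = "\<lambda>n. 2 * sqn W (\<lambda>t. gconv (e n) f t - f t) + 2 * sqn W (\<lambda>t. hat_mult (e n) t * f t - f t)"
  have "?R \<longlonglongrightarrow> 0 + 0"
    by (intro tendsto_add ennreal_tendsto_0_cmult gconv_tendsto hat_mult_tendsto assms) auto
  then show "?R \<longlonglongrightarrow> 0" by simp
  have "sqn W (\<lambda>t. hat_mult (e n) t * gconv (e n) f t - f t) \<le> ?R n" for n
  proof -
    have "sqn W (\<lambda>t. hat_mult (e n) t * gconv (e n) f t - f t) \<le>
      2 * sqn W (\<lambda>t. hat_mult (e n) t * gconv (e n) f t - hat_mult (e n) t * f t) + 2 * sqn W (\<lambda>t. hat_mult (e n) t * f t - f t)"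
      by (rule sqn_diff_triangle) (auto simp: moderate_nonneg[OF W])
    also have "\<dots> \<le> ?R n"
      using sqn_hat_mult_le[OF W, of "e n" "\<lambda>t. gconv (e n) f t - f t"]
      by (intro add_mono mult_left_mono) (auto simp: right_diff_distrib)
    finally show ?thesis .
  qed
  then show "\<forall>\<^sub>F n in sequentially. sqn W (\<lambda>t. hat_mult (e n) t * gconv (e n) f t - f t) \<le> ?R n" by simp
qed

text \<open>The opposite order, for the frequency side. Here the error H f - f passes through the
  mollifier, whose width changes with n, so the uniform constant of \<open>gconv_bound\<close> is
  essential.\<close>

lemma gconv_hat_mult_tendsto:
  assumes [measurable]: "f \<in> borel_measurable borel" and W: "moderate W" and fin: "sqn W f < \<infinity>"
    and e: "e \<longlonglongrightarrow> 0" "\<And>n. 0 < e n" "\<And>n. e n \<le> (1::real)"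
  shows "(\<lambda>n. sqn W (\<lambda>t. gconv (e n) (\<lambda>s. hat_mult (e n) s * f s) t - f t)) \<longlonglongrightarrow> 0"
proof -
  note [measurable] = moderateD[OF W]
  obtain K where K: "0 \<le> K" "\<And>e f. 0 < e \<Longrightarrow> e \<le> 1 \<Longrightarrow> f \<in> borel_measurable borel \<Longrightarrow> sqn W (gconv e f) \<le> ennreal K * sqn W f"
    using gconv_bound[OF W] by metis
  let ?R = "\<lambda>n. 2 * (ennreal K * sqn W (\<lambda>t. hat_mult (e n) t * f t - f t)) + 2 * sqn W (\<lambda>t. gconv (e n) f t - f t)"
  have "?R \<longlonglongrightarrow> 0 + 0"
    by (intro tendsto_add ennreal_tendsto_0_cmult gconv_tendsto hat_mult_tendsto assms) auto
  then have R: "?R \<longlonglongrightarrow> 0" by simp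
  have "sqn W (\<lambda>t. gconv (e n) (\<lambda>s. hat_mult (e n) s * f s) t - f t) \<le> ?R n" for n
  proof -
    have fm: "sqn W (\<lambda>t. hat_mult (e n) t * f t) < \<infinity>"
      using sqn_hat_mult_le[OF W] fin by (rule le_less_trans)
    have "sqn W (\<lambda>t. gconv (e n) (\<lambda>s. hat_mult (e n) s * f s) t - f t) \<le>
      2 * sqn W (\<lambda>t. gconv (e n) (\<lambda>s. hat_mult (e n) s * f s) t - gconv (e n) f t) + 2 * sqn W (\<lambda>t. gconv (e n) f t - f t)"
      by (rule sqn_diff_triangle) (auto simp: moderate_nonneg[OF W])
    also have "(\<lambda>t. gconv (e n) (\<lambda>s. hat_mult (e n) s * f s) t - gconv (e n) f t) = gconv (e n) (\<lambda>s. hat_mult (e n) s * f s - f s)"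
      by (intro ext gconv_diff[symmetric] e sqn_one_finite[OF W] fm fin) auto
    also have "2 * sqn W \<dots> + 2 * sqn W (\<lambda>t. gconv (e n) f t - f t) \<le> ?R n"
      using e by (intro add_mono mult_left_mono K) auto
    finally show ?thesis .
  qed
  then show ?thesis by (intro ennreal_tendsto_0_le[OF R]) simp
qed

section \<open>The Fourier integral and Gaussians\<close>

definition fchar :: "real \<Rightarrow> real \<Rightarrow> complex" where
  "fchar \<omega> t = exp (- 2 * of_real pi * \<i> * of_real \<omega> * of_real t)"

lemma borel_measurable_cnj_comp [measurable (raw)]:
  "f \<in> borel_measurable M \<Longrightarrow> (\<lambda>x. cnj (f x)) \<in> borel_measurable M"
  by (rule measurable_compose[OF _ borel_measurable_continuous_onI]) (auto intro: continuous_intros)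

lemma fchar_measurable [measurable]: "case_prod fchar \<in> borel_measurable (borel \<Otimes>\<^sub>M borel)"
  unfolding fchar_def by measurable

lemma fchar_measurable' [measurable (raw)]:
  assumes [measurable]: "f \<in> borel_measurable M" "g \<in> borel_measurable M"
  shows "(\<lambda>x. fchar (f x) (g x)) \<in> borel_measurable M"
  unfolding fchar_def by measurable

lemma norm_fchar [simp]: "cmod (fchar \<omega> t) = 1"
  by (simp add: fchar_def norm_exp_eq_Re)

lemma fchar_commute: "fchar \<omega> t = fchar t \<omega>"
  by (simp add: fchar_def mult_ac)

lemma cnj_fchar: "cnj (fchar \<omega> t) = fchar (- \<omega>) t"
  by (simp add: fchar_def exp_cnj)

lemma fourier_integral_lborel:
  assumes [measurable]: "f \<in> borel_measurable borel"
  shows "fourier_integral f = (\<lambda>\<omega>. LINT t|lborel. f t * fchar \<omega> t)"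
  unfolding fourier_integral_def fchar_def[symmetric]
  by (intro ext integral_completion) measurable

lemma fourier_integral_measurable [measurable]:
  assumes [measurable]: "f \<in> borel_measurable borel"
  shows "fourier_integral f \<in> borel_measurable borel"
  unfolding fourier_integral_lborel[OF assms] by measurable

lemma integrable_fchar_mult:
  assumes "integrable lborel f"
  shows "integrable lborel (\<lambda>t. f t * fchar \<omega> t)"
  by (rule Bochner_Integration.integrable_bound[OF assms]) (use assms in \<open>auto simp: norm_mult\<close>)

text \<open>|p(x) q(y)| is an integrable majorant on the product space. The interchanges of Fourier
  integrals below are instances in which \<open>K\<close> is a character.\<close>

lemma Fubini_bounded_kernel:
  fixes p q :: "real \<Rightarrow> complex"
  assumes p: "integrable lborel p" and q: "integrable lborel q"
    and K [measurable]: "case_prod K \<in> borel_measurable (borel \<Otimes>\<^sub>M borel)" and K1: "\<And>x y. cmod (K x y) \<le> 1"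
  shows "(LINT x|lborel. p x * (LINT y|lborel. q y * K x y)) = (LINT y|lborel. q y * (LINT x|lborel. p x * K x y))"
proof -
  have [measurable]: "p \<in> borel_measurable borel" "q \<in> borel_measurable borel" using p q by auto
  have "integrable (lborel \<Otimes>\<^sub>M lborel) (\<lambda>(x, y). p x * q y * K x y)"
  proof (rule integrableI_bounded)
    have "(\<integral>\<^sup>+ z. ennreal (norm (case z of (x, y) \<Rightarrow> p x * q y * K x y)) \<partial>(lborel \<Otimes>\<^sub>M lborel))
       \<le> (\<integral>\<^sup>+ z. ennreal (cmod (p (fst z))) * ennreal (cmod (q (snd z))) \<partial>(lborel \<Otimes>\<^sub>M lborel))"
    proof (intro nn_integral_mono)
      fix z
      show "ennreal (norm (case z of (x, y) \<Rightarrow> p x * q y * K x y)) \<le> ennreal (cmod (p (fst z))) * ennreal (cmod (q (snd z)))"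
        using K1[of "fst z" "snd z"] by (auto simp: norm_mult mult_left_le split_beta simp flip: ennreal_mult intro!: ennreal_leI)
    qed
    also have "\<dots> = (\<integral>\<^sup>+ x. \<integral>\<^sup>+ y. ennreal (cmod (p x)) * ennreal (cmod (q y)) \<partial>lborel \<partial>lborel)"
      by (subst lborel.nn_integral_fst[symmetric]) auto
    also have "\<dots> = (\<integral>\<^sup>+ x. ennreal (cmod (p x)) \<partial>lborel) * (\<integral>\<^sup>+ y. ennreal (cmod (q y)) \<partial>lborel)"
      by (simp add: nn_integral_cmult nn_integral_multc)
    also have "\<dots> < \<infinity>" using p q by (simp add: integrable_iff_bounded ennreal_mult_less_top)
    finally show "(\<integral>\<^sup>+ z. ennreal (norm (case z of (x, y) \<Rightarrow> p x * q y * K x y)) \<partial>(lborel \<Otimes>\<^sub>M lborel)) < \<infinity>" .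
  qed measurable
  from lborel_pair.Fubini_integral[OF this]
  have "(LINT y|lborel. LINT x|lborel. p x * q y * K x y) = (LINT x|lborel. LINT y|lborel. p x * q y * K x y)" .
  moreover have "(LINT x|lborel. p x * q y * K x y) = q y * (LINT x|lborel. p x * K x y)" for y
    by (subst integral_mult_right_zero[symmetric]) (simp only: mult_ac)
  moreover have "(LINT y|lborel. p x * q y * K x y) = p x * (LINT y|lborel. q y * K x y)" for x
    by (subst integral_mult_right_zero[symmetric]) (simp only: mult_ac)
  ultimately show ?thesis by simp
qed

text \<open>The characteristic function of the standard normal law, evaluated at - sqrt(2 pi)
  \<omega>; the substitution x = sqrt(2 pi) u turns its density into exp(- pi u^2).\<close>

lemma fourier_std_gauss:
  "(LINT u|lborel. of_real (exp (- pi * u\<^sup>2)) * fchar \<omega> u) = of_real (exp (- pi * \<omega>\<^sup>2))"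
proof -
  let ?c = "sqrt (2 * pi)" and ?t = "- sqrt (2 * pi) * \<omega>"
  have "complex_of_real (exp (- (?t\<^sup>2) / 2)) = char std_normal_distribution ?t"
    by (simp add: char_std_normal_distribution)
  also have "\<dots> = (LINT x|lborel. std_normal_density x *\<^sub>R iexp (?t * x))"
    unfolding char_def by (rule integral_density) auto
  also have "\<dots> = \<bar>?c\<bar> *\<^sub>R (LINT u|lborel. std_normal_density (0 + ?c * u) *\<^sub>R iexp (?t * (0 + ?c * u)))"
    by (rule lborel_integral_real_affine) auto
  also have "\<dots> = (LINT u|lborel. \<bar>?c\<bar> *\<^sub>R (std_normal_density (0 + ?c * u) *\<^sub>R iexp (?t * (0 + ?c * u))))"
    by (rule integral_scaleR_right[symmetric])
  also have "\<dots> = (LINT u|lborel. of_real (exp (- pi * u\<^sup>2)) * fchar \<omega> u)"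
  proof (intro Bochner_Integration.integral_cong refl)
    fix u
    have "?t * (?c * u) = - (2 * pi * \<omega> * u)" by (simp add: algebra_simps)
    then have "iexp (?t * (0 + ?c * u)) = fchar \<omega> u"
      unfolding fchar_def by (intro arg_cong[where f=exp]) (simp add: mult_ac)
    then show "\<bar>?c\<bar> *\<^sub>R (std_normal_density (0 + ?c * u) *\<^sub>R iexp (?t * (0 + ?c * u))) = of_real (exp (- pi * u\<^sup>2)) * fchar \<omega> u"
      by (simp add: normal_density_def power_mult_distrib scaleR_conv_of_real real_sqrt_mult)
  qed
  finally show ?thesis by (simp add: power_mult_distrib)
qed

text \<open>The prefactor of \<open>gauss\<close> cancels the Jacobian of the scaling, so that the
  Gaussian has mass 1; the translation by \<tau> becomes a modulation.\<close>

lemma fourier_gauss: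
  assumes "\<alpha> > 0"
  shows "fourier_integral (gauss \<alpha> \<tau>) \<omega> = of_real (exp (- pi * \<omega>\<^sup>2 / \<alpha>)) * fchar \<omega> \<tau>"
proof -
  let ?c = "1 / sqrt \<alpha>"
  have [measurable]: "gauss \<alpha> \<tau> \<in> borel_measurable borel" unfolding gauss_def by measurable
  have "fourier_integral (gauss \<alpha> \<tau>) \<omega> = \<bar>?c\<bar> *\<^sub>R (LINT u|lborel. gauss \<alpha> \<tau> (\<tau> + ?c * u) * fchar \<omega> (\<tau> + ?c * u))"
    unfolding fourier_integral_lborel[OF \<open>gauss \<alpha> \<tau> \<in> _\<close>] using assms by (intro lborel_integral_real_affine) auto
  also have "\<dots> = (LINT u|lborel. \<bar>?c\<bar> *\<^sub>R (gauss \<alpha> \<tau> (\<tau> + ?c * u) * fchar \<omega> (\<tau> + ?c * u)))"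
    by simp
  also have "\<dots> = (LINT u|lborel. fchar \<omega> \<tau> * (of_real (exp (- pi * u\<^sup>2)) * fchar (\<omega> / sqrt \<alpha>) u))"
  proof (intro Bochner_Integration.integral_cong refl)
    fix u
    have "fchar \<omega> (\<tau> + ?c * u) = fchar \<omega> \<tau> * fchar (\<omega> / sqrt \<alpha>) u"
      unfolding fchar_def by (simp add: algebra_simps flip: exp_add)
    then show "\<bar>?c\<bar> *\<^sub>R (gauss \<alpha> \<tau> (\<tau> + ?c * u) * fchar \<omega> (\<tau> + ?c * u)) =
        fchar \<omega> \<tau> * (of_real (exp (- pi * u\<^sup>2)) * fchar (\<omega> / sqrt \<alpha>) u)"
      using assms by (simp add: gauss_def scaleR_conv_of_real power_divide)
  qed
  also have "\<dots> = fchar \<omega> \<tau> * of_real (exp (- pi * (\<omega> / sqrt \<alpha>)\<^sup>2))"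
    by (subst integral_mult_right_zero, subst fourier_std_gauss) simp
  finally show ?thesis using assms by (simp add: power_divide)
qed

lemma integrable_hat_mult: "e > 0 \<Longrightarrow> integrable lborel (hat_mult e)"
  using integrable_exp_quad0[of "pi * e\<^sup>2"]
  unfolding hat_mult_def by (intro integrable_of_real) (simp add: power_mult_distrib mult_ac)

lemma fourier_hat_mult:
  assumes "e > 0"
  shows "(LINT u|lborel. hat_mult e u * fchar \<omega> u) = hat_kernel e \<omega>"
proof -
  have h: "hat_mult e = (\<lambda>u. of_real (1 / e) * gauss (e\<^sup>2) 0 u)"
    using assms by (auto simp: hat_mult_def gauss_def fun_eq_iff power_mult_distrib mult_ac)
  have m: "gauss (e\<^sup>2) 0 \<in> borel_measurable borel" unfolding gauss_def by measurable
  have "(LINT u|lborel. hat_mult e u * fchar \<omega> u) = of_real (1 / e) * fourier_integral (gauss (e\<^sup>2) 0) \<omega>"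
    unfolding h fourier_integral_lborel[OF m] mult.assoc by (rule integral_mult_right_zero)
  also have "\<dots> = hat_kernel e \<omega>"
    using assms by (subst fourier_gauss) (auto simp: hat_kernel_def fchar_def power_divide)
  finally show ?thesis .
qed

lemma fourier_integral_cnj:
  assumes [measurable]: "f \<in> borel_measurable borel"
  shows "cnj (fourier_integral f \<omega>) = (LINT t|lborel. cnj (f t) * fchar (- \<omega>) t)"
  unfolding fourier_integral_lborel[OF assms]
  by (subst Bochner_Integration.integral_cnj[symmetric]) (simp add: cnj_fchar)

text \<open>Plancherel's inequality up to a constant, which is all that the extension to \<open>L\<^sup>2\<close> needs:
  the Gaussian mean of \<open>|F f|\<^sup>2\<close> is the pairing of \<open>f\<close> with a mollification of its conjugate.\<close>

lemma sqn_fourier_bound: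
  obtains K :: real where "1 \<le> K"
    "\<And>f. integrable lborel f \<Longrightarrow> sqn (\<lambda>_. 1) (fourier_integral f) \<le> ennreal K * sqn (\<lambda>_. 1) f"
proof -
  obtain K where K: "0 \<le> K" "\<And>e f. 0 < e \<Longrightarrow> e \<le> 1 \<Longrightarrow> f \<in> borel_measurable borel \<Longrightarrow> sqn (\<lambda>_. 1) (gconv e f) \<le> ennreal K * sqn (\<lambda>_. 1) f"
    using gconv_bound[OF moderate_one] by metis
  \<comment> \<open>The damping makes the frequency integral converge for each integrable f, and the
    bound does not depend on e. No square integrability of f is assumed: the bound is trivial if its
    right-hand side is infinite.\<close>
  have main: "(\<integral>\<^sup>+\<omega>. ennreal ((cmod (fourier_integral f \<omega>))\<^sup>2 * exp (- pi * (e * \<omega>)\<^sup>2)) \<partial>lborel) \<le> ennreal (1 + K) * sqn (\<lambda>_. 1) f"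
    if f: "integrable lborel f" and e: "0 < e" "e \<le> 1" for f e
  proof -
    have [measurable]: "f \<in> borel_measurable borel" using f by auto
    let ?F = "fourier_integral f"
    \<comment> \<open>Chosen so that multiplication by the transform gives the damped |F f|^2. It is
      integrable because F f is bounded by the L1 norm of f.\<close>
    define u where "u \<omega> = cnj (?F \<omega>) * hat_mult e \<omega>" for \<omega>
    have [measurable]: "u \<in> borel_measurable borel" unfolding u_def by measurable
    have F_bd: "cmod (?F \<omega>) \<le> (LINT t|lborel. cmod (f t))" for \<omega>
      unfolding fourier_integral_lborel[OF \<open>f \<in> _\<close>]
      by (rule order_trans[OF integral_norm_bound]) (simp add: norm_mult)
    have u: "integrable lborel u"
    proof (rule Bochner_Integration.integrable_bound)
      show "integrable lborel (\<lambda>\<omega>. of_real (LINT t|lborel. cmod (f t)) * hat_mult e \<omega>)"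
        using integrable_hat_mult e by (intro integrable_mult_right) auto
      show "AE \<omega> in lborel. norm (u \<omega>) \<le> norm (of_real (LINT t|lborel. cmod (f t)) * hat_mult e \<omega>)"
        using F_bd by (auto simp: u_def norm_mult intro!: mult_right_mono intro: order_trans[OF _ abs_ge_self])
    qed measurable
    have fcnj: "integrable lborel (\<lambda>t. cnj (f t))" using f by simp
    \<comment> \<open>The two characters combine into one at s - t, and the transform of
      \<open>hat_mult\<close> at s - t is the mollifier.\<close>
    have Fu: "(LINT \<omega>|lborel. u \<omega> * fchar s \<omega>) = gconv e (\<lambda>t. cnj (f t)) s" for s
    proof -
      have "(LINT \<omega>|lborel. u \<omega> * fchar s \<omega>)
          = (LINT \<omega>|lborel. (hat_mult e \<omega> * fchar s \<omega>) * (LINT t|lborel. cnj (f t) * fchar (- \<omega>) t))"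
        unfolding u_def fourier_integral_cnj[OF \<open>f \<in> _\<close>] by (simp add: mult_ac)
      also have "\<dots> = (LINT t|lborel. cnj (f t) * (LINT \<omega>|lborel. (hat_mult e \<omega> * fchar s \<omega>) * fchar (- \<omega>) t))"
        using e by (intro Fubini_bounded_kernel integrable_fchar_mult integrable_hat_mult fcnj) auto
      also have "\<dots> = (LINT t|lborel. cnj (f t) * (LINT \<omega>|lborel. hat_mult e \<omega> * fchar (s - t) \<omega>))"
      proof -
        have "fchar s \<omega> * fchar (- \<omega>) t = fchar (s - t) \<omega>" for t \<omega>
          by (simp add: fchar_def algebra_simps flip: exp_add)
        then show ?thesis by (simp add: mult.assoc)
      qed
      also have "\<dots> = gconv e (\<lambda>t. cnj (f t)) s"
        using e by (simp add: fourier_hat_mult gconv_def mult.commute)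
      finally show ?thesis .
    qed
    have id: "(LINT \<omega>|lborel. ?F \<omega> * u \<omega>) = (LINT t|lborel. f t * gconv e (\<lambda>t. cnj (f t)) t)"
    proof -
      have "(LINT \<omega>|lborel. u \<omega> * (LINT t|lborel. f t * fchar \<omega> t)) = (LINT t|lborel. f t * (LINT \<omega>|lborel. u \<omega> * fchar \<omega> t))"
        by (intro Fubini_bounded_kernel u f) auto
      then show ?thesis
        unfolding fourier_integral_lborel[OF \<open>f \<in> _\<close>] Fu[symmetric]
        by (simp add: mult.commute fchar_commute)
    qed
    have Fu_real: "?F \<omega> * u \<omega> = of_real ((cmod (?F \<omega>))\<^sup>2 * exp (- pi * (e * \<omega>)\<^sup>2))" for \<omega>
      unfolding u_def hat_mult_def by (simp add: mult.assoc[symmetric] flip: complex_norm_square)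
    have Fu_int: "integrable lborel (\<lambda>\<omega>. ?F \<omega> * u \<omega>)"
    proof (rule Bochner_Integration.integrable_bound)
      show "integrable lborel (\<lambda>\<omega>. of_real (LINT t|lborel. cmod (f t)) * u \<omega>)"
        using u by (intro integrable_mult_right)
      show "AE \<omega> in lborel. norm (?F \<omega> * u \<omega>) \<le> norm (of_real (LINT t|lborel. cmod (f t)) * u \<omega>)"
        using F_bd by (auto simp: norm_mult intro!: mult_right_mono intro: order_trans[OF _ abs_ge_self])
    qed measurable
    have int2: "integrable lborel (\<lambda>\<omega>. (cmod (?F \<omega>))\<^sup>2 * exp (- pi * (e * \<omega>)\<^sup>2))"
      using integrable_norm[OF Fu_int] unfolding Fu_real norm_of_real by (simp add: abs_mult)
    have "(\<integral>\<^sup>+\<omega>. ennreal ((cmod (?F \<omega>))\<^sup>2 * exp (- pi * (e * \<omega>)\<^sup>2)) \<partial>lborel)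
        = ennreal (LINT \<omega>|lborel. (cmod (?F \<omega>))\<^sup>2 * exp (- pi * (e * \<omega>)\<^sup>2))"
      by (rule nn_integral_eq_integral[OF int2]) auto
    also have "\<dots> \<le> ennreal (cmod (LINT \<omega>|lborel. ?F \<omega> * u \<omega>))"
      unfolding Fu_real integral_complex_of_real norm_of_real by (intro ennreal_leI) simp
    also have "\<dots> = ennreal (cmod (LINT t|lborel. f t * gconv e (\<lambda>t. cnj (f t)) t))"
      unfolding id ..
    also have "\<dots> \<le> (\<integral>\<^sup>+t. ennreal (cmod (f t * gconv e (\<lambda>t. cnj (f t)) t)) \<partial>lborel)"
      by (cases "integrable lborel (\<lambda>t. f t * gconv e (\<lambda>t. cnj (f t)) t)")
         (simp_all add: integral_norm_bound_ennreal not_integrable_integral_eq)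
    \<comment> \<open>Estimating the product by the sum of the squares leads to the constant 1 + K:
      1 for f and \<open>K\<close> for its mollified conjugate.\<close>
    also have "\<dots> \<le> (\<integral>\<^sup>+t. ennreal ((cmod (f t))\<^sup>2 * 1) + ennreal ((cmod (gconv e (\<lambda>t. cnj (f t)) t))\<^sup>2 * 1) \<partial>lborel)"
      by (intro nn_integral_mono) (auto simp flip: ennreal_plus intro!: ennreal_leI norm_mult_le_squares[simplified])
    also have "\<dots> = sqn (\<lambda>_. 1) f + sqn (\<lambda>_. 1) (gconv e (\<lambda>t. cnj (f t)))"
      unfolding sqn_def by (rule nn_integral_add) auto
    also have "\<dots> \<le> sqn (\<lambda>_. 1) f + ennreal K * sqn (\<lambda>_. 1) (\<lambda>t. cnj (f t))"
      using e by (intro add_left_mono K) auto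
    also have "\<dots> = ennreal (1 + K) * sqn (\<lambda>_. 1) f"
      using K by (simp add: sqn_def distrib_right)
    finally show ?thesis .
  qed
  show thesis
  proof
    show "1 \<le> 1 + K" using K by simp
    fix f :: "real \<Rightarrow> complex" assume f: "integrable lborel f"
    have [measurable]: "f \<in> borel_measurable borel" using f by auto
    let ?F = "fourier_integral f"
    let ?u = "\<lambda>n \<omega>. ennreal ((cmod (?F \<omega>))\<^sup>2 * exp (- pi * (inverse (real (Suc n)) * \<omega>)\<^sup>2))"
    have lim: "(\<lambda>n. ?u n \<omega>) \<longlonglongrightarrow> ennreal ((cmod (?F \<omega>))\<^sup>2 * 1)" for \<omega>
    proof -
      have "(\<lambda>n. (cmod (?F \<omega>))\<^sup>2 * exp (- pi * (inverse (real (Suc n)) * \<omega>)\<^sup>2)) \<longlonglongrightarrow> (cmod (?F \<omega>))\<^sup>2 * exp (- pi * (0 * \<omega>)\<^sup>2)"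
        by (intro tendsto_intros LIMSEQ_inverse_real_of_nat)
      then show ?thesis by (intro tendsto_ennrealI) simp
    qed
    \<comment> \<open>The damping is removed by Fatou's lemma along e = 1/(n + 1).\<close>
    have "sqn (\<lambda>_. 1) ?F = (\<integral>\<^sup>+\<omega>. liminf (\<lambda>n. ?u n \<omega>) \<partial>lborel)"
      unfolding sqn_def using lim by (intro nn_integral_cong) (metis lim_imp_Liminf sequentially_bot)
    also have "\<dots> \<le> liminf (\<lambda>n. integral\<^sup>N lborel (?u n))"
      by (rule nn_integral_liminf) measurable
    also have "\<dots> \<le> limsup (\<lambda>n. integral\<^sup>N lborel (?u n))"
      by (rule Liminf_le_Limsup) simp
    also have "\<dots> \<le> ennreal (1 + K) * sqn (\<lambda>_. 1) f"
      by (intro Limsup_bounded always_eventually allI main f) (auto intro: inverse_le_1_iff[THEN iffD2])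
    finally show "sqn (\<lambda>_. 1) ?F \<le> ennreal (1 + K) * sqn (\<lambda>_. 1) f" .
  qed
qed

section \<open>The Fourier transform on square-integrable functions\<close>

text \<open>The Borel counterpart of \<open>is_fourier_L2\<close>. The \<open>X n\<close> need not
  be square integrable: the limits are taken in \<open>ennreal\<close>, so a finite distance from
  \<open>x\<close> and \<open>y\<close> holds eventually.\<close>

definition fourier_pair :: "(real \<Rightarrow> complex) \<Rightarrow> (real \<Rightarrow> complex) \<Rightarrow> bool" where
  "fourier_pair x y \<longleftrightarrow> x \<in> borel_measurable borel \<and> y \<in> borel_measurable borel \<and>
     sqn (\<lambda>_. 1) x < \<infinity> \<and> sqn (\<lambda>_. 1) y < \<infinity> \<and>
     (\<exists>X :: nat \<Rightarrow> real \<Rightarrow> complex. (\<forall>n. integrable lborel (X n)) \<and>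
        (\<lambda>n. sqn (\<lambda>_. 1) (\<lambda>t. X n t - x t)) \<longlonglongrightarrow> 0 \<and>
        (\<lambda>n. sqn (\<lambda>_. 1) (\<lambda>\<omega>. fourier_integral (X n) \<omega> - y \<omega>)) \<longlonglongrightarrow> 0)"

lemma sqn_one_add_finite:
  assumes "f \<in> borel_measurable borel" "g \<in> borel_measurable borel" "sqn (\<lambda>_. 1) f < \<infinity>" "sqn (\<lambda>_. 1) g < \<infinity>"
  shows "sqn (\<lambda>_. 1) (\<lambda>t. f t + g t) < \<infinity>"
  using sqn_add[of f g "\<lambda>_. 1"] assms
  by (auto simp: ennreal_mult_less_top elim!: le_less_trans)

lemma fourier_integral_add:
  assumes "integrable lborel f" "integrable lborel g"
  shows "fourier_integral (\<lambda>t. f t + g t) \<omega> = fourier_integral f \<omega> + fourier_integral g \<omega>"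
proof -
  have [measurable]: "f \<in> borel_measurable borel" "g \<in> borel_measurable borel" using assms by auto
  show ?thesis
    by (simp add: fourier_integral_lborel distrib_right assms integrable_fchar_mult)
qed

lemma fourier_integral_cmult:
  assumes "f \<in> borel_measurable borel"
  shows "fourier_integral (\<lambda>t. c * f t) \<omega> = c * fourier_integral f \<omega>"
  using assms by (simp add: fourier_integral_lborel mult.assoc)

text \<open>A constant sequence is the witness; the Plancherel bound supplies square integrability
  of the transform.\<close>

lemma fourier_pair_integrable:
  assumes f: "integrable lborel f" "sqn (\<lambda>_. 1) f < \<infinity>"
  shows "fourier_pair f (fourier_integral f)"
proof -
  obtain K where "sqn (\<lambda>_. 1) (fourier_integral f) \<le> ennreal K * sqn (\<lambda>_. 1) f"
    using sqn_fourier_bound f by metis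
  also have "\<dots> < \<infinity>" using f by (simp add: ennreal_mult_less_top)
  finally show ?thesis
    unfolding fourier_pair_def using f by (auto simp: sqn_def intro!: exI[of _ "\<lambda>_. f"])
qed

lemma fourier_pair_add:
  assumes "fourier_pair x y" "fourier_pair x' y'"
  shows "fourier_pair (\<lambda>t. x t + x' t) (\<lambda>t. y t + y' t)"
proof -
  note d = assms[unfolded fourier_pair_def]
  from d(1) obtain X where X: "\<And>n. integrable lborel (X n)" "(\<lambda>n. sqn (\<lambda>_. 1) (\<lambda>t. X n t - x t)) \<longlonglongrightarrow> 0"
    "(\<lambda>n. sqn (\<lambda>_. 1) (\<lambda>\<omega>. fourier_integral (X n) \<omega> - y \<omega>)) \<longlonglongrightarrow> 0" by blast
  from d(2) obtain X' where X': "\<And>n. integrable lborel (X' n)" "(\<lambda>n. sqn (\<lambda>_. 1) (\<lambda>t. X' n t - x' t)) \<longlonglongrightarrow> 0"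
    "(\<lambda>n. sqn (\<lambda>_. 1) (\<lambda>\<omega>. fourier_integral (X' n) \<omega> - y' \<omega>)) \<longlonglongrightarrow> 0" by blast
  have [measurable]: "x \<in> borel_measurable borel" "y \<in> borel_measurable borel"
    "x' \<in> borel_measurable borel" "y' \<in> borel_measurable borel"
    "\<And>n. X n \<in> borel_measurable borel" "\<And>n. X' n \<in> borel_measurable borel"
    using d X(1) X'(1) by auto
  have lim: "(\<lambda>n. sqn (\<lambda>_. 1) (\<lambda>t. (a n t + a' n t) - (b t + b' t))) \<longlonglongrightarrow> 0"
    if lim: "(\<lambda>n. sqn (\<lambda>_. 1) (\<lambda>t. a n t - b t)) \<longlonglongrightarrow> 0" "(\<lambda>n. sqn (\<lambda>_. 1) (\<lambda>t. a' n t - b' t)) \<longlonglongrightarrow> 0"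
      and [measurable]: "\<And>n. a n \<in> borel_measurable borel" "\<And>n. a' n \<in> borel_measurable borel"
        "b \<in> borel_measurable borel" "b' \<in> borel_measurable borel"
    for a a' :: "nat \<Rightarrow> real \<Rightarrow> complex" and b b'
  proof (rule ennreal_tendsto_0_le)
    have "(\<lambda>n. 2 * sqn (\<lambda>_. 1) (\<lambda>t. a n t - b t) + 2 * sqn (\<lambda>_. 1) (\<lambda>t. a' n t - b' t)) \<longlonglongrightarrow> 0 + 0"
      by (intro tendsto_add ennreal_tendsto_0_cmult lim) auto
    then show "(\<lambda>n. 2 * sqn (\<lambda>_. 1) (\<lambda>t. a n t - b t) + 2 * sqn (\<lambda>_. 1) (\<lambda>t. a' n t - b' t)) \<longlonglongrightarrow> 0" by simp
    have "sqn (\<lambda>_. 1) (\<lambda>t. (a n t - b t) + (a' n t - b' t)) \<le>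
        2 * sqn (\<lambda>_. 1) (\<lambda>t. a n t - b t) + 2 * sqn (\<lambda>_. 1) (\<lambda>t. a' n t - b' t)" for n
      by (rule sqn_add) auto
    then show "\<forall>\<^sub>F n in sequentially. sqn (\<lambda>_. 1) (\<lambda>t. (a n t + a' n t) - (b t + b' t)) \<le>
        2 * sqn (\<lambda>_. 1) (\<lambda>t. a n t - b t) + 2 * sqn (\<lambda>_. 1) (\<lambda>t. a' n t - b' t)"
      by (simp add: algebra_simps)
  qed
  have "(\<lambda>n. sqn (\<lambda>_. 1) (\<lambda>t. (X n t + X' n t) - (x t + x' t))) \<longlonglongrightarrow> 0"
    by (intro lim X X') auto
  moreover have "(\<lambda>n. sqn (\<lambda>_. 1) (\<lambda>\<omega>. fourier_integral (\<lambda>t. X n t + X' n t) \<omega> - (y \<omega> + y' \<omega>))) \<longlonglongrightarrow> 0"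
    unfolding fourier_integral_add[OF X(1) X'(1)] by (intro lim X X') auto
  ultimately show ?thesis
    unfolding fourier_pair_def using d X(1) X'(1)
    by (auto intro!: exI[of _ "\<lambda>n t. X n t + X' n t"] sqn_one_add_finite simp del: infinity_ennreal_def)
qed

lemma fourier_pair_cmult:
  assumes "fourier_pair x y"
  shows "fourier_pair (\<lambda>t. c * x t) (\<lambda>t. c * y t)"
proof -
  note d = assms[unfolded fourier_pair_def]
  from d obtain X where X: "\<And>n. integrable lborel (X n)" "(\<lambda>n. sqn (\<lambda>_. 1) (\<lambda>t. X n t - x t)) \<longlonglongrightarrow> 0"
    "(\<lambda>n. sqn (\<lambda>_. 1) (\<lambda>\<omega>. fourier_integral (X n) \<omega> - y \<omega>)) \<longlonglongrightarrow> 0" by blast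
  have [measurable]: "x \<in> borel_measurable borel" "y \<in> borel_measurable borel"
    "\<And>n. X n \<in> borel_measurable borel"
    using d X(1) by auto
  have lim: "(\<lambda>n. sqn (\<lambda>_. 1) (\<lambda>t. c * a n t - c * b t)) \<longlonglongrightarrow> 0"
    if lim: "(\<lambda>n. sqn (\<lambda>_. 1) (\<lambda>t. a n t - b t)) \<longlonglongrightarrow> 0"
      and [measurable]: "\<And>n. a n \<in> borel_measurable borel" "b \<in> borel_measurable borel"
    for a :: "nat \<Rightarrow> real \<Rightarrow> complex" and b
  proof -
    have "sqn (\<lambda>_. 1) (\<lambda>t. c * a n t - c * b t) = ennreal ((cmod c)\<^sup>2) * sqn (\<lambda>_. 1) (\<lambda>t. a n t - b t)" for n
      using sqn_cmult[of "\<lambda>t. a n t - b t" "\<lambda>_. 1" c] by (simp add: right_diff_distrib)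
    then show ?thesis using ennreal_tendsto_0_cmult[OF lim] by simp
  qed
  have "(\<lambda>n. sqn (\<lambda>_. 1) (\<lambda>t. c * X n t - c * x t)) \<longlonglongrightarrow> 0"
    by (intro lim X) auto
  moreover have "(\<lambda>n. sqn (\<lambda>_. 1) (\<lambda>\<omega>. fourier_integral (\<lambda>t. c * X n t) \<omega> - c * y \<omega>)) \<longlonglongrightarrow> 0"
    unfolding fourier_integral_cmult[OF \<open>X _ \<in> _\<close>] by (intro lim X) auto
  ultimately show ?thesis
    unfolding fourier_pair_def using d X(1)
    by (auto intro!: exI[of _ "\<lambda>n t. c * X n t"] simp: sqn_cmult ennreal_mult_less_top)
qed

lemma fourier_pair_diff:
  assumes "fourier_pair x y" "fourier_pair x' y'"
  shows "fourier_pair (\<lambda>t. x t - x' t) (\<lambda>t. y t - y' t)"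
  using fourier_pair_add[OF assms(1) fourier_pair_cmult[OF assms(2), of "-1"]] by simp

lemma AE_eq_0_if_sqn_0:
  assumes [measurable]: "f \<in> borel_measurable borel" and "sqn (\<lambda>_. 1) f = 0"
  shows "AE t in lborel. f t = 0"
  using assms(2) unfolding sqn_def by (subst (asm) nn_integral_0_iff_AE) auto

text \<open>If x vanishes almost everywhere, the approximants tend to 0 in norm, and by the
  Plancherel bound so do their transforms. This makes the closure of the graph single-valued up to
  null sets.\<close>

lemma fourier_pair_0:
  assumes "fourier_pair x y" and 0: "AE t in lborel. x t = 0"
  shows "AE \<omega> in lborel. y \<omega> = 0"
proof -
  note d = assms(1)[unfolded fourier_pair_def]
  from d obtain X where X: "\<And>n. integrable lborel (X n)" "(\<lambda>n. sqn (\<lambda>_. 1) (\<lambda>t. X n t - x t)) \<longlonglongrightarrow> 0"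
    "(\<lambda>n. sqn (\<lambda>_. 1) (\<lambda>\<omega>. fourier_integral (X n) \<omega> - y \<omega>)) \<longlonglongrightarrow> 0" by blast
  have [measurable]: "x \<in> borel_measurable borel" "y \<in> borel_measurable borel"
    "\<And>n. X n \<in> borel_measurable borel"
    using d X(1) by auto
  obtain K where K: "\<And>f. integrable lborel f \<Longrightarrow> sqn (\<lambda>_. 1) (fourier_integral f) \<le> ennreal K * sqn (\<lambda>_. 1) f"
    using sqn_fourier_bound by metis
  have "sqn (\<lambda>_. 1) (X n) = sqn (\<lambda>_. 1) (\<lambda>t. X n t - x t)" for n
    by (rule sqn_cong_AE) (use 0 in auto)
  then have X0: "(\<lambda>n. sqn (\<lambda>_. 1) (X n)) \<longlonglongrightarrow> 0" using X(2) by simp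
  let ?R = "\<lambda>n. 2 * sqn (\<lambda>_. 1) (\<lambda>\<omega>. fourier_integral (X n) \<omega> - y \<omega>) + 2 * (ennreal K * sqn (\<lambda>_. 1) (X n))"
  have "?R \<longlonglongrightarrow> 0 + 0"
    by (intro tendsto_add ennreal_tendsto_0_cmult X X0) auto
  moreover have "sqn (\<lambda>_. 1) y \<le> ?R n" for n
  proof -
    have "sqn (\<lambda>_. 1) (\<lambda>\<omega>. y \<omega> - 0) \<le> 2 * sqn (\<lambda>_. 1) (\<lambda>\<omega>. y \<omega> - fourier_integral (X n) \<omega>) + 2 * sqn (\<lambda>_. 1) (\<lambda>\<omega>. fourier_integral (X n) \<omega> - 0)"
      by (rule sqn_diff_triangle) auto
    also have "\<dots> \<le> ?R n"
      unfolding sqn_minus_commute[of _ y] by (intro add_mono mult_left_mono) (auto intro: K X)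
    finally show ?thesis by simp
  qed
  ultimately have "sqn (\<lambda>_. 1) y \<le> 0 + 0"
    by (intro LIMSEQ_le_const) auto
  then show ?thesis by (intro AE_eq_0_if_sqn_0) auto
qed

lemma fourier_pair_unique:
  assumes "fourier_pair x y" "fourier_pair x' y'" "AE t in lborel. x t = x' t"
  shows "AE \<omega> in lborel. y \<omega> = y' \<omega>"
  using fourier_pair_0[OF fourier_pair_diff[OF assms(1,2)]] assms(3) by auto

text \<open>A Riesz--Fischer argument: truncations of \<open>x\<close> chosen with geometrically small increments
  have transforms that converge almost everywhere, and Fatou's lemma identifies the limit.\<close>

lemma fourier_pair_exists:
  assumes [measurable]: "x \<in> borel_measurable borel" and fin: "sqn (\<lambda>_. 1) x < \<infinity>"
  obtains y where "fourier_pair x y"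
proof -
  obtain K where K: "1 \<le> K" "\<And>f. integrable lborel f \<Longrightarrow> sqn (\<lambda>_. 1) (fourier_integral f) \<le> ennreal K * sqn (\<lambda>_. 1) f"
    using sqn_fourier_bound by metis
  define T where "T n t = (if cmod (x t) \<le> real n \<and> \<bar>t\<bar> \<le> real n then x t else 0)" for n :: nat and t
  have [measurable]: "T n \<in> borel_measurable borel" for n unfolding T_def by measurable
  have T_lim: "(\<lambda>n. sqn (\<lambda>_. 1) (\<lambda>t. T n t - x t)) \<longlonglongrightarrow> 0"
    unfolding T_def by (rule sqn_truncate_tendsto[OF assms(1) moderate_one fin])
  have T_int: "integrable lborel (T n)" for n
  proof (rule Bochner_Integration.integrable_bound)
    show "integrable lborel (\<lambda>t. real n * indicator {-real n..real n} t)"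
      by (intro integrable_mult_right) simp
    show "AE t in lborel. norm (T n t) \<le> norm (real n * indicator {-real n..real n} t)"
      by (auto simp: T_def split: split_indicator)
  qed measurable
  \<comment> \<open>The increment of two transforms costs a factor \<open>K\<close> and two errors
    with factor 2 each; the threshold is chosen so that 1/4^m remains.\<close>
  have "\<exists>N. \<forall>n\<ge>N. sqn (\<lambda>_. 1) (\<lambda>t. T n t - x t) \<le> ennreal (1 / (4 * K * 4 ^ m))" for m :: nat
    using T_lim K unfolding ennreal_tendsto_0_iff eventually_sequentially by simp
  then obtain N where N: "\<And>m n. n \<ge> N m \<Longrightarrow> sqn (\<lambda>_. 1) (\<lambda>t. T n t - x t) \<le> ennreal (1 / (4 * K * 4 ^ m))"
    by metis
  \<comment> \<open>Taking the maximum makes \<open>r\<close> monotone, so that from index m onwards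
    all \<open>X n\<close> obey the bound with index m.\<close>
  define r where "r m = Max (N ` {..m}) + m" for m
  have rN: "r m \<ge> N m" for m unfolding r_def by (intro trans_le_add1 Max_ge) auto
  have r_mono: "r m \<le> r n" if "m \<le> n" for m n
    unfolding r_def using that by (intro add_mono Max_mono) auto
  define X where "X m = T (r m)" for m
  have [measurable]: "X m \<in> borel_measurable borel" for m unfolding X_def by measurable
  have X_int: "integrable lborel (X m)" for m unfolding X_def by (rule T_int)
  have X_bd: "sqn (\<lambda>_. 1) (\<lambda>t. X n t - x t) \<le> ennreal (1 / (4 * K * 4 ^ m))" if "m \<le> n" for m n
    unfolding X_def using rN[of m] r_mono[OF that] by (intro N) linarith
  let ?F = "\<lambda>m. fourier_integral (X m)"
  have F_bd: "sqn (\<lambda>_. 1) (\<lambda>\<omega>. ?F n \<omega> - ?F m \<omega>) \<le> ennreal (1 / 4 ^ m)" if "m \<le> n" for m n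
  proof -
    have "(\<lambda>\<omega>. ?F n \<omega> - ?F m \<omega>) = fourier_integral (\<lambda>t. X n t + (-1) * X m t)"
      using fourier_integral_add[of "X n" "\<lambda>t. (-1) * X m t"] X_int fourier_integral_cmult[of "X m" "-1"] by (simp add: fun_eq_iff)
    then have "sqn (\<lambda>_. 1) (\<lambda>\<omega>. ?F n \<omega> - ?F m \<omega>) \<le> ennreal K * sqn (\<lambda>_. 1) (\<lambda>t. X n t - X m t)"
      using K(2)[of "\<lambda>t. X n t + (-1) * X m t"] X_int by simp
    also have "\<dots> \<le> ennreal K * (2 * sqn (\<lambda>_. 1) (\<lambda>t. X n t - x t) + 2 * sqn (\<lambda>_. 1) (\<lambda>t. X m t - x t))"
      unfolding sqn_minus_commute[of _ "X m"]
      by (intro mult_left_mono sqn_diff_triangle) auto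
    also have "\<dots> \<le> ennreal K * (2 * ennreal (1 / (4 * K * 4 ^ m)) + 2 * ennreal (1 / (4 * K * 4 ^ m)))"
      using that by (intro mult_left_mono add_mono X_bd) auto
    also have "\<dots> = ennreal (1 / 4 ^ m)"
      using K(1) by (simp flip: ennreal_numeral ennreal_mult ennreal_plus)
    finally show ?thesis .
  qed
  define d where "d m \<omega> = ?F (Suc m) \<omega> - ?F m \<omega>" for m \<omega>
  have [measurable]: "d m \<in> borel_measurable borel" for m unfolding d_def by measurable
  \<comment> \<open>The weight 2^m leaves the summable bound 2^m/4^m for the integrals. In return a
    finite weighted sum of squares gives absolute summability of the increments, since |d| is at
    most 2^(-m) or at most 2^m |d|^2.\<close>
  have "(\<integral>\<^sup>+\<omega>. (\<Sum>m. ennreal (2 ^ m * (cmod (d m \<omega>))\<^sup>2)) \<partial>lborel) = (\<Sum>m. \<integral>\<^sup>+\<omega>. ennreal (2 ^ m * (cmod (d m \<omega>))\<^sup>2) \<partial>lborel)"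
    by (rule nn_integral_suminf) measurable
  also have "\<dots> \<le> (\<Sum>m. ennreal ((1 / 2) ^ m))"
  proof (intro suminf_le allI)
    fix m
    have "(\<integral>\<^sup>+\<omega>. ennreal (2 ^ m * (cmod (d m \<omega>))\<^sup>2) \<partial>lborel) = ennreal (2 ^ m) * sqn (\<lambda>_. 1) (d m)"
      unfolding sqn_def by (subst nn_integral_cmult[symmetric]) (auto simp: ennreal_mult)
    also have "\<dots> \<le> ennreal (2 ^ m) * ennreal (1 / 4 ^ m)"
      using F_bd[of m "Suc m"] by (intro mult_left_mono) (auto simp: d_def[abs_def])
    also have "\<dots> = ennreal ((1 / 2) ^ m)"
      by (subst ennreal_mult[symmetric]) (use power_mult_distrib[of "2::real" 2 m] in \<open>auto simp: power_divide\<close>)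
    finally show "(\<integral>\<^sup>+\<omega>. ennreal (2 ^ m * (cmod (d m \<omega>))\<^sup>2) \<partial>lborel) \<le> ennreal ((1 / 2) ^ m)" .
  qed auto
  also have "\<dots> < \<infinity>"
    by (subst suminf_ennreal2) auto
  finally have "AE \<omega> in lborel. (\<Sum>m. ennreal (2 ^ m * (cmod (d m \<omega>))\<^sup>2)) \<noteq> \<infinity>"
    by (intro nn_integral_PInf_AE) auto
  then have conv: "AE \<omega> in lborel. convergent (\<lambda>m. ?F m \<omega>)"
  proof eventually_elim
    case (elim \<omega>)
    have s: "summable (\<lambda>m. 2 ^ m * (cmod (d m \<omega>))\<^sup>2)"
      by (rule summable_suminf_not_top) (use elim in auto)
    have S: "summable (\<lambda>m. (1 / 2) ^ m + 2 ^ m * (cmod (d m \<omega>))\<^sup>2)"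
      by (intro summable_add s summable_geometric) auto
    have "cmod (d m \<omega>) \<le> (1 / 2) ^ m + 2 ^ m * (cmod (d m \<omega>))\<^sup>2" for m
    proof (cases "cmod (d m \<omega>) \<le> (1 / 2) ^ m")
      case False
      then have "1 \<le> 2 ^ m * cmod (d m \<omega>)" by (simp add: power_divide field_simps)
      then have "cmod (d m \<omega>) * 1 \<le> cmod (d m \<omega>) * (2 ^ m * cmod (d m \<omega>))" by (rule mult_left_mono) simp
      then show ?thesis by (simp add: power2_eq_square mult_ac add_increasing)
    qed (simp add: add_increasing2)
    then have "summable (\<lambda>m. d m \<omega>)"
      by (intro summable_comparison_test'[OF S, of 0])
    then have "convergent (\<lambda>n. \<Sum>m<n. d m \<omega>)" by (simp add: summable_iff_convergent)
    then have "convergent (\<lambda>n. ?F n \<omega> - ?F 0 \<omega>)"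
      unfolding d_def by (subst (asm) sum_lessThan_telescope)
    from convergent_add[OF this convergent_const[of "?F 0 \<omega>"]] show ?case by simp
  qed
  define y where "y \<omega> = lim (\<lambda>m. ?F m \<omega>)" for \<omega>
  have [measurable]: "y \<in> borel_measurable borel" unfolding y_def by measurable
  have lim: "AE \<omega> in lborel. (\<lambda>m. ?F m \<omega>) \<longlonglongrightarrow> y \<omega>"
    using conv by eventually_elim (simp add: y_def convergent_LIMSEQ_iff)
  have y_bd: "sqn (\<lambda>_. 1) (\<lambda>\<omega>. ?F m \<omega> - y \<omega>) \<le> ennreal (1 / 4 ^ m)" for m
  proof -
    have "sqn (\<lambda>_. 1) (\<lambda>\<omega>. ?F m \<omega> - y \<omega>) = (\<integral>\<^sup>+\<omega>. liminf (\<lambda>n. ennreal ((cmod (?F n \<omega> - ?F m \<omega>))\<^sup>2 * 1)) \<partial>lborel)"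
      unfolding sqn_def
    proof (rule nn_integral_cong_AE, use lim in eventually_elim)
      case (elim \<omega>)
      then have "(\<lambda>n. (cmod (?F n \<omega> - ?F m \<omega>))\<^sup>2 * 1) \<longlonglongrightarrow> (cmod (y \<omega> - ?F m \<omega>))\<^sup>2 * 1"
        by (intro tendsto_intros)
      from lim_imp_Liminf[OF _ tendsto_ennrealI[OF this]]
      show ?case by (simp add: norm_minus_commute)
    qed
    also have "\<dots> \<le> liminf (\<lambda>n. sqn (\<lambda>_. 1) (\<lambda>\<omega>. ?F n \<omega> - ?F m \<omega>))"
      unfolding sqn_def by (rule nn_integral_liminf) measurable
    also have "\<dots> \<le> limsup (\<lambda>n. sqn (\<lambda>_. 1) (\<lambda>\<omega>. ?F n \<omega> - ?F m \<omega>))"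
      by (rule Liminf_le_Limsup) simp
    also have "\<dots> \<le> ennreal (1 / 4 ^ m)"
      by (intro Limsup_bounded eventually_sequentiallyI[of m] F_bd) 
    finally show ?thesis .
  qed
  have small: "(\<lambda>m. ennreal (1 / 4 ^ m)) \<longlonglongrightarrow> 0"
    using tendsto_ennrealI[OF LIMSEQ_realpow_zero[of "1/4"]] by (simp add: power_divide)
  show thesis
  proof
    have "sqn (\<lambda>_. 1) (\<lambda>t. X m t - x t) \<le> ennreal (1 / 4 ^ m)" for m
      by (rule order_trans[OF X_bd[OF order_refl]], rule ennreal_leI) (use K in \<open>auto simp: field_simps\<close>)
    then have "(\<lambda>m. sqn (\<lambda>_. 1) (\<lambda>t. X m t - x t)) \<longlonglongrightarrow> 0"
      by (intro ennreal_tendsto_0_le[OF small]) auto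
    moreover have "(\<lambda>m. sqn (\<lambda>_. 1) (\<lambda>\<omega>. ?F m \<omega> - y \<omega>)) \<longlonglongrightarrow> 0"
      by (intro ennreal_tendsto_0_le[OF small]) (auto simp: y_bd)
    moreover have "sqn (\<lambda>_. 1) y < \<infinity>"
    \<comment> \<open>The limit is handled as a perturbation of the 0-th transform, which is square
      integrable because truncation does not increase the norm.\<close>
    proof -
      have "sqn (\<lambda>_. 1) (X 0) < \<infinity>"
      proof -
        have "sqn (\<lambda>_. 1) (X 0) \<le> sqn (\<lambda>_. 1) x"
          by (rule sqn_mono) (auto simp: X_def T_def)
        then show ?thesis using fin by simp
      qed
      then have "sqn (\<lambda>_. 1) (?F 0) < \<infinity>"
        using fourier_pair_integrable[OF X_int] by (simp add: fourier_pair_def)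
      moreover have "sqn (\<lambda>_. 1) (\<lambda>\<omega>. y \<omega> - ?F 0 \<omega>) < \<infinity>"
        unfolding sqn_minus_commute[of _ y] using y_bd[of 0] by (simp add: le_less_trans)
      ultimately have "sqn (\<lambda>_. 1) (\<lambda>\<omega>. (y \<omega> - ?F 0 \<omega>) + ?F 0 \<omega>) < \<infinity>"
        by (intro sqn_one_add_finite) auto
      then show ?thesis by simp
    qed
    ultimately show "fourier_pair x y"
      unfolding fourier_pair_def using fin X_int by auto
  qed
qed

section \<open>Pairings and the multiplication formula\<close>

lemma tendsto_pairing:
  assumes [measurable]: "\<And>n. u n \<in> borel_measurable borel" "v \<in> borel_measurable borel" "h \<in> borel_measurable borel"
    and fin: "\<And>n. sqn (\<lambda>_. 1) (u n) < \<infinity>" "sqn (\<lambda>_. 1) v < \<infinity>" "sqn (\<lambda>_. 1) h < \<infinity>"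
    and lim: "(\<lambda>n. sqn (\<lambda>_. 1) (\<lambda>t. u n t - v t)) \<longlonglongrightarrow> 0"
  shows "(\<lambda>n. LINT t|lborel. u n t * h t) \<longlonglongrightarrow> (LINT t|lborel. v t * h t)"
proof -
  \<comment> \<open>Cauchy-Schwarz in squared form, so that no roots are taken in
    \<open>ennreal\<close>; the root is taken at the end in the reals.\<close>
  have le: "(ennreal (cmod ((LINT t|lborel. u n t * h t) - (LINT t|lborel. v t * h t))))\<^sup>2
      \<le> sqn (\<lambda>_. 1) h * sqn (\<lambda>_. 1) (\<lambda>t. u n t - v t)" for n
  proof -
    have i: "integrable lborel (\<lambda>t. u n t * h t)" "integrable lborel (\<lambda>t. v t * h t)"
      by (intro integrable_L2_mult fin; measurable)+
    then have "(LINT t|lborel. u n t * h t) - (LINT t|lborel. v t * h t) = (LINT t|lborel. (u n t - v t) * h t)"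
      by (simp add: left_diff_distrib)
    also have "ennreal (cmod \<dots>) \<le> (\<integral>\<^sup>+t. ennreal (norm ((u n t - v t) * h t)) \<partial>lborel)"
      by (rule integral_norm_bound_ennreal) (use i in \<open>simp add: left_diff_distrib\<close>)
    also have "\<dots> = (\<integral>\<^sup>+t. ennreal (cmod (u n t - v t)) * ennreal (cmod (h t)) \<partial>lborel)"
      by (simp add: norm_mult ennreal_mult)
    finally have "(ennreal (cmod ((LINT t|lborel. u n t * h t) - (LINT t|lborel. v t * h t))))\<^sup>2
       \<le> (\<integral>\<^sup>+t. ennreal (cmod (u n t - v t)) * ennreal (cmod (h t)) \<partial>lborel)\<^sup>2"
      by (rule power_mono) simp
    also have "\<dots> \<le> sqn (\<lambda>_. 1) (\<lambda>t. u n t - v t) * sqn (\<lambda>_. 1) h"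
      unfolding sqn_def using Cauchy_Schwarz_nn_integral[of "\<lambda>t. ennreal (cmod (u n t - v t))" lborel "\<lambda>t. ennreal (cmod (h t))"]
      by (simp add: ennreal_power)
    finally show ?thesis by (simp add: mult.commute)
  qed
  have "(\<lambda>n. (ennreal (cmod ((LINT t|lborel. u n t * h t) - (LINT t|lborel. v t * h t))))\<^sup>2) \<longlonglongrightarrow> 0"
    by (rule ennreal_tendsto_0_le[OF ennreal_tendsto_0_cmult[OF lim fin(3)]]) (use le in auto)
  then have "(\<lambda>n. (cmod ((LINT t|lborel. u n t * h t) - (LINT t|lborel. v t * h t)))\<^sup>2) \<longlonglongrightarrow> 0"
    by (simp add: ennreal_power flip: ennreal_0)
  from tendsto_real_sqrt[OF this] show ?thesis
    by (simp add: tendsto_norm_zero_iff LIM_zero_cancel)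
qed

text \<open>Dropping an initial segment leaves approximants within distance 1 on both sides, hence
  square integrable together with their transforms.\<close>

lemma fourier_pairE:
  assumes "fourier_pair x y"
  obtains X where "\<And>n. integrable lborel (X n)" "\<And>n. sqn (\<lambda>_. 1) (X n) < \<infinity>"
    "\<And>n. sqn (\<lambda>_. 1) (fourier_integral (X n)) < \<infinity>"
    "(\<lambda>n. sqn (\<lambda>_. 1) (\<lambda>t. X n t - x t)) \<longlonglongrightarrow> 0"
    "(\<lambda>n. sqn (\<lambda>_. 1) (\<lambda>\<omega>. fourier_integral (X n) \<omega> - y \<omega>)) \<longlonglongrightarrow> 0"
proof -
  note d = assms[unfolded fourier_pair_def]
  from d obtain X where X: "\<And>n. integrable lborel (X n)" "(\<lambda>n. sqn (\<lambda>_. 1) (\<lambda>t. X n t - x t)) \<longlonglongrightarrow> 0"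
    "(\<lambda>n. sqn (\<lambda>_. 1) (\<lambda>\<omega>. fourier_integral (X n) \<omega> - y \<omega>)) \<longlonglongrightarrow> 0" by blast
  have [measurable]: "x \<in> borel_measurable borel" "y \<in> borel_measurable borel"
    "\<And>n. X n \<in> borel_measurable borel"
    using d X(1) by auto
  have fin: "sqn (\<lambda>_. 1) f < \<infinity>" if "sqn (\<lambda>_. 1) (\<lambda>t. f t - g t) \<le> ennreal 1" "sqn (\<lambda>_. 1) g < \<infinity>"
    and [measurable]: "f \<in> borel_measurable borel" "g \<in> borel_measurable borel" for f g
    using sqn_one_add_finite[of "\<lambda>t. f t - g t" g] that by (simp add: le_less_trans)
  obtain N1 where N1: "\<And>n. n \<ge> N1 \<Longrightarrow> sqn (\<lambda>_. 1) (\<lambda>t. X n t - x t) \<le> ennreal 1"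
    using X(2) unfolding ennreal_tendsto_0_iff eventually_sequentially by (meson zero_less_one)
  obtain N2 where N2: "\<And>n. n \<ge> N2 \<Longrightarrow> sqn (\<lambda>_. 1) (\<lambda>\<omega>. fourier_integral (X n) \<omega> - y \<omega>) \<le> ennreal 1"
    using X(3) unfolding ennreal_tendsto_0_iff eventually_sequentially by (meson zero_less_one)
  show thesis
  proof (rule that[of "\<lambda>n. X (n + (N1 + N2))"])
    show "sqn (\<lambda>_. 1) (X (n + (N1 + N2))) < \<infinity>" "sqn (\<lambda>_. 1) (fourier_integral (X (n + (N1 + N2)))) < \<infinity>" for n
      using fin[OF N1, of "n + (N1 + N2)"] fin[OF N2, of "n + (N1 + N2)"] d by auto
  qed (use X LIMSEQ_ignore_initial_segment[OF X(2), of "N1 + N2"] LIMSEQ_ignore_initial_segment[OF X(3), of "N1 + N2"] in auto)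
qed

text \<open>For integrable approximants this is Fubini with a symmetric kernel. Both pairings are
  continuous in L2, \<phi> and its transform being square integrable, so the identity passes to the
  limit. It allows computing with \<open>y\<close> although \<open>y\<close> is not given by an
  integral.\<close>

lemma fourier_pair_mult_formula:
  assumes xy: "fourier_pair x y" and phi: "integrable lborel \<phi>" "sqn (\<lambda>_. 1) \<phi> < \<infinity>"
  shows "(LINT \<omega>|lborel. y \<omega> * \<phi> \<omega>) = (LINT s|lborel. x s * fourier_integral \<phi> s)"
proof -
  note d = xy[unfolded fourier_pair_def]
  obtain X where X: "\<And>n. integrable lborel (X n)" "\<And>n. sqn (\<lambda>_. 1) (X n) < \<infinity>"
    "\<And>n. sqn (\<lambda>_. 1) (fourier_integral (X n)) < \<infinity>"
    "(\<lambda>n. sqn (\<lambda>_. 1) (\<lambda>t. X n t - x t)) \<longlonglongrightarrow> 0"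
    "(\<lambda>n. sqn (\<lambda>_. 1) (\<lambda>\<omega>. fourier_integral (X n) \<omega> - y \<omega>)) \<longlonglongrightarrow> 0"
    using fourier_pairE[OF xy] by blast
  have [measurable]: "x \<in> borel_measurable borel" "y \<in> borel_measurable borel" "\<phi> \<in> borel_measurable borel"
    "\<And>n. X n \<in> borel_measurable borel"
    using d X(1) phi by auto
  have F: "fourier_pair \<phi> (fourier_integral \<phi>)" by (rule fourier_pair_integrable[OF phi])
  have "(\<lambda>n. LINT \<omega>|lborel. fourier_integral (X n) \<omega> * \<phi> \<omega>) \<longlonglongrightarrow> (LINT \<omega>|lborel. y \<omega> * \<phi> \<omega>)"
    using d phi X by (intro tendsto_pairing) auto
  moreover have "(LINT \<omega>|lborel. fourier_integral (X n) \<omega> * \<phi> \<omega>) = (LINT s|lborel. X n s * fourier_integral \<phi> s)" for n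
  proof -
    have "(LINT \<omega>|lborel. \<phi> \<omega> * (LINT s|lborel. X n s * fchar \<omega> s)) = (LINT s|lborel. X n s * (LINT \<omega>|lborel. \<phi> \<omega> * fchar \<omega> s))"
      by (intro Fubini_bounded_kernel X phi) auto
    then show ?thesis
      by (simp add: fourier_integral_lborel mult.commute fchar_commute)
  qed
  moreover have "(\<lambda>n. LINT s|lborel. X n s * fourier_integral \<phi> s) \<longlonglongrightarrow> (LINT s|lborel. x s * fourier_integral \<phi> s)"
    using d F X unfolding fourier_pair_def by (intro tendsto_pairing) auto
  ultimately show ?thesis using LIMSEQ_unique by simp
qed

section \<open>Discretising superpositions\<close>

text \<open>One parameter m controls both the mesh 1/m and the window [-m, m]; the cells are
  numbered from -m^2 to m^2. The coefficient is the exact integral of \<open>k\<close> over a cell,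
  because \<open>k\<close> is an integrable function without meaningful point values.\<close>

definition cell_weight :: "(real \<Rightarrow> complex) \<Rightarrow> nat \<Rightarrow> int \<Rightarrow> complex" where
  "cell_weight k m j = (LINT s|lborel. (if \<bar>s\<bar> \<le> real m \<and> \<lfloor>real m * s\<rfloor> = j then k s else 0))"

definition cell_sum :: "(real \<Rightarrow> complex) \<Rightarrow> nat \<Rightarrow> (real \<Rightarrow> real \<Rightarrow> complex) \<Rightarrow> real \<Rightarrow> complex" where
  "cell_sum k m \<Phi> t = (\<Sum>j\<in>{- (int m * int m)..int m * int m}. cell_weight k m j * \<Phi> (real_of_int j / real m) t)"

lemma floor_cell_bounds:
  assumes "\<bar>s\<bar> \<le> real m"
  shows "\<lfloor>real m * s\<rfloor> \<in> {- (int m * int m)..int m * int m}"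
proof -
  have "- (real m * real m) \<le> real m * s" "real m * s \<le> real m * real m"
    using assms mult_left_mono[of s "real m" "real m"] mult_left_mono[of "- real m" s "real m"] by auto
  then have "\<lfloor>- (real m * real m)\<rfloor> \<le> \<lfloor>real m * s\<rfloor>" "\<lfloor>real m * s\<rfloor> \<le> \<lfloor>real m * real m\<rfloor>"
    by (intro floor_mono; simp)+
  moreover have "\<lfloor>real m * real m\<rfloor> = int m * int m" "\<lfloor>- (real m * real m)\<rfloor> = - (int m * int m)"
    by (metis floor_of_int of_int_mult of_int_of_nat_eq, metis floor_of_int of_int_minus of_int_mult of_int_of_nat_eq)
  ultimately show ?thesis by simp
qed

text \<open>Exact cell integrals turn the finite sum into an integral against the same
  \<open>k\<close>, with s replaced by the left endpoint of its cell. The discretisation error is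
  then an integral of \<open>k\<close> times a difference of values of \<Phi>.\<close>

lemma cell_sum_eq_integral:
  assumes k: "integrable lborel k"
  shows "cell_sum k m \<Phi> t = (LINT s|lborel. k s * (if \<bar>s\<bar> \<le> real m then \<Phi> (real_of_int \<lfloor>real m * s\<rfloor> / real m) t else 0))"
proof -
  have [measurable]: "k \<in> borel_measurable borel" using k by auto
  let ?J = "{- (int m * int m)..int m * int m}"
  let ?c = "\<lambda>j s. if \<bar>s\<bar> \<le> real m \<and> \<lfloor>real m * s\<rfloor> = j then k s else 0"
  have int: "integrable lborel (?c j)" for j
  proof (rule Bochner_Integration.integrable_bound[OF k])
    have "(\<lambda>s. if \<bar>s\<bar> \<le> real m \<and> real_of_int \<lfloor>real m * s\<rfloor> = real_of_int j then k s else 0) \<in> borel_measurable borel"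
      by measurable
    then show "?c j \<in> borel_measurable lborel" by simp
  qed auto
  have "cell_sum k m \<Phi> t = (\<Sum>j\<in>?J. LINT s|lborel. ?c j s * \<Phi> (real_of_int j / real m) t)"
    unfolding cell_sum_def cell_weight_def by simp
  also have "\<dots> = (LINT s|lborel. (\<Sum>j\<in>?J. ?c j s * \<Phi> (real_of_int j / real m) t))"
    by (rule Bochner_Integration.integral_sum[symmetric]) (intro integrable_mult_left int)
  also have "\<dots> = (LINT s|lborel. k s * (if \<bar>s\<bar> \<le> real m then \<Phi> (real_of_int \<lfloor>real m * s\<rfloor> / real m) t else 0))"
  proof (intro Bochner_Integration.integral_cong refl)
    fix s
    show "(\<Sum>j\<in>?J. ?c j s * \<Phi> (real_of_int j / real m) t) = k s * (if \<bar>s\<bar> \<le> real m then \<Phi> (real_of_int \<lfloor>real m * s\<rfloor> / real m) t else 0)"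
    proof (cases "\<bar>s\<bar> \<le> real m")
      case True
      have "(\<Sum>j\<in>?J. ?c j s * \<Phi> (real_of_int j / real m) t) = (\<Sum>j\<in>?J. if j = \<lfloor>real m * s\<rfloor> then k s * \<Phi> (real_of_int j / real m) t else 0)"
        using True by (intro sum.cong) auto
      also have "\<dots> = k s * \<Phi> (real_of_int \<lfloor>real m * s\<rfloor> / real m) t"
        using floor_cell_bounds[OF True] by (subst sum.delta) auto
      finally show ?thesis using True by simp
    qed simp
  qed
  finally show ?thesis .
qed

lemma floor_div_close:
  assumes "m \<ge> 1" shows "\<bar>real_of_int \<lfloor>real m * s\<rfloor> / real m - s\<bar> \<le> 1 / real m"
proof -
  have m: "real m > 0" using assms by simp
  have "\<bar>real_of_int \<lfloor>real m * s\<rfloor> - real m * s\<bar> \<le> 1" by linarith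
  then have "\<bar>real_of_int \<lfloor>real m * s\<rfloor> - real m * s\<bar> / real m \<le> 1 / real m"
    using m by (intro divide_right_mono) auto
  also have "\<bar>real_of_int \<lfloor>real m * s\<rfloor> - real m * s\<bar> / real m = \<bar>(real_of_int \<lfloor>real m * s\<rfloor> - real m * s) / real m\<bar>"
    using m by simp
  also have "(real_of_int \<lfloor>real m * s\<rfloor> - real m * s) / real m = real_of_int \<lfloor>real m * s\<rfloor> / real m - s"
    using m by (simp add: field_simps)
  finally show ?thesis .
qed

text \<open>The integral \<open>\<integral> k(s) \<Phi>(s, \<cdot>) ds\<close> is a limit of finite combinations of the \<open>\<Phi>(s, \<cdot>)\<close>, with
  coefficients that depend on \<open>k\<close> only. They therefore serve on the time and frequency sides at once.\<close>

lemma cell_sum_tendsto: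
  assumes k: "integrable lborel k" and W: "moderate W"
    and \<Phi> [measurable]: "case_prod \<Phi> \<in> borel_measurable (borel \<Otimes>\<^sub>M borel)"
    and cont: "\<And>t. continuous_on UNIV (\<lambda>s. \<Phi> s t)"
    and B: "\<And>s t. cmod (\<Phi> s t) \<le> B"
    and bd: "\<And>s s' t. \<bar>s' - s\<bar> \<le> 1 \<Longrightarrow> cmod (\<Phi> s' t) \<le> b s * d t"
    and [measurable]: "b \<in> borel_measurable borel" "d \<in> borel_measurable borel"
    and finb: "(\<integral>\<^sup>+s. ennreal (cmod (k s) * (b s)\<^sup>2) \<partial>lborel) < \<infinity>"
    and find: "(\<integral>\<^sup>+t. ennreal ((d t)\<^sup>2 * W t) \<partial>lborel) < \<infinity>"
  shows "(\<lambda>m. sqn W (\<lambda>t. cell_sum k m \<Phi> t - (LINT s|lborel. k s * \<Phi> s t))) \<longlonglongrightarrow> 0"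
proof -
  note [measurable] = moderateD[OF W]
  note W0 = moderate_nonneg[OF W]
  have [measurable]: "k \<in> borel_measurable borel" using k by auto
  have Ft [measurable]: "(\<lambda>s. \<Phi> s t) \<in> borel_measurable borel" for t
    by (rule borel_measurable_continuous_onI[OF cont])
  define q where "q m s = real_of_int \<lfloor>real m * s\<rfloor> / real m" for m :: nat and s
  have [measurable]: "q m \<in> borel_measurable borel" for m unfolding q_def by measurable
  define G where "G m s t = (if \<bar>s\<bar> \<le> real m then \<Phi> (q m s) t else 0)" for m s t
  have Gm [measurable]: "case_prod (G m) \<in> borel_measurable (borel \<Otimes>\<^sub>M borel)" for m
    unfolding G_def by measurable
  have Gs [measurable]: "G m s \<in> borel_measurable borel" "\<Phi> s \<in> borel_measurable borel" for m s
    by measurable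
  have B0: "0 \<le> B" using order_trans[OF norm_ge_zero B] .
  \<comment> \<open>The uniform bound \<open>B\<close> gives integrability in s at every fixed t;
    the product bound by \<open>b\<close> and \<open>d\<close> is kept for dominated
    convergence.\<close>
  have i\<Phi>: "integrable lborel (\<lambda>s. k s * \<Phi> s t)" for t
    by (rule Bochner_Integration.integrable_bound[OF integrable_mult_left[OF k, of "of_real B"]])
       (auto simp: norm_mult B0 intro!: mult_left_mono B)
  have iG: "integrable lborel (\<lambda>s. k s * G m s t)" for m t
  proof (rule Bochner_Integration.integrable_bound[OF integrable_mult_left[OF k, of "of_real B"]])
    show "AE s in lborel. norm (k s * G m s t) \<le> norm (k s * of_real B)"
      using B B0 by (auto simp: norm_mult G_def intro!: mult_left_mono)
    show "(\<lambda>s. k s * G m s t) \<in> borel_measurable lborel"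
      by measurable
  qed
  have diff: "cell_sum k m \<Phi> t - (LINT s|lborel. k s * \<Phi> s t) = (LINT s|lborel. k s * (G m s t - \<Phi> s t))" for m t
    unfolding right_diff_distrib cell_sum_eq_integral[OF k] G_def[symmetric] q_def[symmetric]
    by (rule Bochner_Integration.integral_diff[symmetric]) (intro iG i\<Phi>)+
  let ?A = "\<integral>\<^sup>+s. ennreal (cmod (k s)) \<partial>lborel"
  have A: "?A < \<infinity>" using k by (simp add: integrable_iff_bounded)
  let ?I = "\<lambda>m. \<integral>\<^sup>+s. ennreal (cmod (k s)) * sqn W (\<lambda>t. G m s t - \<Phi> s t) \<partial>lborel"
  have le: "sqn W (\<lambda>t. cell_sum k m \<Phi> t - (LINT s|lborel. k s * \<Phi> s t)) \<le> ?A * ?I m" for m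
    unfolding diff by (rule sqn_Jensen) (auto simp: W0)
  have bd0: "0 \<le> b s * d t" for s t
    using order_trans[OF norm_ge_zero bd[of s s t]] by simp
  \<comment> \<open>For m at least 1 the sampling point lies within distance 1 of s, the range in
    which \<open>bd\<close> controls \<Phi> by the value of \<open>b\<close> at s itself.\<close>
  have ptbd: "cmod (G m s t - \<Phi> s t) \<le> 2 * (b s * d t)" if "m \<ge> 1" for m s t
  proof -
    have "cmod (G m s t) \<le> b s * d t"
    proof (cases "\<bar>s\<bar> \<le> real m")
      case True
      have "\<bar>q m s - s\<bar> \<le> 1 / real m" unfolding q_def by (rule floor_div_close[OF that])
      also have "\<dots> \<le> 1" using that by simp
      finally show ?thesis using True bd by (simp add: G_def)
    qed (simp add: G_def bd0)
    moreover have "cmod (\<Phi> s t) \<le> b s * d t" by (rule bd) simp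
    ultimately show ?thesis using norm_triangle_ineq4[of "G m s t" "\<Phi> s t"] by linarith
  qed
  have ptlim: "(\<lambda>m. G (Suc m) s t) \<longlonglongrightarrow> \<Phi> s t" for s t
  proof -
    have "(\<lambda>m. q (Suc m) s) \<longlonglongrightarrow> s"
    proof (rule LIM_zero_cancel, rule Lim_null_comparison)
      show "\<forall>\<^sub>F m in sequentially. norm (q (Suc m) s - s) \<le> 1 / real (Suc m)"
        unfolding q_def real_norm_def by (intro always_eventually allI floor_div_close) simp
      show "(\<lambda>m. 1 / real (Suc m)) \<longlonglongrightarrow> 0"
        using LIMSEQ_inverse_real_of_nat by (simp add: inverse_eq_divide)
    qed
    moreover have "isCont (\<lambda>s. \<Phi> s t) s" using cont by (simp add: continuous_on_eq_continuous_at)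
    ultimately have "(\<lambda>m. \<Phi> (q (Suc m) s) t) \<longlonglongrightarrow> \<Phi> s t" by (rule isCont_tendsto_compose[rotated])
    moreover obtain N :: nat where "\<bar>s\<bar> \<le> N" using real_arch_simple by blast
    then have "\<forall>\<^sub>F m in sequentially. \<Phi> (q (Suc m) s) t = G (Suc m) s t"
      by (intro eventually_sequentiallyI[of N]) (auto simp: G_def)
    ultimately show ?thesis by (rule Lim_transform_eventually)
  qed
  have D: "(\<integral>\<^sup>+t. ennreal ((2 * (b s * d t))\<^sup>2 * W t) \<partial>lborel) = ennreal (4 * (b s)\<^sup>2) * (\<integral>\<^sup>+t. ennreal ((d t)\<^sup>2 * W t) \<partial>lborel)" for s
    by (subst nn_integral_cmult[symmetric]) (auto simp: power_mult_distrib mult.assoc W0 ennreal_mult[symmetric])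
  \<comment> \<open>Dominated convergence is used twice: in t for fixed s, and then in s. The
    shifted index keeps the mesh parameter positive.\<close>
  have "(\<lambda>m. ?I (Suc m)) \<longlonglongrightarrow> (\<integral>\<^sup>+s. 0 \<partial>(lborel :: real measure))"
  proof (rule nn_integral_dominated_convergence[where
        w="\<lambda>s. ennreal (cmod (k s) * (b s)\<^sup>2) * (4 * (\<integral>\<^sup>+t. ennreal ((d t)\<^sup>2 * W t) \<partial>lborel))"])
    show "AE s in lborel. ennreal (cmod (k s)) * sqn W (\<lambda>t. G (Suc m) s t - \<Phi> s t) \<le>
        ennreal (cmod (k s) * (b s)\<^sup>2) * (4 * (\<integral>\<^sup>+t. ennreal ((d t)\<^sup>2 * W t) \<partial>lborel))" for m
    proof (rule AE_I2)
      fix s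
      have "sqn W (\<lambda>t. G (Suc m) s t - \<Phi> s t) \<le> (\<integral>\<^sup>+t. ennreal ((2 * (b s * d t))\<^sup>2 * W t) \<partial>lborel)"
        unfolding sqn_def by (intro nn_integral_mono ennreal_leI mult_right_mono power_mono ptbd W0) auto
      then have "ennreal (cmod (k s)) * sqn W (\<lambda>t. G (Suc m) s t - \<Phi> s t) \<le>
          ennreal (cmod (k s)) * (ennreal (4 * (b s)\<^sup>2) * (\<integral>\<^sup>+t. ennreal ((d t)\<^sup>2 * W t) \<partial>lborel))"
        unfolding D by (rule mult_left_mono) simp
      also have "\<dots> = ennreal (cmod (k s) * (b s)\<^sup>2) * (4 * (\<integral>\<^sup>+t. ennreal ((d t)\<^sup>2 * W t) \<partial>lborel))"
        by (simp add: ennreal_mult mult_ac)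
      finally show "ennreal (cmod (k s)) * sqn W (\<lambda>t. G (Suc m) s t - \<Phi> s t) \<le>
        ennreal (cmod (k s) * (b s)\<^sup>2) * (4 * (\<integral>\<^sup>+t. ennreal ((d t)\<^sup>2 * W t) \<partial>lborel))" .
    qed
    show "(\<integral>\<^sup>+s. ennreal (cmod (k s) * (b s)\<^sup>2) * (4 * (\<integral>\<^sup>+t. ennreal ((d t)\<^sup>2 * W t) \<partial>lborel)) \<partial>lborel) < \<infinity>"
      using finb find by (subst nn_integral_multc) (auto simp: ennreal_mult_less_top)
    show "AE s in lborel. (\<lambda>m. ennreal (cmod (k s)) * sqn W (\<lambda>t. G (Suc m) s t - \<Phi> s t)) \<longlonglongrightarrow> 0"
    proof (rule AE_I2)
      fix s
      have "(\<lambda>m. sqn W (\<lambda>t. G (Suc m) s t - \<Phi> s t)) \<longlonglongrightarrow> 0"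
      proof (rule sqn_dominated_convergence[where B="\<lambda>t. 2 * (b s * d t)"])
        show "(\<integral>\<^sup>+t. ennreal ((2 * (b s * d t))\<^sup>2 * W t) \<partial>lborel) < \<infinity>"
          unfolding D using find by (simp add: ennreal_mult_less_top)
      qed (auto simp: W0 ptbd ptlim)
      then show "(\<lambda>m. ennreal (cmod (k s)) * sqn W (\<lambda>t. G (Suc m) s t - \<Phi> s t)) \<longlonglongrightarrow> 0"
        by (rule ennreal_tendsto_0_cmult) simp
    qed
  qed (auto simp: sqn_def)
  then have "(\<lambda>m. ?I (Suc m)) \<longlonglongrightarrow> 0" by simp
  then have "?I \<longlonglongrightarrow> 0" by (rule LIMSEQ_imp_Suc)
  from ennreal_tendsto_0_cmult[OF this A] show ?thesis
    by (rule ennreal_tendsto_0_le) (simp add: le)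
qed

section \<open>Superpositions of Gaussians\<close>

text \<open>Comparing W(t) with W(0) shows that a moderate weight grows at most exponentially, which
  a Gaussian outweighs.\<close>

lemma nn_integral_exp_quad_moderate:
  assumes a: "a > 0" and W: "moderate W"
  shows "(\<integral>\<^sup>+t. ennreal ((exp (- a * t\<^sup>2))\<^sup>2 * W t) \<partial>lborel) < \<infinity>"
proof -
  from W obtain C c where C: "0 \<le> C" "0 \<le> c" "\<And>s t. W (t + s) \<le> C * exp (c * \<bar>s\<bar>) * W t"
    unfolding moderate_def by blast
  have i: "integrable lborel (\<lambda>t. C * W 0 * exp (c * \<bar>t\<bar> - (2 * a) * t\<^sup>2))"
    using a by (intro integrable_mult_right integrable_exp_quad) auto
  have "(\<integral>\<^sup>+t. ennreal ((exp (- a * t\<^sup>2))\<^sup>2 * W t) \<partial>lborel) \<le> (\<integral>\<^sup>+t. ennreal (C * W 0 * exp (c * \<bar>t\<bar> - (2 * a) * t\<^sup>2)) \<partial>lborel)"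
  proof (intro nn_integral_mono ennreal_leI)
    fix t
    have "(exp (- a * t\<^sup>2))\<^sup>2 * W t \<le> (exp (- a * t\<^sup>2))\<^sup>2 * (C * exp (c * \<bar>t\<bar>) * W 0)"
      using C(3)[of 0 t] by (intro mult_left_mono) auto
    also have "\<dots> = C * W 0 * (exp (c * \<bar>t\<bar>) * exp (2 * (- a * t\<^sup>2)))"
      unfolding exp_double by (simp only: mult_ac)
    also have "exp (c * \<bar>t\<bar>) * exp (2 * (- a * t\<^sup>2)) = exp (c * \<bar>t\<bar> - (2 * a) * t\<^sup>2)"
      by (simp flip: exp_add)
    finally show "(exp (- a * t\<^sup>2))\<^sup>2 * W t \<le> C * W 0 * exp (c * \<bar>t\<bar> - (2 * a) * t\<^sup>2)" .
  qed
  also have "\<dots> < \<infinity>"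
    by (subst nn_integral_eq_integral[OF i]) (use C moderate_nonneg[OF W] in auto)
  finally show ?thesis .
qed

lemma gauss_measurable [measurable]: "gauss \<alpha> \<tau> \<in> borel_measurable borel"
  unfolding gauss_def by measurable

lemma norm_gauss: "\<alpha> > 0 \<Longrightarrow> cmod (gauss \<alpha> \<tau> t) = sqrt \<alpha> * exp (- pi * \<alpha> * (t - \<tau>)\<^sup>2)"
  unfolding gauss_def norm_of_real by simp

lemma sqn_gauss_finite:
  assumes \<alpha>: "\<alpha> > 0" and W: "moderate W"
  shows "sqn W (gauss \<alpha> \<tau>) < \<infinity>"
proof -
  note [measurable] = moderateD[OF W]
  from W obtain C c where C: "0 \<le> C" "0 \<le> c" "\<And>s t. W (t + s) \<le> C * exp (c * \<bar>s\<bar>) * W t"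
    unfolding moderate_def by blast
  define g :: "real \<Rightarrow> complex" where "g t = of_real (exp (- (pi * \<alpha>) * t\<^sup>2))" for t
  have [measurable]: "g \<in> borel_measurable borel" unfolding g_def by measurable
  have g: "sqn W g < \<infinity>"
    using nn_integral_exp_quad_moderate[OF _ W, of "pi * \<alpha>"] \<alpha> by (simp add: sqn_def g_def)
  have "sqn W (gauss \<alpha> \<tau>) = sqn W (\<lambda>t. of_real (sqrt \<alpha>) * g (t - \<tau>))"
    by (simp add: gauss_def[abs_def] g_def)
  also have "\<dots> = ennreal ((cmod (of_real (sqrt \<alpha>)))\<^sup>2) * sqn W (\<lambda>t. g (t - \<tau>))"
    by (rule sqn_cmult) auto
  also have "\<dots> \<le> ennreal ((cmod (of_real (sqrt \<alpha>)))\<^sup>2) * (ennreal (C * exp (c * \<bar>\<tau>\<bar>)) * sqn W g)"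
    by (intro mult_left_mono sqn_translate C) auto
  also have "\<dots> < \<infinity>" using g by (simp add: ennreal_mult_less_top)
  finally show ?thesis .
qed

text \<open>The modulus does not depend on \<tau>, which makes a single frequency majorant serve all
  translates.\<close>

lemma norm_fourier_gauss:
  "\<alpha> > 0 \<Longrightarrow> cmod (fourier_integral (gauss \<alpha> \<tau>) \<omega>) = exp (- (pi / \<alpha>) * \<omega>\<^sup>2)"
  by (simp add: fourier_gauss norm_mult)

lemma sqn_fourier_gauss_finite:
  assumes \<alpha>: "\<alpha> > 0" and W: "moderate W"
  shows "sqn W (fourier_integral (gauss \<alpha> \<tau>)) < \<infinity>"
  unfolding sqn_def norm_fourier_gauss[OF \<alpha>]
  using \<alpha> by (intro nn_integral_exp_quad_moderate W) simp

lemma integrable_gauss: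
  assumes "\<alpha> > 0" shows "integrable lborel (gauss \<alpha> \<tau>)"
proof -
  have "integrable lborel (\<lambda>t. exp (- (pi * \<alpha>) * (- \<tau> + 1 * t)\<^sup>2))"
    using integrable_exp_quad0[of "pi * \<alpha>"] assms by (intro lborel_integrable_real_affine) auto
  then have "integrable lborel (\<lambda>t. complex_of_real (sqrt \<alpha> * exp (- (pi * \<alpha>) * (- \<tau> + 1 * t)\<^sup>2)))"
    by (intro integrable_of_real integrable_mult_right)
  then show ?thesis by (simp add: gauss_def[abs_def])
qed

lemma fourier_pair_gauss: "\<alpha> > 0 \<Longrightarrow> fourier_pair (gauss \<alpha> \<tau>) (fourier_integral (gauss \<alpha> \<tau>))"
  by (intro fourier_pair_integrable integrable_gauss sqn_gauss_finite moderate_one)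

text \<open>The factor that is constant in t after completing the square in H(t) G(t - s), with the
  prefactor of \<open>gauss\<close> divided out.\<close>

definition gauss_factor :: "real \<Rightarrow> real \<Rightarrow> complex" where
  "gauss_factor e s = of_real (exp (- (pi / (e\<^sup>2 + 1 / e\<^sup>2)) * s\<^sup>2) / (e * sqrt (e\<^sup>2 + 1 / e\<^sup>2)))"

lemma gauss_factor_measurable [measurable]: "gauss_factor e \<in> borel_measurable borel"
  unfolding gauss_factor_def by measurable

text \<open>Completing the square in t: e^2 t^2 + (t - s)^2/e^2 = s^2/\<alpha> + \<alpha> (t -
  \<rho> s)^2. The curvature is \<alpha> for all s and the centre is \<rho> s, with \<rho> = 1/(1 +
  e^4).\<close>

lemma hat_mult_hat_kernel:
  assumes e: "e > 0" and \<alpha>: "\<alpha> = e\<^sup>2 + 1 / e\<^sup>2" and \<rho>: "\<rho> = 1 / (e\<^sup>2 * \<alpha>)"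
  shows "hat_mult e t * hat_kernel e (t - s) = gauss_factor e s * gauss \<alpha> (\<rho> * s) t"
proof -
  have \<alpha>0: "\<alpha> > 0" using e unfolding \<alpha> by (intro add_pos_pos) auto
  have "e\<^sup>2 * t\<^sup>2 + (t - s)\<^sup>2 / e\<^sup>2 = \<alpha> * t\<^sup>2 - 2 * t * s / e\<^sup>2 + s\<^sup>2 / e\<^sup>2"
    by (simp add: \<alpha> power2_diff distrib_right diff_divide_distrib add_divide_distrib)
  moreover have "\<alpha> * (t - \<rho> * s)\<^sup>2 = \<alpha> * t\<^sup>2 - 2 * t * s / e\<^sup>2 + s\<^sup>2 / (e\<^sup>2 * e\<^sup>2 * \<alpha>)"
    using e \<alpha>0 by (simp add: \<rho> power2_diff power_mult_distrib power_divide) (simp add: field_simps power2_eq_square)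
  moreover have "s\<^sup>2 / (e\<^sup>2 * e\<^sup>2 * \<alpha>) + s\<^sup>2 / \<alpha> = s\<^sup>2 / e\<^sup>2"
  proof -
    have cancel: "s\<^sup>2 * (E * \<alpha>) / (E * E * \<alpha>) = s\<^sup>2 / E" if "E > 0" for E :: real
      using that \<alpha>0 by simp
    have "s\<^sup>2 / (e\<^sup>2 * e\<^sup>2 * \<alpha>) + s\<^sup>2 / \<alpha> = s\<^sup>2 * (1 + e\<^sup>2 * e\<^sup>2) / (e\<^sup>2 * e\<^sup>2 * \<alpha>)"
      using e \<alpha>0 by (simp add: field_simps)
    also have "1 + e\<^sup>2 * e\<^sup>2 = e\<^sup>2 * \<alpha>" using e by (simp add: \<alpha> field_simps)
    also have "s\<^sup>2 * (e\<^sup>2 * \<alpha>) / (e\<^sup>2 * e\<^sup>2 * \<alpha>) = s\<^sup>2 / e\<^sup>2"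
      by (rule cancel) (use e in simp)
    finally show ?thesis .
  qed
  ultimately have eq: "e\<^sup>2 * t\<^sup>2 + (t - s)\<^sup>2 / e\<^sup>2 = s\<^sup>2 / \<alpha> + \<alpha> * (t - \<rho> * s)\<^sup>2" by simp
  have "- pi * (e * t)\<^sup>2 + - pi * ((t - s) / e)\<^sup>2 = - pi * (e\<^sup>2 * t\<^sup>2 + (t - s)\<^sup>2 / e\<^sup>2)"
    by (simp only: power_mult_distrib power_divide distrib_left)
  also have "\<dots> = - (pi / \<alpha>) * s\<^sup>2 + - pi * \<alpha> * (t - \<rho> * s)\<^sup>2"
    unfolding eq distrib_left by simp
  finally have "exp (- pi * (e * t)\<^sup>2) * exp (- pi * ((t - s) / e)\<^sup>2) = exp (- (pi / \<alpha>) * s\<^sup>2) * exp (- pi * \<alpha> * (t - \<rho> * s)\<^sup>2)"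
    by (simp only: exp_add[symmetric])
  then have "exp (- pi * (e * t)\<^sup>2) * (exp (- pi * ((t - s) / e)\<^sup>2) / e)
      = exp (- (pi / \<alpha>) * s\<^sup>2) / (e * sqrt \<alpha>) * (sqrt \<alpha> * exp (- pi * \<alpha> * (t - \<rho> * s)\<^sup>2))"
    using e \<alpha>0 by (simp add: field_simps)
  then show ?thesis
    unfolding hat_mult_def hat_kernel_def gauss_factor_def gauss_def \<alpha>[symmetric] by (metis of_real_mult)
qed

lemma hat_kernel_even: "hat_kernel e (- t) = hat_kernel e t"
  by (simp add: hat_kernel_def)

lemma hat_mult_gconv_eq:
  assumes "e > 0" "\<alpha> = e\<^sup>2 + 1 / e\<^sup>2" "\<rho> = 1 / (e\<^sup>2 * \<alpha>)"
  shows "hat_mult e t * gconv e x t = (LINT s|lborel. (gauss_factor e s * x s) * gauss \<alpha> (\<rho> * s) t)"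
  unfolding gconv_def
  by (subst integral_mult_right_zero[symmetric])
     (simp only: mult.assoc[symmetric] hat_mult_hat_kernel[OF assms], simp only: mult_ac)

text \<open>The left side pairs y with \<phi>(\<nu>) = H(\<nu>) G(\<omega> - \<nu>), and the
  multiplication formula moves the transform onto \<phi>. Writing G as an integral of H against
  characters and exchanging integrals produces H(t) G(t - s) again. The density on the frequency
  side is therefore the one on the time side, with each Gaussian replaced by its transform.\<close>

lemma gconv_hat_mult_eq:
  assumes e: "e > 0" and \<alpha>: "\<alpha> = e\<^sup>2 + 1 / e\<^sup>2" and \<rho>: "\<rho> = 1 / (e\<^sup>2 * \<alpha>)" and xy: "fourier_pair x y"
  shows "gconv e (\<lambda>\<nu>. hat_mult e \<nu> * y \<nu>) \<omega> = (LINT s|lborel. (gauss_factor e s * x s) * fourier_integral (gauss \<alpha> (\<rho> * s)) \<omega>)"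
proof -
  define \<phi> where "\<phi> \<nu> = hat_mult e \<nu> * hat_kernel e (\<omega> - \<nu>)" for \<nu>
  have [measurable]: "\<phi> \<in> borel_measurable borel" unfolding \<phi>_def by measurable
  have phi: "integrable lborel \<phi>" "sqn (\<lambda>_. 1) \<phi> < \<infinity>"
  proof -
    show "integrable lborel \<phi>"
      unfolding \<phi>_def using e by (intro integrable_L2_mult sqn_hat_mult sqn_hat_kernel) auto
    show "sqn (\<lambda>_. 1) \<phi> < \<infinity>"
      unfolding \<phi>_def by (rule le_less_trans[OF sqn_hat_mult_le[OF moderate_one] sqn_hat_kernel[OF e]])
  qed
  have F\<phi>: "fourier_integral \<phi> s = gauss_factor e s * fourier_integral (gauss \<alpha> (\<rho> * s)) \<omega>" for s
  proof -
    have "fourier_integral \<phi> s = (LINT \<nu>|lborel. (hat_mult e \<nu> * fchar s \<nu>) * (LINT t|lborel. hat_mult e t * fchar (\<omega> - \<nu>) t))"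
      using e by (simp add: fourier_integral_lborel fourier_hat_mult \<phi>_def mult_ac)
    also have "\<dots> = (LINT t|lborel. hat_mult e t * (LINT \<nu>|lborel. (hat_mult e \<nu> * fchar s \<nu>) * fchar (\<omega> - \<nu>) t))"
      using e by (intro Fubini_bounded_kernel integrable_fchar_mult integrable_hat_mult) auto
    also have "\<dots> = (LINT t|lborel. gauss_factor e s * (gauss \<alpha> (\<rho> * s) t * fchar \<omega> t))"
    proof (intro Bochner_Integration.integral_cong refl)
      fix t
      \<comment> \<open>Regrouping the phases, s \<nu> + (\<omega> - \<nu>) t = \<omega> t + (s - t)
        \<nu>, isolates a transform of H at s - t.\<close>
      have "fchar s \<nu> * fchar (\<omega> - \<nu>) t = fchar \<omega> t * fchar (s - t) \<nu>" for \<nu>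
        by (simp add: fchar_def algebra_simps flip: exp_add)
      then have "(LINT \<nu>|lborel. (hat_mult e \<nu> * fchar s \<nu>) * fchar (\<omega> - \<nu>) t) = (LINT \<nu>|lborel. fchar \<omega> t * (hat_mult e \<nu> * fchar (s - t) \<nu>))"
        by (simp only: mult.assoc) (simp only: mult.left_commute)
      also have "\<dots> = fchar \<omega> t * hat_kernel e (t - s)"
        using e hat_kernel_even[of e "s - t"] by (subst integral_mult_right_zero) (simp add: fourier_hat_mult)
      finally have "hat_mult e t * (LINT \<nu>|lborel. (hat_mult e \<nu> * fchar s \<nu>) * fchar (\<omega> - \<nu>) t) = (hat_mult e t * hat_kernel e (t - s)) * fchar \<omega> t"
        by simp
      then show "hat_mult e t * (LINT \<nu>|lborel. (hat_mult e \<nu> * fchar s \<nu>) * fchar (\<omega> - \<nu>) t) = gauss_factor e s * (gauss \<alpha> (\<rho> * s) t * fchar \<omega> t)"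
        unfolding hat_mult_hat_kernel[OF e \<alpha> \<rho>] by (simp only: mult.assoc)
    qed
    also have "\<dots> = gauss_factor e s * fourier_integral (gauss \<alpha> (\<rho> * s)) \<omega>"
      by (subst integral_mult_right_zero) (simp add: fourier_integral_lborel)
    finally show ?thesis .
  qed
  have "gconv e (\<lambda>\<nu>. hat_mult e \<nu> * y \<nu>) \<omega> = (LINT \<nu>|lborel. y \<nu> * \<phi> \<nu>)"
    unfolding gconv_def \<phi>_def by (simp only: mult_ac)
  also have "\<dots> = (LINT s|lborel. x s * fourier_integral \<phi> s)"
    by (rule fourier_pair_mult_formula[OF xy phi])
  finally show ?thesis unfolding F\<phi> by (simp only: mult_ac)
qed

text \<open>The decay in s absorbs any exponential. Paired with a square integrable x, it makes the
  superposition density integrable against exponentials of every rate.\<close>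

lemma sqn_gauss_factor_exp:
  assumes e: "e > 0"
  shows "sqn (\<lambda>_. 1) (\<lambda>s. gauss_factor e s * of_real (A * exp (c * \<bar>s\<bar>))) < \<infinity>"
proof -
  define a where "a = pi / (e\<^sup>2 + 1 / e\<^sup>2)"
  define D where "D = (A / (e * sqrt (e\<^sup>2 + 1 / e\<^sup>2)))\<^sup>2"
  have "e\<^sup>2 + 1 / e\<^sup>2 > 0" using e by (intro add_pos_pos) auto
  then have a: "a > 0" by (simp add: a_def)
  have i: "integrable lborel (\<lambda>s. D * exp ((2 * c) * \<bar>s\<bar> - (2 * a) * s\<^sup>2))"
    using a by (intro integrable_mult_right integrable_exp_quad) auto
  have "(cmod (gauss_factor e s * of_real (A * exp (c * \<bar>s\<bar>))))\<^sup>2 * 1 = D * exp ((2 * c) * \<bar>s\<bar> - (2 * a) * s\<^sup>2)" for s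
  proof -
    have "(exp (- a * s\<^sup>2))\<^sup>2 * (exp (c * \<bar>s\<bar>))\<^sup>2 = exp ((2 * c) * \<bar>s\<bar> - (2 * a) * s\<^sup>2)"
      by (simp flip: exp_double exp_add)
    then show ?thesis
      unfolding gauss_factor_def a_def[symmetric] D_def of_real_mult[symmetric] norm_of_real power2_abs
      by (simp add: power_mult_distrib power_divide)
  qed
  then have "sqn (\<lambda>_. 1) (\<lambda>s. gauss_factor e s * of_real (A * exp (c * \<bar>s\<bar>))) = (\<integral>\<^sup>+s. ennreal (D * exp ((2 * c) * \<bar>s\<bar> - (2 * a) * s\<^sup>2)) \<partial>lborel)"
    unfolding sqn_def by simp
  also have "\<dots> < \<infinity>"
    by (subst nn_integral_eq_integral[OF i]) (auto simp: D_def)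
  finally show ?thesis .
qed

text \<open>The exponential density and its reflection together dominate the two-sided exponential,
  up to the factor 1/\<mu>.\<close>

lemma nn_integral_exp_abs:
  assumes "\<mu> > 0" shows "(\<integral>\<^sup>+t. ennreal (exp (- \<mu> * \<bar>t\<bar>)) \<partial>lborel) < \<infinity>"
proof -
  let ?E = "exponential_density \<mu>"
  have E: "(\<integral>\<^sup>+t. ennreal (?E t) \<partial>lborel) = 1"
    using prob_space.emeasure_space_1[OF prob_space_exponential_density[OF assms]] by (simp add: emeasure_density)
  have E': "(\<integral>\<^sup>+t. ennreal (?E (- t)) \<partial>lborel) = 1"
    using nn_integral_real_affine[of "\<lambda>t. ennreal (?E t)" "-1" 0] E by simp
  have "(\<integral>\<^sup>+t. ennreal (exp (- \<mu> * \<bar>t\<bar>)) \<partial>lborel) \<le> (\<integral>\<^sup>+t. ennreal (1 / \<mu>) * (ennreal (?E t) + ennreal (?E (- t))) \<partial>lborel)"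
  proof (rule nn_integral_mono)
    fix t
    have "exp (- \<mu> * \<bar>t\<bar>) \<le> 1 / \<mu> * (?E t + ?E (- t))"
      using assms by (auto simp: exponential_density_def field_simps abs_if)
    moreover have "0 \<le> ?E t" "0 \<le> ?E (- t)" using assms by (auto simp: exponential_density_def)
    ultimately show "ennreal (exp (- \<mu> * \<bar>t\<bar>)) \<le> ennreal (1 / \<mu>) * (ennreal (?E t) + ennreal (?E (- t)))"
      using assms by (simp add: ennreal_mult[symmetric] ennreal_leI flip: ennreal_plus)
  qed
  also have "\<dots> = ennreal (1 / \<mu>) * (1 + 1)"
    using E E' by (subst nn_integral_cmult) (auto simp: nn_integral_add)
  also have "\<dots> < \<infinity>" by (simp add: ennreal_mult_less_top)
  finally show ?thesis .
qed

text \<open>An exponential bound: a Gaussian bound in \<open>t\<close> would lose the decay in \<open>s\<close> that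
  \<open>gauss_factor\<close> provides.\<close>

lemma norm_gauss_exp_bound:
  assumes \<alpha>: "\<alpha> > 0" and \<rho>: "0 \<le> \<rho>" "\<rho> \<le> 1" and \<mu>: "0 \<le> \<mu>" and s: "\<bar>s' - s\<bar> \<le> 1"
  shows "cmod (gauss \<alpha> (\<rho> * s') t) \<le> (sqrt \<alpha> * exp (\<mu>\<^sup>2 / (4 * pi * \<alpha>) + \<mu>) * exp (\<mu> * \<bar>s\<bar>)) * exp (- \<mu> * \<bar>t\<bar>)"
proof -
  define r where "r = \<bar>t - \<rho> * s'\<bar>"
  have "\<bar>\<rho> * s'\<bar> \<le> 1 * \<bar>s'\<bar>" unfolding abs_mult using \<rho> by (intro mult_right_mono) auto
  \<comment> \<open>Allowing s' to differ from s by 1 costs the additive 1 here and hence the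
    summand \<mu> in the exponent of the constant.\<close>
  then have "\<bar>t\<bar> \<le> r + \<bar>s\<bar> + 1" using s unfolding r_def by linarith
  then have "\<mu> * \<bar>t\<bar> \<le> \<mu> * (r + \<bar>s\<bar> + 1)" using \<mu> by (rule mult_left_mono)
  then have m: "- \<mu> * r \<le> \<mu> + \<mu> * \<bar>s\<bar> - \<mu> * \<bar>t\<bar>" by (simp add: algebra_simps)
  \<comment> \<open>This square trades Gaussian for exponential decay: the maximum of \<mu> r - pi
    \<alpha> r^2 is \<mu>^2/(4 pi \<alpha>).\<close>
  have "0 \<le> (2 * pi * \<alpha> * r - \<mu>)\<^sup>2 / (4 * pi * \<alpha>)" using \<alpha> by simp
  also have "\<dots> = pi * \<alpha> * r\<^sup>2 - \<mu> * r + \<mu>\<^sup>2 / (4 * pi * \<alpha>)"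
    using \<alpha> by (simp add: power2_eq_square field_simps)
  finally have "- pi * \<alpha> * r\<^sup>2 \<le> (\<mu>\<^sup>2 / (4 * pi * \<alpha>) + \<mu>) + \<mu> * \<bar>s\<bar> + - \<mu> * \<bar>t\<bar>" using m by simp
  then have "exp (- pi * \<alpha> * r\<^sup>2) \<le> exp (\<mu>\<^sup>2 / (4 * pi * \<alpha>) + \<mu>) * exp (\<mu> * \<bar>s\<bar>) * exp (- \<mu> * \<bar>t\<bar>)"
    by (simp only: exp_add[symmetric] exp_le_cancel_iff)
  from mult_left_mono[OF this, of "sqrt \<alpha>"] show ?thesis
    using \<alpha> by (simp add: norm_gauss r_def mult.assoc)
qed

section \<open>Density of the span for Fourier pairs\<close>

lemma gauss_span_sum:
  assumes "finite J" "\<alpha> > 0"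
  shows "(\<lambda>t. \<Sum>j\<in>J. c j * gauss \<alpha> (\<tau> j) t) \<in> cfun.span {gauss \<alpha> \<tau> | \<alpha> \<tau>. \<alpha> > 0} \<and>
     fourier_pair (\<lambda>t. \<Sum>j\<in>J. c j * gauss \<alpha> (\<tau> j) t) (\<lambda>\<omega>. \<Sum>j\<in>J. c j * fourier_integral (gauss \<alpha> (\<tau> j)) \<omega>)"
  using assms(1)
proof induction
  case empty
  \<comment> \<open>The zero pair is obtained as a zero multiple of a pair already known.\<close>
  have "fourier_pair (\<lambda>t. 0 * gauss 1 0 t) (\<lambda>\<omega>. 0 * fourier_integral (gauss 1 0) \<omega>)"
    by (intro fourier_pair_cmult fourier_pair_gauss) simp
  moreover have "(\<lambda>t::real. 0::complex) = 0" by (simp add: fun_eq_iff)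
  ultimately show ?case using cfun.span_zero by simp
next
  case (insert j J)
  have "gauss \<alpha> (\<tau> j) \<in> cfun.span {gauss \<alpha> \<tau> | \<alpha> \<tau>. \<alpha> > 0}"
    using assms(2) by (intro cfun.span_base) auto
  from cfun.span_add[OF cfun.span_scale[OF this, of "c j"] insert.IH[THEN conjunct1]]
  have "(\<lambda>t. c j * gauss \<alpha> (\<tau> j) t + (\<Sum>j\<in>J. c j * gauss \<alpha> (\<tau> j) t)) \<in> cfun.span {gauss \<alpha> \<tau> | \<alpha> \<tau>. \<alpha> > 0}"
    by (simp add: plus_fun_def)
  moreover have "fourier_pair (\<lambda>t. c j * gauss \<alpha> (\<tau> j) t + (\<Sum>j\<in>J. c j * gauss \<alpha> (\<tau> j) t))
      (\<lambda>\<omega>. c j * fourier_integral (gauss \<alpha> (\<tau> j)) \<omega> + (\<Sum>j\<in>J. c j * fourier_integral (gauss \<alpha> (\<tau> j)) \<omega>))"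
    using insert.IH assms(2) by (intro fourier_pair_add fourier_pair_cmult fourier_pair_gauss) auto
  ultimately show ?case using insert.hyps by simp
qed

text \<open>Two errors occur on each side, regularisation and discretisation. One parameter e and
  then one mesh m are chosen for both sides, so the resulting sums have the same coefficients and
  form a Fourier pair.\<close>

lemma gauss_span_dense:
  assumes xy: "fourier_pair x y" and WT: "moderate WT" and WO: "moderate WO"
    and fin: "sqn WT x < \<infinity>" "sqn WO y < \<infinity>" and \<eta>: "0 < (\<eta>::real)"
  obtains z z' where "z \<in> cfun.span {gauss \<alpha> \<tau> | \<alpha> \<tau>. \<alpha> > 0}" "fourier_pair z z'"
    "sqn WT (\<lambda>t. x t - z t) \<le> ennreal \<eta>" "sqn WO (\<lambda>\<omega>. y \<omega> - z' \<omega>) \<le> ennreal \<eta>"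
proof -
  note [measurable] = moderateD[OF WT] moderateD[OF WO]
  have [measurable]: "x \<in> borel_measurable borel" "y \<in> borel_measurable borel" and x1: "sqn (\<lambda>_. 1) x < \<infinity>"
    using xy by (auto simp: fourier_pair_def)
  let ?e = "\<lambda>n. inverse (real (Suc n))"
  have e: "?e \<longlonglongrightarrow> 0" "\<And>n. 0 < ?e n" "\<And>n. ?e n \<le> 1"
    using LIMSEQ_inverse_real_of_nat by (auto intro: inverse_le_1_iff[THEN iffD2])
  have "\<forall>\<^sub>F n in sequentially. sqn WT (\<lambda>t. hat_mult (?e n) t * gconv (?e n) x t - x t) \<le> ennreal (\<eta> / 4)
      \<and> sqn WO (\<lambda>t. gconv (?e n) (\<lambda>s. hat_mult (?e n) s * y s) t - y t) \<le> ennreal (\<eta> / 4)"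
    using hat_mult_gconv_tendsto[OF _ WT fin(1) e] gconv_hat_mult_tendsto[OF _ WO fin(2) e] \<eta>
    unfolding ennreal_tendsto_0_iff by (intro eventually_conj) auto
  then obtain n where n: "sqn WT (\<lambda>t. hat_mult (?e n) t * gconv (?e n) x t - x t) \<le> ennreal (\<eta> / 4)"
      "sqn WO (\<lambda>t. gconv (?e n) (\<lambda>s. hat_mult (?e n) s * y s) t - y t) \<le> ennreal (\<eta> / 4)"
    using eventually_happens' sequentially_bot by blast
  define e where "e = ?e n"
  have e0: "e > 0" by (simp add: e_def)
  define \<alpha> where "\<alpha> = e\<^sup>2 + 1 / e\<^sup>2"
  define \<rho> where "\<rho> = 1 / (e\<^sup>2 * \<alpha>)"
  have \<alpha>: "\<alpha> > 0" unfolding \<alpha>_def using e0 by (intro add_pos_pos) auto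
  have "e\<^sup>2 * \<alpha> \<ge> 1" using e0 by (simp add: \<alpha>_def distrib_left)
  \<comment> \<open>Since e^2 \<alpha> = 1 + e^4, the centres \<rho> s lie no farther out than s, as
    \<open>norm_gauss_exp_bound\<close> demands.\<close>
  then have \<rho>: "0 \<le> \<rho>" "\<rho> \<le> 1" by (auto simp: \<rho>_def)
  define k where "k s = gauss_factor e s * x s" for s
  have [measurable]: "k \<in> borel_measurable borel" unfolding k_def by measurable
  have kexp: "integrable lborel (\<lambda>s. k s * of_real (A * exp (c * \<bar>s\<bar>)))" for A c
  proof -
    have "integrable lborel (\<lambda>s. (gauss_factor e s * of_real (A * exp (c * \<bar>s\<bar>))) * x s)"
      by (intro integrable_L2_mult sqn_gauss_factor_exp e0 x1) auto
    then show ?thesis by (simp add: k_def mult_ac)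
  qed
  from kexp[of 1 0] have k: "integrable lborel k" by simp
  define \<Phi> where "\<Phi> s t = gauss \<alpha> (\<rho> * s) t" for s t
  define \<Psi> where "\<Psi> s \<omega> = fourier_integral (gauss \<alpha> (\<rho> * s)) \<omega>" for s \<omega>
  have \<Psi>_eq: "\<Psi> s \<omega> = of_real (exp (- pi * \<omega>\<^sup>2 / \<alpha>)) * fchar \<omega> (\<rho> * s)" for s \<omega>
    unfolding \<Psi>_def by (rule fourier_gauss[OF \<alpha>])
  have time: "(\<lambda>m. sqn WT (\<lambda>t. cell_sum k m \<Phi> t - (LINT s|lborel. k s * \<Phi> s t))) \<longlonglongrightarrow> 0"
  proof -
    from WT obtain C c where C: "0 \<le> C" "0 \<le> c" "\<And>s t. WT (t + s) \<le> C * exp (c * \<bar>s\<bar>) * WT t"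
      unfolding moderate_def by blast
    \<comment> \<open>The rate must satisfy 2 \<mu> > c, so that the squared majorant in t beats the
      growth of the weight. The price is growth of rate \<mu> in s, which \<open>kexp\<close> covers
      for every rate.\<close>
    define \<mu> where "\<mu> = c + 1"
    have \<mu>: "\<mu> > 0" "2 * \<mu> - c > 0" using C by (auto simp: \<mu>_def)
    define A where "A = sqrt \<alpha> * exp (\<mu>\<^sup>2 / (4 * pi * \<alpha>) + \<mu>)"
    show ?thesis
    proof (rule cell_sum_tendsto[OF k WT, where b="\<lambda>s. A * exp (\<mu> * \<bar>s\<bar>)" and d="\<lambda>t. exp (- \<mu> * \<bar>t\<bar>)" and B="sqrt \<alpha>"])
      show "case_prod \<Phi> \<in> borel_measurable (borel \<Otimes>\<^sub>M borel)" unfolding \<Phi>_def gauss_def by measurable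
      show "continuous_on UNIV (\<lambda>s. \<Phi> s t)" for t unfolding \<Phi>_def gauss_def by (intro continuous_intros)
      show "cmod (\<Phi> s t) \<le> sqrt \<alpha>" for s t
        unfolding \<Phi>_def norm_gauss[OF \<alpha>] using \<alpha> by (simp add: mult_left_le)
      show "cmod (\<Phi> s' t) \<le> A * exp (\<mu> * \<bar>s\<bar>) * exp (- \<mu> * \<bar>t\<bar>)" if "\<bar>s' - s\<bar> \<le> 1" for s s' t
        unfolding \<Phi>_def A_def using \<mu> by (intro norm_gauss_exp_bound \<alpha> \<rho> that) simp
      have "(\<integral>\<^sup>+s. ennreal (cmod (k s) * (A * exp (\<mu> * \<bar>s\<bar>))\<^sup>2) \<partial>lborel) = (\<integral>\<^sup>+s. ennreal (norm (k s * of_real (A\<^sup>2 * exp ((2 * \<mu>) * \<bar>s\<bar>)))) \<partial>lborel)"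
        unfolding norm_mult norm_of_real by (simp add: power_mult_distrib mult.assoc flip: exp_double)
      also have "\<dots> < \<infinity>" using kexp[of "A\<^sup>2" "2 * \<mu>"] unfolding integrable_iff_bounded by blast
      finally show "(\<integral>\<^sup>+s. ennreal (cmod (k s) * (A * exp (\<mu> * \<bar>s\<bar>))\<^sup>2) \<partial>lborel) < \<infinity>" .
      have "(\<integral>\<^sup>+t. ennreal ((exp (- \<mu> * \<bar>t\<bar>))\<^sup>2 * WT t) \<partial>lborel) \<le> (\<integral>\<^sup>+t. ennreal (C * WT 0) * ennreal (exp (- (2 * \<mu> - c) * \<bar>t\<bar>)) \<partial>lborel)"
      proof (rule nn_integral_mono)
        fix t
        have "(exp (- \<mu> * \<bar>t\<bar>))\<^sup>2 * WT t \<le> (exp (- \<mu> * \<bar>t\<bar>))\<^sup>2 * (C * exp (c * \<bar>t\<bar>) * WT 0)"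
          using C(3)[of 0 t] by (intro mult_left_mono) auto
        also have "\<dots> = C * WT 0 * (exp (2 * (- \<mu> * \<bar>t\<bar>)) * exp (c * \<bar>t\<bar>))"
          unfolding exp_double by (simp only: mult_ac)
        also have "exp (2 * (- \<mu> * \<bar>t\<bar>)) * exp (c * \<bar>t\<bar>) = exp (- (2 * \<mu> - c) * \<bar>t\<bar>)"
          by (simp add: algebra_simps flip: exp_add)
        finally show "ennreal ((exp (- \<mu> * \<bar>t\<bar>))\<^sup>2 * WT t) \<le> ennreal (C * WT 0) * ennreal (exp (- (2 * \<mu> - c) * \<bar>t\<bar>))"
          using C moderate_nonneg[OF WT] by (subst ennreal_mult[symmetric]) (auto intro: ennreal_leI)
      qed
      also have "\<dots> < \<infinity>"
        using nn_integral_exp_abs[OF \<mu>(2)] by (subst nn_integral_cmult) (auto simp: ennreal_mult_less_top)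
      finally show "(\<integral>\<^sup>+t. ennreal ((exp (- \<mu> * \<bar>t\<bar>))\<^sup>2 * WT t) \<partial>lborel) < \<infinity>" .
    qed measurable
  qed
  have freq: "(\<lambda>m. sqn WO (\<lambda>\<omega>. cell_sum k m \<Psi> \<omega> - (LINT s|lborel. k s * \<Psi> s \<omega>))) \<longlonglongrightarrow> 0"
  \<comment> \<open>Each \<Psi> has the modulus of one centred Gaussian, whatever s is; hence the
    constant \<open>b\<close> suffices on this side.\<close>
  proof (rule cell_sum_tendsto[OF k WO, where b="\<lambda>_. 1" and d="\<lambda>\<omega>. exp (- (pi / \<alpha>) * \<omega>\<^sup>2)" and B=1])
    show "case_prod \<Psi> \<in> borel_measurable (borel \<Otimes>\<^sub>M borel)" unfolding \<Psi>_eq by measurable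
    show "continuous_on UNIV (\<lambda>s. \<Psi> s t)" for t unfolding \<Psi>_eq fchar_def by (intro continuous_intros)
    show "cmod (\<Psi> s' t) \<le> 1 * exp (- (pi / \<alpha>) * t\<^sup>2)" for s' t
      unfolding \<Psi>_def norm_fourier_gauss[OF \<alpha>] by simp
    show "cmod (\<Psi> s t) \<le> 1" for s t
      unfolding \<Psi>_def norm_fourier_gauss[OF \<alpha>] using \<alpha> by simp
    show "(\<integral>\<^sup>+s. ennreal (cmod (k s) * 1\<^sup>2) \<partial>lborel) < \<infinity>" using k by (simp add: integrable_iff_bounded)
    show "(\<integral>\<^sup>+t. ennreal ((exp (- (pi / \<alpha>) * t\<^sup>2))\<^sup>2 * WO t) \<partial>lborel) < \<infinity>"
      using \<alpha> by (intro nn_integral_exp_quad_moderate WO) simp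
  qed measurable
  have "\<forall>\<^sub>F m in sequentially. sqn WT (\<lambda>t. cell_sum k m \<Phi> t - (LINT s|lborel. k s * \<Phi> s t)) \<le> ennreal (\<eta> / 4)
      \<and> sqn WO (\<lambda>\<omega>. cell_sum k m \<Psi> \<omega> - (LINT s|lborel. k s * \<Psi> s \<omega>)) \<le> ennreal (\<eta> / 4)"
    using time freq \<eta> unfolding ennreal_tendsto_0_iff by (intro eventually_conj) auto
  then obtain m where m: "sqn WT (\<lambda>t. cell_sum k m \<Phi> t - (LINT s|lborel. k s * \<Phi> s t)) \<le> ennreal (\<eta> / 4)"
      "sqn WO (\<lambda>\<omega>. cell_sum k m \<Psi> \<omega> - (LINT s|lborel. k s * \<Psi> s \<omega>)) \<le> ennreal (\<eta> / 4)"
    using eventually_happens' sequentially_bot by blast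
  have T: "hat_mult e t * gconv e x t = (LINT s|lborel. k s * \<Phi> s t)" for t
    unfolding k_def \<Phi>_def by (rule hat_mult_gconv_eq[OF e0 \<alpha>_def \<rho>_def])
  have O: "gconv e (\<lambda>s. hat_mult e s * y s) \<omega> = (LINT s|lborel. k s * \<Psi> s \<omega>)" for \<omega>
    unfolding k_def \<Psi>_def by (rule gconv_hat_mult_eq[OF e0 \<alpha>_def \<rho>_def xy])
  have S: "cell_sum k m \<Phi> \<in> cfun.span {gauss \<alpha> \<tau> | \<alpha> \<tau>. \<alpha> > 0} \<and> fourier_pair (cell_sum k m \<Phi>) (cell_sum k m \<Psi>)"
    unfolding cell_sum_def[abs_def] \<Phi>_def \<Psi>_def by (rule gauss_span_sum[OF _ \<alpha>]) simp
  have [measurable]: "cell_sum k m \<Phi> \<in> borel_measurable borel" "cell_sum k m \<Psi> \<in> borel_measurable borel"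
    using S by (auto simp: fourier_pair_def)
  have [measurable]: "(\<lambda>t. LINT s|lborel. k s * \<Phi> s t) \<in> borel_measurable borel"
    "(\<lambda>\<omega>. LINT s|lborel. k s * \<Psi> s \<omega>) \<in> borel_measurable borel"
    unfolding T[symmetric] O[symmetric] by measurable
  have four: "2 * ennreal (\<eta> / 4) + 2 * ennreal (\<eta> / 4) = ennreal \<eta>"
    using \<eta> by (simp flip: ennreal_numeral ennreal_mult ennreal_plus)
  show thesis
  proof
    have "sqn WT (\<lambda>t. x t - cell_sum k m \<Phi> t) \<le>
        2 * sqn WT (\<lambda>t. x t - (LINT s|lborel. k s * \<Phi> s t)) + 2 * sqn WT (\<lambda>t. (LINT s|lborel. k s * \<Phi> s t) - cell_sum k m \<Phi> t)"
      by (rule sqn_diff_triangle) (auto simp: moderate_nonneg[OF WT])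
    also have "\<dots> \<le> 2 * ennreal (\<eta> / 4) + 2 * ennreal (\<eta> / 4)"
      using n(1) m(1) unfolding e_def[symmetric] T
      by (intro add_mono mult_left_mono) (auto simp: sqn_minus_commute[of WT x] sqn_minus_commute[of WT _ "cell_sum k m \<Phi>"])
    finally show "sqn WT (\<lambda>t. x t - cell_sum k m \<Phi> t) \<le> ennreal \<eta>" unfolding four .
    have "sqn WO (\<lambda>t. y t - cell_sum k m \<Psi> t) \<le>
        2 * sqn WO (\<lambda>t. y t - (LINT s|lborel. k s * \<Psi> s t)) + 2 * sqn WO (\<lambda>t. (LINT s|lborel. k s * \<Psi> s t) - cell_sum k m \<Psi> t)"
      by (rule sqn_diff_triangle) (auto simp: moderate_nonneg[OF WO])
    also have "\<dots> \<le> 2 * ennreal (\<eta> / 4) + 2 * ennreal (\<eta> / 4)"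
      using n(2) m(2) unfolding e_def[symmetric] O
      by (intro add_mono mult_left_mono) (auto simp: sqn_minus_commute[of WO y] sqn_minus_commute[of WO _ "cell_sum k m \<Psi>"])
    finally show "sqn WO (\<lambda>t. y t - cell_sum k m \<Psi> t) \<le> ennreal \<eta>" unfolding four .
  qed (use S in auto)
qed

section \<open>Completeness in the weighted space\<close>

text \<open>Replacing \<open>1 + w\<close> by its values at the integers gives a Borel weight that is comparable
  at every point, whereas a Borel modification of \<open>w\<close> would be comparable only almost everywhere.\<close>

lemma moderate_step_weight:
  assumes w: "weight_function w" and reg: "regular_weight (\<lambda>\<xi>. 1 + w \<xi>)"
  obtains V M where "moderate V" "0 \<le> M" "\<And>t. w t \<le> M * V t" "\<And>t. V t \<le> M * (1 + w t)"
proof -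
  define U where "U t = 1 + w t" for t
  have U1: "U t \<ge> 1" for t using w by (simp add: U_def weight_function_def)
  then have U0: "U t > 0" "U t \<ge> 0" for t using less_le_trans[OF zero_less_one U1[of t]] by auto
  have fin: "mult_modulus U 1 < \<infinity>" using reg by (simp add: regular_weight_def U_def[abs_def])
  define M where "M = enn2real (mult_modulus U 1)"
  have M: "U a \<le> M * U b" if "\<bar>a - b\<bar> \<le> 1" for a b
  proof -
    have "ennreal (U a / U b) \<le> mult_modulus U 1"
      unfolding mult_modulus_def using that by (intro Sup_upper) auto
    then have "U a / U b \<le> M"
      unfolding M_def using fin U0 by (metis enn2real_ennreal enn2real_mono divide_nonneg_nonneg infinity_ennreal_def)
    then show ?thesis using U0[of b] by (simp add: field_simps)
  qed
  have M1: "M \<ge> 1" using M[of 0 0] U0[of 0] by simp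
  \<comment> \<open>A shift of size at most n is made in n moves of size at most 1, each costing a
    factor \<open>M\<close>; \<open>r\<close> is s moved one unit towards 0, or 0 if s is already
    that close.\<close>
  have it: "U (t + s) \<le> M ^ n * U t" if "\<bar>s\<bar> \<le> real n" for n s t
    using that
  proof (induction n arbitrary: s)
    case (Suc n)
    define r where "r = (if \<bar>s\<bar> \<le> 1 then 0 else s - sgn s)"
    have r: "\<bar>r\<bar> \<le> real n" "\<bar>s - r\<bar> \<le> 1" using Suc.prems by (auto simp: r_def sgn_if)
    have "U (t + s) \<le> M * U (t + r)" using r by (intro M) simp
    also have "\<dots> \<le> M * (M ^ n * U t)" using M1 by (intro mult_left_mono Suc.IH r) simp
    finally show ?case by (simp add: mult.assoc)
  qed simp
  \<comment> \<open>Rounding the distance up adds less than one move, which accounts for the single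
    factor \<open>M\<close> in front of the exponential.\<close>
  have exp_bd: "U a \<le> M * exp (ln M * \<bar>a - b\<bar>) * U b" for a b
  proof -
    define n where "n = nat \<lceil>\<bar>a - b\<bar>\<rceil>"
    have n: "\<bar>a - b\<bar> \<le> real n" "real n \<le> 1 + \<bar>a - b\<bar>" unfolding n_def by linarith+
    have "U a \<le> M ^ n * U b" using it[of "a - b" n b] n by simp
    also have "M ^ n = exp (real n * ln M)" using M1 by (simp add: exp_of_nat_mult)
    also have "\<dots> * U b \<le> exp ((1 + \<bar>a - b\<bar>) * ln M) * U b"
      using M1 n U0 by (intro mult_right_mono iffD2[OF exp_le_cancel_iff]) auto
    also have "exp ((1 + \<bar>a - b\<bar>) * ln M) = M * exp (ln M * \<bar>a - b\<bar>)"
    proof -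
      have "exp ((1 + \<bar>a - b\<bar>) * ln M) = exp (ln M + ln M * \<bar>a - b\<bar>)" by (simp add: algebra_simps)
      also have "\<dots> = M * exp (ln M * \<bar>a - b\<bar>)" unfolding exp_add using M1 by simp
      finally show ?thesis .
    qed
    finally show ?thesis .
  qed
  define V where "V t = U (real_of_int \<lfloor>t\<rfloor>)" for t :: real
  have close: "\<bar>real_of_int \<lfloor>t\<rfloor> - t\<bar> \<le> 1" for t :: real by linarith
  show thesis
  proof
    have "(\<lambda>i::int. U (real_of_int i)) \<circ> (floor :: real \<Rightarrow> int) \<in> borel_measurable borel"
      by (rule measurable_comp[OF measurable_real_floor]) simp
    then have "V \<in> borel_measurable borel" by (simp add: V_def[abs_def] comp_def)
    \<comment> \<open>Rounding both points down can lengthen the shift by 1, whence the additional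
      factor \<open>exp (ln M)\<close>.\<close>
    moreover have "V (t + s) \<le> (M * exp (ln M)) * exp (ln M * \<bar>s\<bar>) * V t" for s t
    proof -
      have "\<bar>real_of_int \<lfloor>t + s\<rfloor> - real_of_int \<lfloor>t\<rfloor>\<bar> \<le> 1 + \<bar>s\<bar>" by linarith
      then have le: "ln M * \<bar>real_of_int \<lfloor>t + s\<rfloor> - real_of_int \<lfloor>t\<rfloor>\<bar> \<le> ln M * (1 + \<bar>s\<bar>)"
        using M1 by (intro mult_left_mono) auto
      have "V (t + s) \<le> M * exp (ln M * \<bar>real_of_int \<lfloor>t + s\<rfloor> - real_of_int \<lfloor>t\<rfloor>\<bar>) * V t"
        unfolding V_def by (rule exp_bd)
      also have "\<dots> \<le> M * exp (ln M * (1 + \<bar>s\<bar>)) * V t"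
        using M1 le U0 by (intro mult_right_mono mult_left_mono) (auto simp: V_def)
      also have "exp (ln M * (1 + \<bar>s\<bar>)) = exp (ln M) * exp (ln M * \<bar>s\<bar>)"
        by (simp only: distrib_left exp_add mult_1_right)
      finally show ?thesis by (simp only: mult.assoc)
    qed
    moreover have "1 \<le> V t" for t unfolding V_def by (rule U1)
    ultimately show "moderate V"
      unfolding moderate_def using M1 by (intro conjI allI exI[of _ "M * exp (ln M)"] exI[of _ "ln M"]) auto
    show "0 \<le> M" using M1 by simp
    show "w t \<le> M * V t" for t
    proof -
      have "U t \<le> M * V t" unfolding V_def using close[of t] by (intro M) linarith
      then show ?thesis by (simp add: U_def)
    qed
    show "V t \<le> M * (1 + w t)" for t
      using M[OF close, of t] by (simp add: V_def U_def)
  qed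
qed

section \<open>Borel versions and passage to Lebesgue measurable functions\<close>

lemma borel_version_complex:
  fixes f :: "real \<Rightarrow> complex"
  assumes "f \<in> borel_measurable lebesgue"
  obtains f' where "f' \<in> borel_measurable borel" "AE t in lborel. f t = f' t"
proof -
  from assms have "(\<lambda>t. Re (f t)) \<in> borel_measurable lebesgue" "(\<lambda>t. Im (f t)) \<in> borel_measurable lebesgue"
    by measurable
  then obtain a b where a: "a \<in> borel_measurable lborel" "AE t in lborel. Re (f t) = a t"
    and b: "b \<in> borel_measurable lborel" "AE t in lborel. Im (f t) = b t"
    by (blast dest: completion_ex_borel_measurable_real)
  show thesis
  proof
    show "(\<lambda>t. Complex (a t) (b t)) \<in> borel_measurable borel"
      using a b unfolding Complex_eq by measurable
    show "AE t in lborel. f t = Complex (a t) (b t)"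
      using a(2) b(2) by eventually_elim (simp add: complex_eq_iff)
  qed
qed

lemma borel_imp_lebesgue_measurable: "f \<in> borel_measurable borel \<Longrightarrow> f \<in> borel_measurable lebesgue"
  by (simp add: measurable_completion)

text \<open>The nonnegative integral is unchanged by completion of the measure even for integrands
  that are not Borel. Thus \<open>sqn\<close> also measures the Lebesgue functions and weights of
  the statement.\<close>

lemma sqn_lebesgue: "sqn W f = (\<integral>\<^sup>+t. ennreal ((cmod (f t))\<^sup>2 * W t) \<partial>lebesgue)"
  by (simp add: sqn_def nn_integral_completion)

lemma L2_iff:
  assumes "weight_function w"
  shows "f \<in> L2 w \<longleftrightarrow> f \<in> borel_measurable lebesgue \<and> sqn w f < \<infinity>"
  using assms unfolding L2_def sqn_lebesgue weight_function_def
  by (auto simp: integrable_iff_bounded)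

lemma L2_integral:
  assumes "weight_function w" "f \<in> borel_measurable lebesgue"
  shows "(LINT t|lebesgue. (cmod (f t))\<^sup>2 * w t) = enn2real (sqn w f)"
  using assms unfolding sqn_lebesgue weight_function_def
  by (intro integral_eq_nn_integral) auto

lemma weight_function_one: "weight_function (\<lambda>_. 1)"
  by (simp add: weight_function_def)

lemma L2_one_iff: "f \<in> L2 (\<lambda>_. 1) \<longleftrightarrow> f \<in> borel_measurable lebesgue \<and> sqn (\<lambda>_. 1) f < \<infinity>"
  by (rule L2_iff[OF weight_function_one])

lemma L2_norm_one: "f \<in> borel_measurable lebesgue \<Longrightarrow> L2_norm (\<lambda>_. 1) f = sqrt (enn2real (sqn (\<lambda>_. 1) f))"
  unfolding L2_norm_def using L2_integral[OF weight_function_one, of f] by simp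

text \<open>Finiteness matters: an infinite \<open>sqn\<close> is sent to 0 by
  \<open>enn2real\<close> and would count as norm 0.\<close>

lemma L2_norm_tendsto_0_iff:
  assumes "\<And>n. f n \<in> borel_measurable lebesgue" "\<And>n. sqn (\<lambda>_. 1) (f n) < \<infinity>"
  shows "(\<lambda>n. L2_norm (\<lambda>_. 1) (f n)) \<longlonglongrightarrow> 0 \<longleftrightarrow> (\<lambda>n. sqn (\<lambda>_. 1) (f n)) \<longlonglongrightarrow> 0"
proof -
  have eq: "ennreal (enn2real (sqn (\<lambda>_. 1) (f n))) = sqn (\<lambda>_. 1) (f n)" for n
    using assms(2)[of n] by (simp add: ennreal_enn2real)
  have "(\<lambda>n. L2_norm (\<lambda>_. 1) (f n)) \<longlonglongrightarrow> 0 \<longleftrightarrow> (\<lambda>n. enn2real (sqn (\<lambda>_. 1) (f n))) \<longlonglongrightarrow> 0"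
  proof
    assume "(\<lambda>n. L2_norm (\<lambda>_. 1) (f n)) \<longlonglongrightarrow> 0"
    then have "(\<lambda>n. (L2_norm (\<lambda>_. 1) (f n))\<^sup>2) \<longlonglongrightarrow> 0\<^sup>2" by (rule tendsto_power)
    then show "(\<lambda>n. enn2real (sqn (\<lambda>_. 1) (f n))) \<longlonglongrightarrow> 0" by (simp add: L2_norm_one assms)
  next
    assume "(\<lambda>n. enn2real (sqn (\<lambda>_. 1) (f n))) \<longlonglongrightarrow> 0"
    from tendsto_real_sqrt[OF this] show "(\<lambda>n. L2_norm (\<lambda>_. 1) (f n)) \<longlonglongrightarrow> 0" by (simp add: L2_norm_one assms)
  qed
  also have "\<dots> \<longleftrightarrow> (\<lambda>n. ennreal (enn2real (sqn (\<lambda>_. 1) (f n)))) \<longlonglongrightarrow> ennreal 0"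
    by (subst tendsto_ennreal_iff) auto
  finally show ?thesis by (simp add: eq)
qed

text \<open>The approximants are replaced by Borel versions; norms are unaffected, so both limits
  carry over.\<close>

lemma is_fourier_L2D:
  assumes F: "is_fourier_L2 x y"
    and [measurable]: "x' \<in> borel_measurable borel" "y' \<in> borel_measurable borel"
    and ae: "AE t in lborel. x t = x' t" "AE t in lborel. y t = y' t"
  shows "fourier_pair x' y'"
proof -
  from F obtain X where xy: "x \<in> L2 (\<lambda>_. 1)" "y \<in> L2 (\<lambda>_. 1)"
    and X: "\<And>n. integrable lebesgue (X n)" "\<And>n. X n \<in> L2 (\<lambda>_. 1)" "\<And>n. fourier_integral (X n) \<in> L2 (\<lambda>_. 1)"
      "(\<lambda>n. L2_norm (\<lambda>_. 1) (\<lambda>t. X n t - x t)) \<longlonglongrightarrow> 0"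
      "(\<lambda>n. L2_norm (\<lambda>_. 1) (\<lambda>\<omega>. fourier_integral (X n) \<omega> - y \<omega>)) \<longlonglongrightarrow> 0"
    unfolding is_fourier_L2_def by blast
  have "\<exists>Z. Z \<in> borel_measurable borel \<and> (AE t in lborel. X n t = Z t)" for n
    using borel_version_complex[of "X n"] X(2)[of n] by (auto simp: L2_one_iff)
  then obtain Z where Z [measurable]: "\<And>n. Z n \<in> borel_measurable borel" and XZ: "\<And>n. AE t in lborel. X n t = Z n t"
    by metis
  have leb: "X n \<in> borel_measurable lebesgue" "Z n \<in> borel_measurable lebesgue" "x \<in> borel_measurable lebesgue"
    "y \<in> borel_measurable lebesgue" for n
    using X(2) xy borel_imp_lebesgue_measurable[OF Z] by (auto simp: L2_one_iff)
  have iZ: "integrable lborel (Z n)" for n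
  proof -
    have "integrable lebesgue (Z n)"
      using X(1)[of n] by (rule integrable_cong_AE_imp) (use leb XZ[of n] in \<open>auto simp: AE_completion_iff eq_commute\<close>)
    then show ?thesis by (simp add: integrable_completion)
  qed
  \<comment> \<open>Functions equal almost everywhere have the same Fourier integral at every
    frequency, not just at almost every one.\<close>
  have FZ: "fourier_integral (X n) = fourier_integral (Z n)" for n
  proof
    fix \<omega>
    have k: "(\<lambda>t. exp (- 2 * of_real pi * \<i> * of_real \<omega> * complex_of_real t)) \<in> borel_measurable lebesgue"
      by (rule borel_imp_lebesgue_measurable) measurable
    have "AE t in lebesgue. X n t = Z n t" using XZ[of n] by (simp add: AE_completion_iff)
    then show "fourier_integral (X n) \<omega> = fourier_integral (Z n) \<omega>"
      unfolding fourier_integral_def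
      by (intro integral_cong_AE borel_measurable_times leb k) auto
  qed
  have sZ: "sqn (\<lambda>_. 1) (Z n) < \<infinity>" "sqn (\<lambda>_. 1) (fourier_integral (Z n)) < \<infinity>" for n
    using X(2,3)[of n] sqn_cong_AE[OF XZ[of n]] by (auto simp: L2_one_iff FZ)
  have sx: "sqn (\<lambda>_. 1) x' < \<infinity>" "sqn (\<lambda>_. 1) y' < \<infinity>"
    using xy sqn_cong_AE[OF ae(1)] sqn_cong_AE[OF ae(2)] by (auto simp: L2_one_iff)
  have diff: "sqn (\<lambda>_. 1) (\<lambda>t. f t - g t) < \<infinity>"
    if "f \<in> borel_measurable borel" "g \<in> borel_measurable borel" "sqn (\<lambda>_. 1) f < \<infinity>" "sqn (\<lambda>_. 1) g < \<infinity>" for f g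
    using sqn_one_add_finite[of f "\<lambda>t. - g t"] that by (simp add: sqn_uminus)
  have eq1: "sqn (\<lambda>_. 1) (\<lambda>t. X n t - x t) = sqn (\<lambda>_. 1) (\<lambda>t. Z n t - x' t)" for n
    by (rule sqn_cong_AE) (use XZ[of n] ae in auto)
  have eq2: "sqn (\<lambda>_. 1) (\<lambda>t. fourier_integral (X n) t - y t) = sqn (\<lambda>_. 1) (\<lambda>t. fourier_integral (Z n) t - y' t)" for n
    by (rule sqn_cong_AE) (use ae in \<open>auto simp: FZ\<close>)
  have "(\<lambda>n. sqn (\<lambda>_. 1) (\<lambda>t. X n t - x t)) \<longlonglongrightarrow> 0"
    using X(4) by (subst (asm) L2_norm_tendsto_0_iff) (use leb sx sZ diff in \<open>auto simp: eq1\<close>)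
  moreover have "(\<lambda>n. sqn (\<lambda>_. 1) (\<lambda>t. fourier_integral (X n) t - y t)) \<longlonglongrightarrow> 0"
    using X(5)
    by (subst (asm) L2_norm_tendsto_0_iff)
       (use leb sx sZ diff in \<open>auto simp: eq2 simp del: infinity_ennreal_def intro!: borel_measurable_diff\<close>, auto simp: FZ intro!: borel_imp_lebesgue_measurable)
  ultimately show ?thesis
    unfolding fourier_pair_def eq1 eq2 using iZ sx by auto
qed

text \<open>Here the sequence from \<open>fourier_pairE\<close> is needed, since
  \<open>is_fourier_L2\<close> demands that every approximant and its transform be square
  integrable.\<close>

lemma is_fourier_L2I:
  assumes F: "fourier_pair x' y'"
    and m: "x \<in> borel_measurable lebesgue" "y \<in> borel_measurable lebesgue"
    and ae: "AE t in lborel. x t = x' t" "AE t in lborel. y t = y' t"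
  shows "is_fourier_L2 x y"
proof -
  obtain X where X: "\<And>n. integrable lborel (X n)" "\<And>n. sqn (\<lambda>_. 1) (X n) < \<infinity>"
    "\<And>n. sqn (\<lambda>_. 1) (fourier_integral (X n)) < \<infinity>"
    "(\<lambda>n. sqn (\<lambda>_. 1) (\<lambda>t. X n t - x' t)) \<longlonglongrightarrow> 0"
    "(\<lambda>n. sqn (\<lambda>_. 1) (\<lambda>\<omega>. fourier_integral (X n) \<omega> - y' \<omega>)) \<longlonglongrightarrow> 0"
    using fourier_pairE[OF F] by blast
  have [measurable]: "X n \<in> borel_measurable borel" "x' \<in> borel_measurable borel" "y' \<in> borel_measurable borel" for n
    using X(1)[of n] F by (auto simp: fourier_pair_def)
  have fx: "sqn (\<lambda>_. 1) x' < \<infinity>" "sqn (\<lambda>_. 1) y' < \<infinity>" using F by (auto simp: fourier_pair_def)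
  have leb: "X n \<in> borel_measurable lebesgue" "fourier_integral (X n) \<in> borel_measurable lebesgue" for n
    by (rule borel_imp_lebesgue_measurable, measurable)+
  have diff: "sqn (\<lambda>_. 1) (\<lambda>t. f t - g t) < \<infinity>"
    if "f \<in> borel_measurable borel" "g \<in> borel_measurable borel" "sqn (\<lambda>_. 1) f < \<infinity>" "sqn (\<lambda>_. 1) g < \<infinity>" for f g
    using sqn_one_add_finite[of f "\<lambda>t. - g t"] that by (simp add: sqn_uminus)
  have eq1: "sqn (\<lambda>_. 1) (\<lambda>t. X n t - x t) = sqn (\<lambda>_. 1) (\<lambda>t. X n t - x' t)" for n
    by (rule sqn_cong_AE) (use ae in auto)
  have eq2: "sqn (\<lambda>_. 1) (\<lambda>t. fourier_integral (X n) t - y t) = sqn (\<lambda>_. 1) (\<lambda>t. fourier_integral (X n) t - y' t)" for n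
    by (rule sqn_cong_AE) (use ae in auto)
  have "(\<lambda>n. L2_norm (\<lambda>_. 1) (\<lambda>t. X n t - x t)) \<longlonglongrightarrow> 0"
    by (subst L2_norm_tendsto_0_iff) (use leb m X fx diff in \<open>auto simp: eq1 simp del: infinity_ennreal_def\<close>)
  moreover have "(\<lambda>n. L2_norm (\<lambda>_. 1) (\<lambda>t. fourier_integral (X n) t - y t)) \<longlonglongrightarrow> 0"
    by (subst L2_norm_tendsto_0_iff) (use leb m X fx diff in \<open>auto simp: eq2 simp del: infinity_ennreal_def\<close>)
  moreover have "integrable lebesgue (X n)" for n using X(1) by (simp add: integrable_completion)
  moreover have "x \<in> L2 (\<lambda>_. 1)" "y \<in> L2 (\<lambda>_. 1)"
    using m fx sqn_cong_AE[OF ae(1)] sqn_cong_AE[OF ae(2)] by (auto simp: L2_one_iff)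
  moreover have "X n \<in> L2 (\<lambda>_. 1)" "fourier_integral (X n) \<in> L2 (\<lambda>_. 1)" for n
    using leb X by (auto simp: L2_one_iff)
  ultimately show ?thesis unfolding is_fourier_L2_def by blast
qed

text \<open>Existence of a transform for a Borel version of x validates the choice in
  \<open>fourier_L2\<close>.\<close>

lemma is_fourier_L2_fourier_L2:
  assumes "x \<in> L2 (\<lambda>_. 1)"
  shows "is_fourier_L2 x (fourier_L2 x)"
proof -
  have x: "x \<in> borel_measurable lebesgue" "sqn (\<lambda>_. 1) x < \<infinity>" using assms by (auto simp: L2_one_iff)
  obtain x' where x': "x' \<in> borel_measurable borel" "AE t in lborel. x t = x' t"
    using borel_version_complex[OF x(1)] by blast
  obtain y where y: "fourier_pair x' y"
    using fourier_pair_exists[OF x'(1)] x(2) sqn_cong_AE[OF x'(2)] by auto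
  then have "y \<in> borel_measurable lebesgue"
    by (auto simp: fourier_pair_def intro: borel_imp_lebesgue_measurable)
  then have "is_fourier_L2 x y"
    using y x x' by (intro is_fourier_L2I[OF y]) auto
  then show ?thesis unfolding fourier_L2_def by (rule someI[of "is_fourier_L2 x"])
qed

text \<open>Uniqueness of pairs pins the choice down up to a null set. Any transform found by
  computation may therefore replace \<open>fourier_L2\<close> inside \<open>sqn\<close>.\<close>

lemma fourier_L2_AE_eq:
  assumes F: "fourier_pair x' y'" and x: "x \<in> borel_measurable lebesgue" "AE t in lborel. x t = x' t"
  shows "x \<in> L2 (\<lambda>_. 1)" "fourier_L2 x \<in> borel_measurable lebesgue" "AE \<omega> in lborel. fourier_L2 x \<omega> = y' \<omega>"
proof -
  have x': "x' \<in> borel_measurable borel" "sqn (\<lambda>_. 1) x' < \<infinity>" using F by (auto simp: fourier_pair_def)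
  show x2: "x \<in> L2 (\<lambda>_. 1)" using x x'(2) sqn_cong_AE[OF x(2)] by (simp add: L2_one_iff)
  note G = is_fourier_L2_fourier_L2[OF x2]
  then show m: "fourier_L2 x \<in> borel_measurable lebesgue" by (simp add: is_fourier_L2_def L2_one_iff)
  obtain y where y: "y \<in> borel_measurable borel" "AE t in lborel. fourier_L2 x t = y t"
    using borel_version_complex[OF m] by blast
  have "fourier_pair x' y" by (rule is_fourier_L2D[OF G x'(1) y(1) x(2) y(2)])
  from fourier_pair_unique[OF this F] y(2) show "AE \<omega> in lborel. fourier_L2 x \<omega> = y' \<omega>" by auto
qed

section \<open>Comparison of weights, the norm of the space, and the conclusion\<close>

lemma sqn_le_of_weight_le:
  assumes [measurable]: "f \<in> borel_measurable lebesgue" and V: "V \<in> borel_measurable lebesgue" and M: "0 \<le> M" and le: "\<And>t. w t \<le> M * V t"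
  shows "sqn w f \<le> ennreal M * sqn V f"
proof -
  note [measurable] = V
  have "sqn w f \<le> (\<integral>\<^sup>+t. ennreal M * ennreal ((cmod (f t))\<^sup>2 * V t) \<partial>lebesgue)"
    unfolding sqn_lebesgue
  proof (rule nn_integral_mono)
    fix t
    have "(cmod (f t))\<^sup>2 * w t \<le> M * ((cmod (f t))\<^sup>2 * V t)"
      using mult_left_mono[OF le, of "(cmod (f t))\<^sup>2" t] by (simp add: mult_ac)
    then show "ennreal ((cmod (f t))\<^sup>2 * w t) \<le> ennreal M * ennreal ((cmod (f t))\<^sup>2 * V t)"
      using M by (subst ennreal_mult'[symmetric]) (auto intro: ennreal_leI)
  qed
  also have "\<dots> = ennreal M * sqn V f"
    unfolding sqn_lebesgue by (rule nn_integral_cmult) measurable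
  finally show ?thesis .
qed

text \<open>The two sides agree even without finiteness, because a Bochner integral that diverges
  and \<open>enn2real\<close> of infinity are both 0.\<close>

lemma H_norm_eq:
  assumes w: "weight_function wT" "weight_function wO" and x: "x \<in> borel_measurable lebesgue" "fourier_L2 x \<in> borel_measurable lebesgue"
  shows "H_norm wT wO x = sqrt (enn2real (sqn wT x) + enn2real (sqn wO (fourier_L2 x)))"
proof -
  have "f t * cnj (f t) * of_real (v t) = of_real ((cmod (f t))\<^sup>2 * v t)" for f :: "real \<Rightarrow> complex" and v :: "real \<Rightarrow> real" and t
    by (simp flip: complex_norm_square)
  then show ?thesis
    unfolding H_norm_def H_inner_def by (simp add: L2_integral assms del: of_real_mult of_real_power)
qed

theorem theorem2p1:
  fixes w\<^sub>T w\<^sub>\<Omega> :: "real \<Rightarrow> real"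
  assumes "weight_function w\<^sub>T" and "weight_function w\<^sub>\<Omega>"
    and "nondegenerate w\<^sub>T" and "nondegenerate w\<^sub>\<Omega>"
    and "regular_weight (\<lambda>\<xi>. 1 + w\<^sub>T \<xi>)" and "regular_weight (\<lambda>\<xi>. 1 + w\<^sub>\<Omega> \<xi>)"
  shows "(\<forall>\<alpha>>0. \<forall>\<tau>. gauss \<alpha> \<tau> \<in> H_space w\<^sub>T w\<^sub>\<Omega>) \<and>
         complete_in_H w\<^sub>T w\<^sub>\<Omega> {gauss \<alpha> \<tau> | \<alpha> \<tau>. \<alpha> > 0}"
proof -
  let ?G = "{gauss \<alpha> \<tau> | \<alpha> \<tau>. \<alpha> > 0}"
  note w = assms(1,2)
  obtain V\<^sub>T M\<^sub>T where T: "moderate V\<^sub>T" "0 \<le> M\<^sub>T" "\<And>t. w\<^sub>T t \<le> M\<^sub>T * V\<^sub>T t" "\<And>t. V\<^sub>T t \<le> M\<^sub>T * (1 + w\<^sub>T t)"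
    using moderate_step_weight[OF assms(1,5)] by metis
  obtain V\<^sub>\<Omega> M\<^sub>\<Omega> where O: "moderate V\<^sub>\<Omega>" "0 \<le> M\<^sub>\<Omega>" "\<And>t. w\<^sub>\<Omega> t \<le> M\<^sub>\<Omega> * V\<^sub>\<Omega> t" "\<And>t. V\<^sub>\<Omega> t \<le> M\<^sub>\<Omega> * (1 + w\<^sub>\<Omega> t)"
    using moderate_step_weight[OF assms(2,6)] by metis
  note [measurable] = moderateD[OF T(1)] moderateD[OF O(1)]
  have Vleb: "V\<^sub>T \<in> borel_measurable lebesgue" "V\<^sub>\<Omega> \<in> borel_measurable lebesgue"
    by (rule borel_imp_lebesgue_measurable, measurable)+
  \<comment> \<open>\<open>P\<close> implies membership in the space and is visibly linear, as pairs
    can be added and scaled; a direct proof would meet the linearity of \<open>fourier_L2\<close>,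
    which holds only up to null sets.\<close>
  define P where "P z \<longleftrightarrow> (\<exists>z'. fourier_pair z z' \<and> sqn V\<^sub>T z < \<infinity> \<and> sqn V\<^sub>\<Omega> z' < \<infinity>)" for z
  have P_gauss: "P (gauss \<alpha> \<tau>)" if "\<alpha> > 0" for \<alpha> \<tau>
    unfolding P_def using that fourier_pair_gauss sqn_gauss_finite[OF that T(1)] sqn_fourier_gauss_finite[OF that O(1)] by blast
  have P_H: "z \<in> H_space w\<^sub>T w\<^sub>\<Omega>" if "P z" for z
  proof -
    from that obtain z' where z: "fourier_pair z z'" "sqn V\<^sub>T z < \<infinity>" "sqn V\<^sub>\<Omega> z' < \<infinity>" unfolding P_def by blast
    have zm: "z \<in> borel_measurable lebesgue" "z' \<in> borel_measurable lebesgue"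
      using z(1) by (auto simp: fourier_pair_def intro: borel_imp_lebesgue_measurable)
    note F = fourier_L2_AE_eq[OF z(1) zm(1) AE_I2[OF refl]]
    have "sqn w\<^sub>T z < \<infinity>"
      using sqn_le_of_weight_le[OF zm(1) Vleb(1) T(2,3)] z(2) by (auto simp: ennreal_mult_less_top elim!: le_less_trans)
    moreover have "sqn w\<^sub>\<Omega> (fourier_L2 z) < \<infinity>"
      using sqn_le_of_weight_le[OF zm(2) Vleb(2) O(2,3)] z(3) sqn_cong_AE[OF F(3)]
      by (auto simp: ennreal_mult_less_top elim!: le_less_trans)
    ultimately show ?thesis unfolding H_space_def using F zm w by (auto simp: L2_iff)
  qed
  have P_sub: "cfun.subspace (Collect P)"
  proof (rule cfun.subspaceI)
    have "P (\<lambda>t. 0 * gauss 1 0 t)"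
      unfolding P_def
      by (rule exI[of _ "\<lambda>t. 0 * fourier_integral (gauss 1 0) t"], intro conjI fourier_pair_cmult fourier_pair_gauss)
         (auto simp: sqn_def)
    then show "0 \<in> Collect P" by (simp add: zero_fun_def)
  next
    fix f g assume "f \<in> Collect P" "g \<in> Collect P"
    then obtain f' g' where f: "fourier_pair f f'" "sqn V\<^sub>T f < \<infinity>" "sqn V\<^sub>\<Omega> f' < \<infinity>"
      and g: "fourier_pair g g'" "sqn V\<^sub>T g < \<infinity>" "sqn V\<^sub>\<Omega> g' < \<infinity>" unfolding P_def by blast
    have [measurable]: "f \<in> borel_measurable borel" "g \<in> borel_measurable borel" "f' \<in> borel_measurable borel" "g' \<in> borel_measurable borel"
      using f g by (auto simp: fourier_pair_def)
    have "sqn V\<^sub>T (\<lambda>t. f t + g t) \<le> 2 * sqn V\<^sub>T f + 2 * sqn V\<^sub>T g"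
      by (rule sqn_add) (auto simp: moderate_nonneg[OF T(1)])
    moreover have "sqn V\<^sub>\<Omega> (\<lambda>t. f' t + g' t) \<le> 2 * sqn V\<^sub>\<Omega> f' + 2 * sqn V\<^sub>\<Omega> g'"
      by (rule sqn_add) (auto simp: moderate_nonneg[OF O(1)])
    ultimately have "P (\<lambda>t. f t + g t)"
      unfolding P_def using f g fourier_pair_add[OF f(1) g(1)]
      by (intro exI[of _ "\<lambda>t. f' t + g' t"]) (auto simp: ennreal_mult_less_top elim!: le_less_trans)
    then show "f + g \<in> Collect P" by (simp add: plus_fun_def)
  next
    fix c f assume "f \<in> Collect P"
    then obtain f' where f: "fourier_pair f f'" "sqn V\<^sub>T f < \<infinity>" "sqn V\<^sub>\<Omega> f' < \<infinity>" unfolding P_def by blast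
    have [measurable]: "f \<in> borel_measurable borel" "f' \<in> borel_measurable borel"
      using f by (auto simp: fourier_pair_def)
    show "(\<lambda>t. c * f t) \<in> Collect P"
      unfolding P_def using f fourier_pair_cmult[OF f(1), of c]
      by (intro CollectI exI[of _ "\<lambda>t. c * f' t"]) (auto simp: sqn_cmult ennreal_mult_less_top)
  qed
  have span_P: "cfun.span ?G \<subseteq> Collect P"
    by (rule cfun.span_minimal[OF _ P_sub]) (auto intro: P_gauss)
  have dense: "\<exists>z\<in>cfun.span ?G. H_norm w\<^sub>T w\<^sub>\<Omega> (\<lambda>t. x t - z t) < \<epsilon>" if x: "x \<in> H_space w\<^sub>T w\<^sub>\<Omega>" and \<epsilon>: "\<epsilon> > 0" for x \<epsilon>
  proof -
    define y where "y = fourier_L2 x"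
    have x2: "x \<in> L2 (\<lambda>_. 1)" and xm: "x \<in> borel_measurable lebesgue" and x1: "sqn (\<lambda>_. 1) x < \<infinity>" "sqn w\<^sub>T x < \<infinity>" and yw: "sqn w\<^sub>\<Omega> y < \<infinity>"
      using x w by (auto simp: H_space_def L2_one_iff L2_iff y_def)
    have F: "is_fourier_L2 x y" unfolding y_def by (rule is_fourier_L2_fourier_L2[OF x2])
    have ym: "y \<in> borel_measurable lebesgue" and y1: "sqn (\<lambda>_. 1) y < \<infinity>"
      using F by (auto simp: is_fourier_L2_def L2_one_iff)
    obtain x' where x': "x' \<in> borel_measurable borel" "AE t in lborel. x t = x' t"
      using borel_version_complex[OF xm] by blast
    obtain y' where y': "y' \<in> borel_measurable borel" "AE t in lborel. y t = y' t"
      using borel_version_complex[OF ym] by blast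
    have pair: "fourier_pair x' y'" by (rule is_fourier_L2D[OF F x'(1) y'(1) x'(2) y'(2)])
    \<comment> \<open>Here the unweighted square integrability required by \<open>H_space\<close>
      enters: \<open>V\<close> is bounded by a multiple of 1 + u, so both norms have to be
      finite.\<close>
    have fin: "sqn V f < \<infinity>" if f: "f \<in> borel_measurable lebesgue" "sqn (\<lambda>_. 1) f < \<infinity>" "sqn u f < \<infinity>"
      and u: "weight_function u" and V: "0 \<le> M" "\<And>t. V t \<le> M * (1 + u t)" for u V f M
    proof -
      have [measurable]: "u \<in> borel_measurable lebesgue" "f \<in> borel_measurable lebesgue" and u0: "\<And>t. 0 \<le> u t"
        using u f by (auto simp: weight_function_def)
      have "sqn (\<lambda>t. 1 + u t) f = (\<integral>\<^sup>+t. ennreal ((cmod (f t))\<^sup>2 * 1) + ennreal ((cmod (f t))\<^sup>2 * u t) \<partial>lebesgue)"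
        unfolding sqn_lebesgue by (intro nn_integral_cong) (simp add: distrib_left u0)
      also have "\<dots> = sqn (\<lambda>_. 1) f + sqn u f"
        unfolding sqn_lebesgue by (rule nn_integral_add) measurable
      also have "\<dots> < \<infinity>" using f by simp
      finally have "sqn (\<lambda>t. 1 + u t) f < \<infinity>" .
      moreover have "sqn V f \<le> ennreal M * sqn (\<lambda>t. 1 + u t) f"
        by (rule sqn_le_of_weight_le[OF _ _ V]) measurable
      ultimately show ?thesis by (auto simp: ennreal_mult_less_top elim!: le_less_trans)
    qed
    have fx: "sqn V\<^sub>T x' < \<infinity>"
      using fin[OF xm x1 w(1) T(2,4)] sqn_cong_AE[OF x'(2)] by simp
    have fy: "sqn V\<^sub>\<Omega> y' < \<infinity>"
      using fin[OF ym y1 yw w(2) O(2,4)] sqn_cong_AE[OF y'(2)] by simp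
    \<comment> \<open>The errors add up to at most
      \<open>(M\<^sub>T + M\<^sub>\<Omega>) * \<eta>\<close>, below half of the square of
      \<epsilon>. The summand 1 keeps the denominator positive if both constants vanish.\<close>
    define \<eta> where "\<eta> = \<epsilon>\<^sup>2 / (2 * (M\<^sub>T + M\<^sub>\<Omega> + 1))"
    have Mpos: "M\<^sub>T + M\<^sub>\<Omega> + 1 > 0" using T(2) O(2) by simp
    have \<eta>: "\<eta> > 0" using \<epsilon> Mpos by (simp add: \<eta>_def)
    obtain z z' where z: "z \<in> cfun.span ?G" "fourier_pair z z'"
      "sqn V\<^sub>T (\<lambda>t. x' t - z t) \<le> ennreal \<eta>" "sqn V\<^sub>\<Omega> (\<lambda>\<omega>. y' \<omega> - z' \<omega>) \<le> ennreal \<eta>"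
      using gauss_span_dense[OF pair T(1) O(1) fx fy \<eta>] by blast
    have pd: "fourier_pair (\<lambda>t. x' t - z t) (\<lambda>\<omega>. y' \<omega> - z' \<omega>)"
      by (rule fourier_pair_diff[OF pair z(2)])
    then have pm: "(\<lambda>t. x' t - z t) \<in> borel_measurable lebesgue" "(\<lambda>\<omega>. y' \<omega> - z' \<omega>) \<in> borel_measurable lebesgue"
      by (auto simp: fourier_pair_def intro!: borel_imp_lebesgue_measurable simp del: borel_measurable_diff)
    have dm: "(\<lambda>t. x t - z t) \<in> borel_measurable lebesgue"
      using z(2) by (intro borel_measurable_diff xm borel_imp_lebesgue_measurable) (simp add: fourier_pair_def)
    have ae: "AE t in lborel. x t - z t = x' t - z t" using x'(2) by auto
    \<comment> \<open>Linearity of the transform is used through pairs: the chosen transform of x -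
      z agrees almost everywhere with y' - z'.\<close>
    note D = fourier_L2_AE_eq[OF pd dm ae]
    have bound: "enn2real s \<le> M * \<eta>" if "s \<le> ennreal M * r" "r \<le> ennreal \<eta>" "0 \<le> M" for s r M
    proof -
      have "s \<le> ennreal M * ennreal \<eta>" using that by (meson mult_left_mono order_trans zero_le)
      then have "s \<le> ennreal (M * \<eta>)" using \<eta> that by (simp add: ennreal_mult)
      then show ?thesis using \<eta> that by (intro enn2real_leI) auto
    qed
    have "sqn w\<^sub>T (\<lambda>t. x t - z t) = sqn w\<^sub>T (\<lambda>t. x' t - z t)" by (rule sqn_cong_AE[OF ae])
    then have 1: "enn2real (sqn w\<^sub>T (\<lambda>t. x t - z t)) \<le> M\<^sub>T * \<eta>"
      using bound[OF sqn_le_of_weight_le[OF pm(1) Vleb(1) T(2,3)] z(3) T(2)] by simp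
    have "sqn w\<^sub>\<Omega> (fourier_L2 (\<lambda>t. x t - z t)) = sqn w\<^sub>\<Omega> (\<lambda>\<omega>. y' \<omega> - z' \<omega>)" by (rule sqn_cong_AE[OF D(3)])
    then have 2: "enn2real (sqn w\<^sub>\<Omega> (fourier_L2 (\<lambda>t. x t - z t))) \<le> M\<^sub>\<Omega> * \<eta>"
      using bound[OF sqn_le_of_weight_le[OF pm(2) Vleb(2) O(2,3)] z(4) O(2)] by simp
    have "M\<^sub>T * \<eta> + M\<^sub>\<Omega> * \<eta> < (M\<^sub>T + M\<^sub>\<Omega> + 1) * \<eta>" using \<eta> by (simp add: distrib_right)
    also have "\<dots> = \<epsilon>\<^sup>2 / 2"
    proof -
      have "K * (\<epsilon>\<^sup>2 / (2 * K)) = \<epsilon>\<^sup>2 / 2" if "K > 0" for K :: real using that by simp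
      from this[OF Mpos] show ?thesis unfolding \<eta>_def .
    qed
    also have "\<dots> < \<epsilon>\<^sup>2" using \<epsilon> by simp
    finally have "enn2real (sqn w\<^sub>T (\<lambda>t. x t - z t)) + enn2real (sqn w\<^sub>\<Omega> (fourier_L2 (\<lambda>t. x t - z t))) < \<epsilon>\<^sup>2"
      using 1 2 by linarith
    then have "H_norm w\<^sub>T w\<^sub>\<Omega> (\<lambda>t. x t - z t) < \<epsilon>"
      unfolding H_norm_eq[OF w dm D(2)] using \<epsilon> by (intro real_less_lsqrt) auto
    then show ?thesis using z(1) by blast
  qed
  show ?thesis
    unfolding complete_in_H_def using P_gauss P_H span_P dense by blast
qed

end
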